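(* Let $\mathcal G$ be the ultragraph with vertex set $G^0=\{v\}\cup\{w_n:n\in\mathbb N\}$ (all listed vertices distinct), edge set $\mathcal G^1=\{e\}\cup\{e_n:n\in\mathbb N\}$ (all listed edges distinct), $s(e)=v$, $r(e)=A:=\{w_n:n\in\mathbb N\}$, and $s(e_n)=w_n$, $r(e_n)=\{w_n\}$ for each $n\in\mathbb N$. Let $K$ be a field. Then the ultragraph Leavitt path algebra $L_K(\mathcal G)$ is not isomorphic to the Leavitt path algebra $L_K(E)$ of any countable graph $E$. Likewise, the ultragraph $C^*$-algebra $C^*(\mathcal G)$ is not isomorphic to the graph $C^*$-algebra $C^*(E)$ of any countable graph $E$.
   Context: An ultragraph is a quadruple $\mathcal G=(G^0,\mathcal G^1,r,s)$ with $G^0$ a set of vertices, $\mathcal G^1$ a set of edges, $s:\mathcal G^1\to G^0$ and $r:\mathcal G^1\to\mathcal P(G^0)\setminus\{\emptyset\}$. $\mathcal G^0$ is the smallest collection of subsets of $G^0$ containing all singletons $\{v\}$ and all ranges $r(e)$ and closed under finite unions and finite intersections (with $\emptyset\in\mathcal G^0$). A vertex $v$ is regular if $0<|s^{-1}(v)|<\infty$. $L_K(\mathcal G)$ is the universal $K$-algebra generated by $\{s_e,s_e^*:e\in\mathcal G^1\}\cup\{p_A:A\in\mathcal G^0\}$ subject to: $p_\emptyset=0$, $p_Ap_B=p_{A\cap B}$, $p_{A\cup B}=p_A+p_B-p_{A\cap B}$; $p_{s(e)}s_e=s_ep_{r(e)}=s_e$ and $p_{r(e)}s_e^*=s_e^*p_{s(e)}=s_e^*$;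 $s_e^*s_f=\delta_{e,f}p_{r(e)}$; $p_v=\sum_{s(e)=v}s_es_e^*$ for every regular vertex $v$ (where $p_v:=p_{\{v\}}$). $C^*(\mathcal G)$ is the universal $C^*$-algebra generated by projections $p_A$ ($A\in\mathcal G^0$) and partial isometries $s_e$ ($e\in\mathcal G^1$) with mutually orthogonal ranges such that $p_\emptyset=0$, $p_Ap_B=p_{A\cap B}$, $p_{A\cup B}=p_A+p_B-p_{A\cap B}$, $s_e^*s_e=p_{r(e)}$, $s_es_e^*\le p_{s(e)}$, and $p_v=\sum_{s(e)=v}s_es_e^*$ for every regular $v$. A (directed) graph $E=(E^0,E^1,r,s)$ has range and source maps $r,s:E^1\to E^0$; it is countable if $E^0$ and $E^1$ are countable. It is regarded as the ultragraph with the same sources and with ranges $\{r(e)\}$; $L_K(E)$ and $C^*(E)$ are the corresponding algebras (the usual Leavitt path algebra and graph $C^*$-algebra, with relations $s_e^*s_f=\delta_{e,f}p_{r(e)}$ and $p_v=\sum_{s(e)=v}s_es_e^*$ for regular $v$). Isomorphism means isomorphism of $K$-algebras, respectively $*$-isomorphism of $C^*$-algebras. *)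

theory Defs
  imports
    Complex_Main
    "HOL-Library.Countable_Set"
    "HOL-Library.Poly_Mapping"
    "Graph_Theory.Digraph"
begin

section \<open>Ultragraphs\<close>

record ('v, 'e) ultragraph =
  uverts :: "'v set"
  uedges :: "'e set"
  usource :: "'e \<Rightarrow> 'v"
  urange :: "'e \<Rightarrow> 'v set"

definition wf_ultragraph :: "('v, 'e) ultragraph \<Rightarrow> bool" where
  "wf_ultragraph G \<longleftrightarrow>
     (\<forall>e\<in>uedges G. usource G e \<in> uverts G \<and> urange G e \<subseteq> uverts G \<and> urange G e \<noteq> {})"

inductive_set generalized_vertices :: "('v, 'e) ultragraph \<Rightarrow> 'v set set"
  for G :: "('v, 'e) ultragraph" where
  empty: "{} \<in> generalized_vertices G"
| vertex: "v \<in> uverts G \<Longrightarrow> {v} \<in> generalized_vertices G"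
| range: "e \<in> uedges G \<Longrightarrow> urange G e \<in> generalized_vertices G"
| union: "A \<in> generalized_vertices G \<Longrightarrow> B \<in> generalized_vertices G \<Longrightarrow>
    A \<union> B \<in> generalized_vertices G"
| inter: "A \<in> generalized_vertices G \<Longrightarrow> B \<in> generalized_vertices G \<Longrightarrow>
    A \<inter> B \<in> generalized_vertices G"

definition edges_from :: "('v, 'e) ultragraph \<Rightarrow> 'v \<Rightarrow> 'e set" where
  "edges_from G v = {e \<in> uedges G. usource G e = v}"

definition regular_vertices :: "('v, 'e) ultragraph \<Rightarrow> 'v set" where
  "regular_vertices G = {v \<in> uverts G. finite (edges_from G v) \<and> edges_from G v \<noteq> {}}"

definition ultragraph_of_graph :: "('v, 'e) pre_digraph \<Rightarrow> ('v, 'e) ultragraph" where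
  "ultragraph_of_graph E =
     \<lparr>uverts = verts E, uedges = arcs E, usource = tail E, urange = (\<lambda>e. {head E e})\<rparr>"

lemma wf_ultragraph_of_graph: "wf_digraph E \<Longrightarrow> wf_ultragraph (ultragraph_of_graph E)"
  by (auto simp: wf_ultragraph_def ultragraph_of_graph_def wf_digraph_def)


section \<open>Algebras without unit\<close>

record ('a, 'k) alg =
  Carrier :: "'a set"
  Add :: "'a \<Rightarrow> 'a \<Rightarrow> 'a"
  Mult :: "'a \<Rightarrow> 'a \<Rightarrow> 'a"
  Scale :: "'k \<Rightarrow> 'a \<Rightarrow> 'a"

record 'a normed_star_alg = "('a, complex) alg" +
  Star :: "'a \<Rightarrow> 'a"
  Norm :: "'a \<Rightarrow> real"

definition alg_isomorphism ::
    "('a, 'k, 'm) alg_scheme \<Rightarrow> ('b, 'k, 'n) alg_scheme \<Rightarrow> ('a \<Rightarrow> 'b) \<Rightarrow> bool" where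
  "alg_isomorphism A B f \<longleftrightarrow>
     bij_betw f (Carrier A) (Carrier B) \<and>
     (\<forall>x\<in>Carrier A. \<forall>y\<in>Carrier A. f (Add A x y) = Add B (f x) (f y)) \<and>
     (\<forall>x\<in>Carrier A. \<forall>y\<in>Carrier A. f (Mult A x y) = Mult B (f x) (f y)) \<and>
     (\<forall>c. \<forall>x\<in>Carrier A. f (Scale A c x) = Scale B c (f x))"

definition alg_isomorphic ::
    "('a, 'k, 'm) alg_scheme \<Rightarrow> ('b, 'k, 'n) alg_scheme \<Rightarrow> bool" where
  "alg_isomorphic A B \<longleftrightarrow> (\<exists>f. alg_isomorphism A B f)"

definition star_isomorphic :: "'a normed_star_alg \<Rightarrow> 'b normed_star_alg \<Rightarrow> bool" where
  "star_isomorphic A B \<longleftrightarrow>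
     (\<exists>f. alg_isomorphism A B f \<and> (\<forall>x\<in>Carrier A. f (Star A x) = Star B (f x)))"

text \<open>
  The operations on classes are meaningful when \<open>R\<close> is an equivalence relation on the carrier
  with which they are compatible.
\<close>

definition quotient_alg :: "('a, 'k) alg \<Rightarrow> ('a \<times> 'a) set \<Rightarrow> ('a set, 'k) alg" where
  "quotient_alg A R =
     \<lparr>Carrier = Carrier A // R,
      Add = (\<lambda>X Y. \<Union>x\<in>X. \<Union>y\<in>Y. R `` {Add A x y}),
      Mult = (\<lambda>X Y. \<Union>x\<in>X. \<Union>y\<in>Y. R `` {Mult A x y}),
      Scale = (\<lambda>c X. \<Union>x\<in>X. R `` {Scale A c x})\<rparr>"


section \<open>The free algebra on the generators\<close>

datatype 'g word = Word (letters: "'g list")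

instantiation word :: (type) monoid_add
begin

definition zero_word :: "'a word" where "0 = Word []"

definition plus_word :: "'a word \<Rightarrow> 'a word \<Rightarrow> 'a word" where
  "u + w = Word (letters u @ letters w)"

instance by standard (simp_all add: zero_word_def plus_word_def)

end

text \<open>
  Words form the free monoid, so that \<open>'g word \<Rightarrow>\<^sub>0 'k\<close> with its convolution
  product is the free unital algebra on \<open>'g\<close>.
\<close>

datatype ('v, 'e) letter = Proj "'v set" | Edge 'e | Ghost 'e

type_synonym ('v, 'e, 'k) free = "('v, 'e) letter word \<Rightarrow>\<^sub>0 'k"

definition pr :: "'v set \<Rightarrow> ('v, 'e, 'k::field) free" where
  "pr A = Poly_Mapping.single (Word [Proj A]) 1"

definition ed :: "'e \<Rightarrow> ('v, 'e, 'k::field) free" where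
  "ed e = Poly_Mapping.single (Word [Edge e]) 1"

definition gh :: "'e \<Rightarrow> ('v, 'e, 'k::field) free" where
  "gh e = Poly_Mapping.single (Word [Ghost e]) 1"

definition generators :: "('v, 'e) ultragraph \<Rightarrow> ('v, 'e) letter set" where
  "generators G = Proj ` generalized_vertices G \<union> Edge ` uedges G \<union> Ghost ` uedges G"

text \<open>
  The algebras are not assumed to be unital: the empty word is excluded.
\<close>

definition free_carrier :: "('v, 'e) ultragraph \<Rightarrow> ('v, 'e, 'k::field) free set" where
  "free_carrier G =
     {x. \<forall>w\<in>Poly_Mapping.keys x. letters w \<noteq> [] \<and> set (letters w) \<subseteq> generators G}"

definition scale :: "'k \<Rightarrow> ('v, 'e, 'k::field) free \<Rightarrow> ('v, 'e, 'k) free" where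
  "scale c x = Poly_Mapping.map ((*) c) x"

definition free_alg :: "('v, 'e) ultragraph \<Rightarrow> (('v, 'e, 'k::field) free, 'k) alg" where
  "free_alg G = \<lparr>Carrier = free_carrier G, Add = (+), Mult = (*), Scale = scale\<rparr>"


section \<open>Ultragraph Leavitt path algebras\<close>

text \<open>A pair \<open>(x, y)\<close> stands for the defining relation \<open>x = y\<close>.\<close>

definition leavitt_relations ::
    "('v, 'e) ultragraph \<Rightarrow> (('v, 'e, 'k::field) free \<times> ('v, 'e, 'k) free) set" where
  "leavitt_relations G =
     {(pr {}, 0)}
   \<union> {(pr A * pr B, pr (A \<inter> B)) | A B.
        A \<in> generalized_vertices G \<and> B \<in> generalized_vertices G}
   \<union> {(pr (A \<union> B), pr A + pr B - pr (A \<inter> B)) | A B.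
        A \<in> generalized_vertices G \<and> B \<in> generalized_vertices G}
   \<union> {(pr {usource G e} * ed e, ed e) | e. e \<in> uedges G}
   \<union> {(ed e * pr (urange G e), ed e) | e. e \<in> uedges G}
   \<union> {(pr (urange G e) * gh e, gh e) | e. e \<in> uedges G}
   \<union> {(gh e * pr {usource G e}, gh e) | e. e \<in> uedges G}
   \<union> {(gh e * ed f, if e = f then pr (urange G e) else 0) | e f.
        e \<in> uedges G \<and> f \<in> uedges G}
   \<union> {(pr {v}, \<Sum>e\<in>edges_from G v. ed e * gh e) | v. v \<in> regular_vertices G}"

inductive_set leavitt_ideal :: "('v, 'e) ultragraph \<Rightarrow> ('v, 'e, 'k::field) free set"
  for G :: "('v, 'e) ultragraph" where
  zero: "0 \<in> leavitt_ideal G"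
| relation: "(x, y) \<in> leavitt_relations G \<Longrightarrow> x - y \<in> leavitt_ideal G"
| add: "x \<in> leavitt_ideal G \<Longrightarrow> y \<in> leavitt_ideal G \<Longrightarrow> x + y \<in> leavitt_ideal G"
| scale: "x \<in> leavitt_ideal G \<Longrightarrow> scale c x \<in> leavitt_ideal G"
| left: "a \<in> free_carrier G \<Longrightarrow> x \<in> leavitt_ideal G \<Longrightarrow> a * x \<in> leavitt_ideal G"
| right: "x \<in> leavitt_ideal G \<Longrightarrow> a \<in> free_carrier G \<Longrightarrow> x * a \<in> leavitt_ideal G"

definition leavitt_cong ::
    "('v, 'e) ultragraph \<Rightarrow> (('v, 'e, 'k::field) free \<times> ('v, 'e, 'k) free) set" where
  "leavitt_cong G =
     {(x, y). x \<in> free_carrier G \<and> y \<in> free_carrier G \<and> x - y \<in> leavitt_ideal G}"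

definition ultragraph_leavitt_algebra ::
    "'k::field itself \<Rightarrow> ('v, 'e) ultragraph \<Rightarrow> (('v, 'e, 'k) free set, 'k) alg" where
  "ultragraph_leavitt_algebra _ G = quotient_alg (free_alg G) (leavitt_cong G)"

definition leavitt_path_algebra ::
    "'k::field itself \<Rightarrow> ('v, 'e) pre_digraph \<Rightarrow> (('v, 'e, 'k) free set, 'k) alg" where
  "leavitt_path_algebra K E = ultragraph_leavitt_algebra K (ultragraph_of_graph E)"


section \<open>Ultragraph C*-algebras\<close>

text \<open>
  With complex coefficients the free algebra is the free *-algebra on self-adjoint generators
  \<open>p\<^sub>A\<close> and generators \<open>s\<^sub>e\<close> with adjoints \<open>s\<^sub>e\<^sup>*\<close>: the involution reverses
  words, fixes \<open>Proj A\<close>, exchanges \<open>Edge e\<close> and \<open>Ghost e\<close>, and conjugates coefficients.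
\<close>

fun star_letter :: "('v, 'e) letter \<Rightarrow> ('v, 'e) letter" where
  "star_letter (Proj A) = Proj A"
| "star_letter (Edge e) = Ghost e"
| "star_letter (Ghost e) = Edge e"

definition star_word :: "('v, 'e) letter word \<Rightarrow> ('v, 'e) letter word" where
  "star_word w = Word (rev (map star_letter (letters w)))"

definition star :: "('v, 'e, complex) free \<Rightarrow> ('v, 'e, complex) free" where
  "star x = Poly_Mapping.map cnj (Poly_Mapping.map_key star_word x)"

text \<open>
  \<open>s\<^sub>e s\<^sub>e\<^sup>*\<close> and \<open>p\<^sub>A\<close> are projections, and for projections \<open>q \<le> p\<close> means
  \<open>p q = q\<close>. Ranges of partial isometries are orthogonal when the range projections
  \<open>s\<^sub>e s\<^sub>e\<^sup>*\<close> are.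
\<close>

definition cstar_relations ::
    "('v, 'e) ultragraph \<Rightarrow> (('v, 'e, complex) free \<times> ('v, 'e, complex) free) set" where
  "cstar_relations G =
     {(star (pr A), pr A) | A. A \<in> generalized_vertices G}
   \<union> {(pr A * pr A, pr A) | A. A \<in> generalized_vertices G}
   \<union> {(ed e * star (ed e) * ed e, ed e) | e. e \<in> uedges G}
   \<union> {((ed e * star (ed e)) * (ed f * star (ed f)), 0) | e f.
        e \<in> uedges G \<and> f \<in> uedges G \<and> e \<noteq> f}
   \<union> {(pr {}, 0)}
   \<union> {(pr A * pr B, pr (A \<inter> B)) | A B.
        A \<in> generalized_vertices G \<and> B \<in> generalized_vertices G}
   \<union> {(pr (A \<union> B), pr A + pr B - pr (A \<inter> B)) | A B.
        A \<in> generalized_vertices G \<and> B \<in> generalized_vertices G}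
   \<union> {(star (ed e) * ed e, pr (urange G e)) | e. e \<in> uedges G}
   \<union> {(pr {usource G e} * (ed e * star (ed e)), ed e * star (ed e)) | e. e \<in> uedges G}
   \<union> {(pr {v}, \<Sum>e\<in>edges_from G v. ed e * star (ed e)) | v. v \<in> regular_vertices G}"

text \<open>
  A *-homomorphism from the free *-algebra to a C*-algebra respecting the relations pulls back
  the norm to a C*-seminorm as below; conversely every such seminorm arises in this way, from
  the Hausdorff completion. So the universal C*-algebra is the Hausdorff completion for the
  supremum of these seminorms. On \<open>free_carrier G\<close> the supremum is finite, since the relations
  and the C*-identity bound each seminorm by 1 on generators.
\<close>

definition cstar_seminorm ::
    "('v, 'e) ultragraph \<Rightarrow> (('v, 'e, complex) free \<Rightarrow> real) \<Rightarrow> bool" where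
  "cstar_seminorm G p \<longleftrightarrow>
     (\<forall>x\<in>free_carrier G. 0 \<le> p x) \<and>
     (\<forall>x\<in>free_carrier G. \<forall>y\<in>free_carrier G. p (x + y) \<le> p x + p y) \<and>
     (\<forall>c. \<forall>x\<in>free_carrier G. p (scale c x) = cmod c * p x) \<and>
     (\<forall>x\<in>free_carrier G. \<forall>y\<in>free_carrier G. p (x * y) \<le> p x * p y) \<and>
     (\<forall>x\<in>free_carrier G. p (star x * x) = (p x)\<^sup>2) \<and>
     (\<forall>(x, y)\<in>cstar_relations G. p (x - y) = 0)"

definition universal_norm :: "('v, 'e) ultragraph \<Rightarrow> ('v, 'e, complex) free \<Rightarrow> real" where
  "universal_norm G x = (SUP p\<in>Collect (cstar_seminorm G). p x)"

definition cauchy_alg ::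
    "('v, 'e) ultragraph \<Rightarrow> (nat \<Rightarrow> ('v, 'e, complex) free, complex) alg" where
  "cauchy_alg G =
     \<lparr>Carrier = {x. (\<forall>n. x n \<in> free_carrier G) \<and>
        (\<forall>\<epsilon>>0. \<exists>M. \<forall>m\<ge>M. \<forall>n\<ge>M. universal_norm G (x m - x n) < \<epsilon>)},
      Add = (\<lambda>x y n. x n + y n),
      Mult = (\<lambda>x y n. x n * y n),
      Scale = (\<lambda>c x n. scale c (x n))\<rparr>"

definition null_cong ::
    "('v, 'e) ultragraph \<Rightarrow>
      ((nat \<Rightarrow> ('v, 'e, complex) free) \<times> (nat \<Rightarrow> ('v, 'e, complex) free)) set" where
  "null_cong G =
     {(x, y). x \<in> Carrier (cauchy_alg G) \<and> y \<in> Carrier (cauchy_alg G) \<and>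
        (\<lambda>n. universal_norm G (x n - y n)) \<longlonglongrightarrow> 0}"

definition ultragraph_cstar_algebra ::
    "('v, 'e) ultragraph \<Rightarrow> (nat \<Rightarrow> ('v, 'e, complex) free) set normed_star_alg" where
  "ultragraph_cstar_algebra G =
     alg.extend (quotient_alg (cauchy_alg G) (null_cong G))
       (normed_star_alg.fields
         (\<lambda>X. \<Union>x\<in>X. null_cong G `` {\<lambda>n. star (x n)})
         (\<lambda>X. THE r. \<forall>x\<in>X. (\<lambda>n. universal_norm G (x n)) \<longlonglongrightarrow> r))"

definition graph_cstar_algebra ::
    "('v, 'e) pre_digraph \<Rightarrow> (nat \<Rightarrow> ('v, 'e, complex) free) set normed_star_alg" where
  "graph_cstar_algebra E = ultragraph_cstar_algebra (ultragraph_of_graph E)"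


section \<open>The ultragraph of the statement\<close>

datatype vertex = V | W nat

datatype edge = E0 | En nat

definition ultragraph_G :: "(vertex, edge) ultragraph" where
  "ultragraph_G =
     \<lparr>uverts = {V} \<union> {W n | n. True},
      uedges = {E0} \<union> {En n | n. True},
      usource = (\<lambda>d. case d of E0 \<Rightarrow> V | En n \<Rightarrow> W n),
      urange = (\<lambda>d. case d of E0 \<Rightarrow> {W n | n. True} | En n \<Rightarrow> {W n})\<rparr>"

lemma wf_ultragraph_G: "wf_ultragraph ultragraph_G"
  by (auto simp: wf_ultragraph_def ultragraph_G_def)

end

theory Submission
  imports "HOL-Library.Function_Algebras" "HOL-Analysis.Euclidean_Space" "HOL-Analysis.Operator_Norm" Defs
begin

text \<open>
  Since \<open>p\<^sub>v = s\<^sub>e s\<^sub>e\<^sup>*\<close> and \<open>p\<^sub>A = s\<^sub>e\<^sup>* s\<^sub>e\<close>, both algebras of the ultragraph are unital and consist of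
  two by two matrices over the commutative corner at \<open>p\<^sub>A\<close>. So they satisfy Hall's identity
  \<open>[[x, y]\<^sup>2, z] = 0\<close>, which excludes three orthogonal equivalent nonzero idempotents. For a graph
  algebra with these two properties, all but finitely many vertex projections vanish, and at most
  two edges end at a vertex with nonzero projection: up to zero generators the graph is finite.

  For Leavitt path algebras this contradicts that \<open>L\<^sub>K(G)\<close> is not finitely generated: the
  representations at the vertices \<open>w\<^sub>n\<close> are eventually constant on each element, hence would be so
  uniformly, but \<open>p\<close> at \<open>w\<^sub>n\<close> is only seen by the \<open>n\<close>-th one.

  The C*-algebra of the ultragraph has infinitely many orthogonal nonzero central projections.
  In the C*-algebra of a finite graph, a central idempotent commutes with its images under the
  gauge action, which depend continuously on the parameter; as commuting idempotents at distance less
  than 1 coincide, it is gauge invariant, and so it is approximated by elements of degree 0. Compressing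
  such an element by a long path ending at \<open>u\<close> gives a multiple of \<open>p\<^sub>u\<close>, and compressing it by
  \<open>q\<^sub>u = p\<^sub>u - \<Sum> s\<^sub>f s\<^sub>f\<^sup>*\<close> (over the edges \<open>f\<close> from \<open>u\<close>) gives a multiple of \<open>q\<^sub>u\<close>. So among
  orthogonal central idempotents at most one is nonzero on each of these finitely many corners, while
  a nonzero one is nonzero on some corner.
\<close>

section \<open>Quotients by ideals\<close>

text \<open>Hall's identity is polynomial, so it survives isomorphism, quotients and completion,
  which is how the matrix structure reaches the graph algebra. Nothing guarantees in advance that
  generators of a graph algebra are nonzero, and no faithful representation of it is constructed;
  the argument runs modulo the generators that vanish, hence finiteness is claimed only for
  essential vertices and edges. The finite generation argument does not carry over to the
  C*-algebra: norm limits of eventually constant families are merely convergent, and topological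
  generation by finitely many elements yields no common index. Central idempotents replace it,
  because commuting idempotents cannot be close without being equal. The congruence calculus is set
  up for an arbitrary ideal since it serves four cases: the Leavitt ideal, the null ideal of a
  seminorm, the null ideal of the universal norm, and the null sequences among the Cauchy sequences.
  Computations use representatives instead of classes.\<close>

locale ideal_of =
  fixes S J :: "'a::ring set" and sc :: "'k::field \<Rightarrow> 'a \<Rightarrow> 'a"
  assumes S_zero: "0 \<in> S"
    and S_add: "x \<in> S \<Longrightarrow> y \<in> S \<Longrightarrow> x + y \<in> S"
    and S_mult: "x \<in> S \<Longrightarrow> y \<in> S \<Longrightarrow> x * y \<in> S"
    and S_scale: "x \<in> S \<Longrightarrow> sc c x \<in> S"
    and scale_minus_one: "sc (- 1) x = - x"
    and scale_diff: "sc c (x - y) = sc c x - sc c y"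
    and J_subset: "J \<subseteq> S"
    and J_zero: "0 \<in> J"
    and J_add: "x \<in> J \<Longrightarrow> y \<in> J \<Longrightarrow> x + y \<in> J"
    and J_scale: "x \<in> J \<Longrightarrow> sc c x \<in> J"
    and J_left: "a \<in> S \<Longrightarrow> x \<in> J \<Longrightarrow> a * x \<in> J"
    and J_right: "x \<in> J \<Longrightarrow> a \<in> S \<Longrightarrow> x * a \<in> J"
begin

text \<open>Membership of both sides in \<open>S\<close> is part of the relation, so chains of
  congruences carry their own carrier conditions and \<open>x \<approx> 0\<close> means exactly
  \<open>x \<in> J\<close>.\<close>

definition cong :: "'a \<Rightarrow> 'a \<Rightarrow> bool" (infix "\<approx>" 50) where
  "x \<approx> y \<longleftrightarrow> x \<in> S \<and> y \<in> S \<and> x - y \<in> J"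

lemma S_uminus: "x \<in> S \<Longrightarrow> - x \<in> S"
  using S_scale[of x "- 1"] by (simp add: scale_minus_one)

lemma S_diff: "x \<in> S \<Longrightarrow> y \<in> S \<Longrightarrow> x - y \<in> S"
  using S_add[of x "- y"] S_uminus by simp

lemma J_uminus: "x \<in> J \<Longrightarrow> - x \<in> J"
  using J_scale[of x "- 1"] by (simp add: scale_minus_one)

lemma J_diff: "x \<in> J \<Longrightarrow> y \<in> J \<Longrightarrow> x - y \<in> J"
  using J_add[of x "- y"] J_uminus by simp

lemma cong_S: "x \<approx> y \<Longrightarrow> x \<in> S" "x \<approx> y \<Longrightarrow> y \<in> S"
  by (auto simp: cong_def)

lemma cong_refl: "x \<in> S \<Longrightarrow> x \<approx> x"
  by (simp add: cong_def J_zero)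

lemma cong_sym: "x \<approx> y \<Longrightarrow> y \<approx> x"
  using J_uminus[of "x - y"] by (simp add: cong_def)

lemma cong_trans [trans]: "x \<approx> y \<Longrightarrow> y \<approx> z \<Longrightarrow> x \<approx> z"
  using J_add[of "x - y" "y - z"] by (simp add: cong_def)

lemma cong_add: "x \<approx> x' \<Longrightarrow> y \<approx> y' \<Longrightarrow> x + y \<approx> x' + y'"
  using J_add[of "x - x'" "y - y'"] by (simp add: cong_def S_add algebra_simps)

lemma cong_diff: "x \<approx> x' \<Longrightarrow> y \<approx> y' \<Longrightarrow> x - y \<approx> x' - y'"
  using J_diff[of "x - x'" "y - y'"] by (simp add: cong_def S_diff algebra_simps)

lemma cong_uminus: "x \<approx> x' \<Longrightarrow> - x \<approx> - x'"
  using J_uminus[of "x - x'"] by (simp add: cong_def S_uminus)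

lemma cong_mult: "x \<approx> x' \<Longrightarrow> y \<approx> y' \<Longrightarrow> x * y \<approx> x' * y'"
  using J_add[OF J_right[of "x - x'" y] J_left[of x' "y - y'"]]
  by (simp add: cong_def S_mult algebra_simps)

lemma cong_scale: "x \<approx> x' \<Longrightarrow> sc c x \<approx> sc c x'"
  using J_scale[of "x - x'" c] by (simp add: cong_def S_scale scale_diff)

lemma cong_sum: "(\<And>i. i \<in> I \<Longrightarrow> f i \<approx> g i) \<Longrightarrow> sum f I \<approx> sum g I"
  by (induction I rule: infinite_finite_induct) (auto intro: cong_add cong_refl S_zero)

lemma S_sum: "(\<And>i. i \<in> I \<Longrightarrow> f i \<in> S) \<Longrightarrow> sum f I \<in> S"
  by (induction I rule: infinite_finite_induct) (auto intro: S_add S_zero)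

lemma cong_0_iff: "x \<approx> 0 \<longleftrightarrow> x \<in> J"
  using J_subset by (auto simp: cong_def S_zero)

lemma cong_left: "a \<in> S \<Longrightarrow> x \<approx> y \<Longrightarrow> a * x \<approx> a * y"
  by (intro cong_mult cong_refl)

lemma cong_right: "x \<approx> y \<Longrightarrow> a \<in> S \<Longrightarrow> x * a \<approx> y * a"
  by (intro cong_mult cong_refl)

lemma cong_J_iff: "x \<approx> y \<Longrightarrow> x \<in> J \<longleftrightarrow> y \<in> J"
  using cong_trans[of x y 0] cong_trans[of y x 0] cong_sym[of x y] by (auto simp: cong_0_iff)

lemma cong_eq_trans [trans]: "x \<approx> y \<Longrightarrow> y = z \<Longrightarrow> x \<approx> z" "x = y \<Longrightarrow> y \<approx> z \<Longrightarrow> x \<approx> z"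
  by simp_all

lemma cong_self_zero: "x \<approx> y \<Longrightarrow> x - y \<in> J"
  by (simp add: cong_def)

section \<open>Passage to the quotient algebra\<close>

definition R :: "('a \<times> 'a) set" where
  "R = {(x, y). x \<in> S \<and> y \<in> S \<and> x - y \<in> J}"

lemma R_iff: "(x, y) \<in> R \<longleftrightarrow> x \<approx> y"
  by (simp add: R_def cong_def)

lemma equiv_R: "equiv S R"
proof (rule equivI)
  show "R \<subseteq> S \<times> S"
    by (auto simp: R_def)
  show "refl_on S R"
    by (simp add: refl_on_def R_iff cong_refl)
  show "sym R"
    using cong_sym by (simp add: sym_def R_iff)
  show "trans R"
    using cong_trans unfolding trans_def R_iff by blast
qed

lemma class_eq_iff: "x \<in> S \<Longrightarrow> y \<in> S \<Longrightarrow> R `` {x} = R `` {y} \<longleftrightarrow> x \<approx> y"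
  using eq_equiv_class_iff[OF equiv_R] by (simp add: R_iff)

text \<open>\<open>quotient_alg\<close> defines its operations as unions over all representatives;
  for a compatible operation every member of the union is the same class.\<close>

lemma class_op1:
  assumes "x \<in> S" and "\<And>x'. x \<approx> x' \<Longrightarrow> f x \<approx> f x'"
  shows "(\<Union>x'\<in>R `` {x}. R `` {f x'}) = R `` {f x}"
proof -
  have eq: "R `` {f x'} = R `` {f x}" if "x \<approx> x'" for x'
    using cong_sym[OF assms(2)[OF that]] by (simp add: class_eq_iff cong_S[OF assms(2)[OF that]])
  show ?thesis
    using assms(1) by (intro UN_constant_eq[where a = x] ballI eq) (auto simp: R_iff cong_refl)
qed

lemma class_op2:
  assumes "x \<in> S" "y \<in> S" and "\<And>x' y'. x \<approx> x' \<Longrightarrow> y \<approx> y' \<Longrightarrow> f x y \<approx> f x' y'"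
  shows "(\<Union>x'\<in>R `` {x}. \<Union>y'\<in>R `` {y}. R `` {f x' y'}) = R `` {f x y}"
proof -
  have eq: "R `` {f x' y'} = R `` {f x y}" if "x \<approx> x'" "y \<approx> y'" for x' y'
    using cong_sym[OF assms(3)[OF that]] by (simp add: class_eq_iff cong_S[OF assms(3)[OF that]])
  show ?thesis
    using assms(1,2)
    by (intro UN_constant_eq[where a = x] UN_constant_eq[where a = y] ballI eq)
      (auto simp: R_iff cong_refl)
qed

definition quot :: "('a set, 'k) alg" where
  "quot = quotient_alg \<lparr>Carrier = S, Add = (+), Mult = (*), Scale = sc\<rparr> R"

lemma quot_Carrier: "X \<in> Carrier quot \<longleftrightarrow> (\<exists>x\<in>S. X = R `` {x})"
  by (auto simp: quot_def quotient_alg_def quotient_def)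

lemma quot_ops:
  assumes "x \<in> S" "y \<in> S"
  shows "Add quot (R `` {x}) (R `` {y}) = R `` {x + y}"
    and "Mult quot (R `` {x}) (R `` {y}) = R `` {x * y}"
    and "Scale quot c (R `` {x}) = R `` {sc c x}"
  using assms
  by (simp_all add: quot_def quotient_alg_def class_op1 class_op2 cong_add cong_mult cong_scale)

end

text \<open>\<open>rel x y\<close>: an isomorphism of the quotients maps the class of \<open>x\<close> to the class of \<open>y\<close>.\<close>

locale correspondence = A: ideal_of S J sc + B: ideal_of S' J' sc'
  for S J :: "'a::ring set" and sc :: "'k::field \<Rightarrow> 'a \<Rightarrow> 'a"
    and S' J' :: "'b::ring set" and sc' :: "'k \<Rightarrow> 'b \<Rightarrow> 'b" +
  fixes rel :: "'a \<Rightarrow> 'b \<Rightarrow> bool"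
  assumes rel_S: "rel x y \<Longrightarrow> x \<in> S \<and> y \<in> S'"
    and rel_total: "x \<in> S \<Longrightarrow> \<exists>y. rel x y"
    and rel_surj: "y \<in> S' \<Longrightarrow> \<exists>x. rel x y"
    and rel_add: "rel x y \<Longrightarrow> rel x' y' \<Longrightarrow> rel (x + x') (y + y')"
    and rel_mult: "rel x y \<Longrightarrow> rel x' y' \<Longrightarrow> rel (x * x') (y * y')"
    and rel_scale: "rel x y \<Longrightarrow> rel (sc c x) (sc' c y)"
    and rel_cong: "rel x y \<Longrightarrow> rel x' y' \<Longrightarrow> x - x' \<in> J \<longleftrightarrow> y - y' \<in> J'"
begin

lemma rel_diff: "rel x y \<Longrightarrow> rel x' y' \<Longrightarrow> rel (x - x') (y - y')"
  using rel_add[of x y "- x'" "- y'"] rel_scale[of x' y' "- 1"]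
  by (simp add: A.scale_minus_one B.scale_minus_one)

text \<open>Zero corresponds to zero up to the ideals, because \<open>x - x\<close> corresponds to
  \<open>y - y\<close>; comparing with it turns congruence into membership.\<close>

lemma rel_J: "rel x y \<Longrightarrow> x \<in> J \<longleftrightarrow> y \<in> J'"
  using rel_cong[OF _ rel_diff[of x y x y]] by simp

end

text \<open>An isomorphism is pulled back to representatives: \<open>x\<close> and \<open>y\<close>
  are related when \<open>f\<close> maps the class of \<open>x\<close> to the class of
  \<open>y\<close>. Bijectivity of \<open>f\<close> yields totality, surjectivity and, through
  injectivity, \<open>rel_cong\<close>.\<close>

lemma correspondence_exists:
  assumes "ideal_of S J sc" and "ideal_of S' J' sc'"
    and "alg_isomorphism (ideal_of.quot S J sc) (ideal_of.quot S' J' sc') f"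
  shows "\<exists>rel. correspondence S J sc S' J' sc' rel"
proof -
  interpret A: ideal_of S J sc by fact
  interpret B: ideal_of S' J' sc' by fact
  define rel where "rel x y \<longleftrightarrow> x \<in> S \<and> y \<in> S' \<and> f (A.R `` {x}) = B.R `` {y}" for x y
  have bij: "bij_betw f (Carrier A.quot) (Carrier B.quot)"
    and add: "\<And>X Y. X \<in> Carrier A.quot \<Longrightarrow> Y \<in> Carrier A.quot \<Longrightarrow>
      f (Add A.quot X Y) = Add B.quot (f X) (f Y)"
    and mult: "\<And>X Y. X \<in> Carrier A.quot \<Longrightarrow> Y \<in> Carrier A.quot \<Longrightarrow>
      f (Mult A.quot X Y) = Mult B.quot (f X) (f Y)"
    and scale: "\<And>c X. X \<in> Carrier A.quot \<Longrightarrow> f (Scale A.quot c X) = Scale B.quot c (f X)"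
    using assms(3) by (auto simp: alg_isomorphism_def)
  have cl: "A.R `` {x} \<in> Carrier A.quot" if "x \<in> S" for x
    using that A.quot_Carrier by blast
  have "correspondence S J sc S' J' sc' rel"
  proof
    show "x \<in> S \<and> y \<in> S'" if "rel x y" for x y
      using that by (simp add: rel_def)
    show "\<exists>y. rel x y" if "x \<in> S" for x
      using bij_betwE[OF bij] cl[OF that] B.quot_Carrier that unfolding rel_def by blast
    show "\<exists>x. rel x y" if "y \<in> S'" for y
    proof -
      have "B.R `` {y} \<in> f ` Carrier A.quot"
        using that bij B.quot_Carrier unfolding bij_betw_def by blast
      then show ?thesis
        using A.quot_Carrier that unfolding rel_def by force
    qed
    show "rel (x + x') (y + y')" "rel (x * x') (y * y')" if "rel x y" "rel x' y'" for x y x' y'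
      using that add[OF cl[of x] cl[of x']] mult[OF cl[of x] cl[of x']]
      by (auto simp: rel_def A.quot_ops B.quot_ops A.S_add B.S_add A.S_mult B.S_mult)
    show "rel (sc c x) (sc' c y)" if "rel x y" for x y c
      using that scale[OF cl[of x], of c]
      by (auto simp: rel_def A.quot_ops[of x x] B.quot_ops[of y y] A.S_scale B.S_scale)
    show "x - x' \<in> J \<longleftrightarrow> y - y' \<in> J'" if "rel x y" "rel x' y'" for x y x' y'
    proof -
      have S: "x \<in> S" "x' \<in> S" "y \<in> S'" "y' \<in> S'"
        using that by (auto simp: rel_def)
      have "x - x' \<in> J \<longleftrightarrow> A.R `` {x} = A.R `` {x'}"
        using S by (simp add: A.class_eq_iff A.cong_def)
      also have "\<dots> \<longleftrightarrow> f (A.R `` {x}) = f (A.R `` {x'})"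
        using inj_onD[OF bij_betw_imp_inj_on[OF bij] _ cl[OF S(1)] cl[OF S(2)]] by metis
      also have "\<dots> \<longleftrightarrow> B.R `` {y} = B.R `` {y'}"
        using that by (simp add: rel_def)
      also have "\<dots> \<longleftrightarrow> y - y' \<in> J'"
        using S by (simp add: B.class_eq_iff B.cong_def)
      finally show ?thesis .
    qed
  qed
  then show ?thesis by blast
qed


section \<open>The free algebra\<close>

text \<open>Treats the three kinds of generators alike, so that inductions need a single generator
  case.\<close>

definition gen :: "('v, 'e) letter \<Rightarrow> ('v, 'e, 'k::field) free" where
  "gen g = Poly_Mapping.single (Word [g]) 1"

lemma pr_gen: "pr A = gen (Proj A)"
  and ed_gen: "ed e = gen (Edge e)"
  and gh_gen: "gh e = gen (Ghost e)"
  by (simp_all add: pr_def ed_def gh_def gen_def)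

lemma lookup_scale [simp]: "Poly_Mapping.lookup (scale c x) w = c * Poly_Mapping.lookup x w"
  by (simp add: scale_def Poly_Mapping.map.rep_eq when_def)

lemma scale_single [simp]: "scale c (Poly_Mapping.single w d) = Poly_Mapping.single w (c * d)"
  by (rule poly_mapping_eqI) (simp add: lookup_single when_def)

lemma scale_add: "scale c (x + y) = scale c x + scale c y"
  by (rule poly_mapping_eqI) (simp add: lookup_add algebra_simps)

lemma scale_diff: "scale c (x - y) = scale c x - scale c y"
  by (rule poly_mapping_eqI) (simp add: lookup_minus algebra_simps)

lemma scale_minus_one: "scale (- 1) x = - x"
  by (rule poly_mapping_eqI) simp

lemma scale_one [simp]: "scale 1 x = x"
  by (rule poly_mapping_eqI) simp

lemma scale_zero_left [simp]: "scale 0 x = 0"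
  by (rule poly_mapping_eqI) simp

lemma scale_zero_right [simp]: "scale c 0 = 0"
  by (rule poly_mapping_eqI) simp

lemma scale_scale: "scale c (scale d x) = scale (c * d) x"
  by (rule poly_mapping_eqI) (simp add: mult.assoc)

lemma sum_monomials:
  "(\<Sum>w\<in>Poly_Mapping.keys x. Poly_Mapping.single w (Poly_Mapping.lookup x w)) = x"
  by (rule poly_mapping_eqI) (auto simp: lookup_sum lookup_single when_def sum.delta in_keys_iff)

text \<open>The last case remembers that \<open>w\<close> is a word of \<open>x\<close>, so bounds
  on the degree or the length of the words of a fixed element stay available in the
  induction.\<close>

lemma free_induct [case_names zero add single]:
  fixes x :: "('v, 'e, 'k::field) free"
  assumes "P 0" and "\<And>x y. P x \<Longrightarrow> P y \<Longrightarrow> P (x + y)"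
    and "\<And>w c. w \<in> Poly_Mapping.keys x \<Longrightarrow> P (Poly_Mapping.single w c)"
  shows "P x"
proof -
  have "P (\<Sum>w\<in>I. Poly_Mapping.single w (Poly_Mapping.lookup x w))"
    if "finite I" "I \<subseteq> Poly_Mapping.keys x" for I
    using that by (induction I rule: finite_induct) (auto intro: assms)
  from this[OF finite_keys order_refl] show ?thesis
    by (simp add: sum_monomials)
qed

lemma scale_mult_left: "scale c (x * y) = scale c x * y"
  by (simp add: scale_def mult_map_scale_conv_mult mult.assoc)

lemma scale_mult_right: "scale c (x * y) = x * scale c y"
proof -
  have "Poly_Mapping.single 0 c * x = x * Poly_Mapping.single 0 c"
    by (induction x rule: free_induct) (simp_all add: algebra_simps mult_single)
  then show ?thesis
    by (simp add: scale_def mult_map_scale_conv_mult mult.assoc[symmetric])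
qed

lemma word_Cons: "Poly_Mapping.single (Word (g # ls)) 1 = gen g * Poly_Mapping.single (Word ls) 1"
  by (simp add: gen_def mult_single plus_word_def)

lemma free_carrier_0: "0 \<in> free_carrier G"
  by (simp add: free_carrier_def)

lemma free_carrier_single:
  "letters w \<noteq> [] \<Longrightarrow> set (letters w) \<subseteq> generators G \<Longrightarrow> Poly_Mapping.single w c \<in> free_carrier G"
  by (simp add: free_carrier_def)

lemma free_carrier_add: "x \<in> free_carrier G \<Longrightarrow> y \<in> free_carrier G \<Longrightarrow> x + y \<in> free_carrier G"
  using Poly_Mapping.keys_add[of x y] by (auto simp: free_carrier_def)

lemma free_carrier_scale: "x \<in> free_carrier G \<Longrightarrow> scale c x \<in> free_carrier G"
  by (auto simp: free_carrier_def in_keys_iff)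

lemma free_carrier_mult: "x \<in> free_carrier G \<Longrightarrow> y \<in> free_carrier G \<Longrightarrow> x * y \<in> free_carrier G"
  using Poly_Mapping.keys_mult[of x y] by (fastforce simp: free_carrier_def plus_word_def)

lemma free_carrier_uminus: "x \<in> free_carrier G \<Longrightarrow> - x \<in> free_carrier G"
  using free_carrier_scale[of x G "- 1"] by (simp add: scale_minus_one)

lemma free_carrier_diff: "x \<in> free_carrier G \<Longrightarrow> y \<in> free_carrier G \<Longrightarrow> x - y \<in> free_carrier G"
  using free_carrier_add[of x G "- y"] free_carrier_uminus[of y G] by simp

lemma free_carrier_sum: "(\<And>i. i \<in> I \<Longrightarrow> f i \<in> free_carrier G) \<Longrightarrow> sum f I \<in> free_carrier G"
  by (induction I rule: infinite_finite_induct) (auto intro: free_carrier_0 free_carrier_add)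

lemma free_carrier_gen: "g \<in> generators G \<Longrightarrow> gen g \<in> free_carrier G"
  by (simp add: gen_def free_carrier_single)

lemma free_carrier_pr: "A \<in> generalized_vertices G \<Longrightarrow> pr A \<in> free_carrier G"
  and free_carrier_ed: "e \<in> uedges G \<Longrightarrow> ed e \<in> free_carrier G"
  and free_carrier_gh: "e \<in> uedges G \<Longrightarrow> gh e \<in> free_carrier G"
  by (auto simp: pr_gen ed_gen gh_gen generators_def intro!: free_carrier_gen)

lemmas free_carrier_intros = free_carrier_0 free_carrier_add free_carrier_mult free_carrier_scale
  free_carrier_diff free_carrier_uminus free_carrier_pr free_carrier_ed free_carrier_gh
  free_carrier_sum free_carrier_gen

lemma free_carrier_linear_induct [consumes 1, case_names zero add monomial]:
  assumes "x \<in> free_carrier G" and "P 0"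
    and "\<And>x y. x \<in> free_carrier G \<Longrightarrow> y \<in> free_carrier G \<Longrightarrow> P x \<Longrightarrow> P y \<Longrightarrow> P (x + y)"
    and "\<And>w c. letters w \<noteq> [] \<Longrightarrow> set (letters w) \<subseteq> generators G \<Longrightarrow> P (Poly_Mapping.single w c)"
  shows "P x"
proof -
  have "x \<in> free_carrier G \<and> P x"
  proof (induction x rule: free_induct)
    case (single w c)
    then show ?case
      using assms(1,4) free_carrier_single by (auto simp: free_carrier_def)
  qed (use assms free_carrier_0 free_carrier_add in auto)
  then show ?thesis ..
qed

text \<open>Since the empty word is excluded, a word is a nonempty product of generators; hence the
  nonempty list induction, and no case for a unit.\<close>

lemma free_carrier_induct [consumes 1, case_names zero add scale mult generator]:
  assumes "x \<in> free_carrier G" and "P 0"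
    and "\<And>x y. x \<in> free_carrier G \<Longrightarrow> y \<in> free_carrier G \<Longrightarrow> P x \<Longrightarrow> P y \<Longrightarrow> P (x + y)"
    and scale: "\<And>c x. x \<in> free_carrier G \<Longrightarrow> P x \<Longrightarrow> P (scale c x)"
    and mult: "\<And>x y. x \<in> free_carrier G \<Longrightarrow> y \<in> free_carrier G \<Longrightarrow> P x \<Longrightarrow> P y \<Longrightarrow> P (x * y)"
    and gen: "\<And>g. g \<in> generators G \<Longrightarrow> P (gen g)"
  shows "P x"
  using assms(1)
proof (induction x rule: free_carrier_linear_induct)
  case (monomial w c)
  have "P (Poly_Mapping.single (Word ls) 1)" if "ls \<noteq> []" "set ls \<subseteq> generators G" for ls
    using that
  proof (induction ls rule: list_nonempty_induct)
    case (single g)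
    then show ?case
      using gen[of g] by (simp add: gen_def)
  next
    case (cons g ls)
    then show ?case
      unfolding word_Cons by (auto intro!: mult gen free_carrier_gen free_carrier_single)
  qed
  then have "P (Poly_Mapping.single w 1)"
    using monomial by (cases w) simp
  then show ?case
    using scale[of "Poly_Mapping.single w 1" c] free_carrier_single[OF monomial, of 1] by simp
qed (use assms in auto)


section \<open>The Leavitt path algebra\<close>

lemma range_nonempty_gv:
  assumes "wf_ultragraph G" "e \<in> uedges G"
  shows "{usource G e} \<in> generalized_vertices G" "urange G e \<in> generalized_vertices G"
  using assms by (auto simp: wf_ultragraph_def intro: generalized_vertices.intros)

lemma leavitt_relation_carrier:
  assumes "wf_ultragraph G" "(x, y) \<in> leavitt_relations G"
  shows "x \<in> free_carrier G" "y \<in> free_carrier G"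
  using assms(2) range_nonempty_gv[OF assms(1)]
  unfolding leavitt_relations_def
  by (auto intro!: free_carrier_intros generalized_vertices.empty generalized_vertices.union
      generalized_vertices.inter intro: generalized_vertices.vertex
      simp: regular_vertices_def edges_from_def)

lemma leavitt_ideal_subset:
  assumes "wf_ultragraph G"
  shows "leavitt_ideal G \<subseteq> free_carrier G"
proof
  fix x :: "('a, 'b, 'c::field) free"
  assume "x \<in> leavitt_ideal G"
  then show "x \<in> free_carrier G"
    by induction (auto intro: free_carrier_intros leavitt_relation_carrier[OF assms])
qed

lemma ideal_of_leavitt:
  "wf_ultragraph G \<Longrightarrow> ideal_of (free_carrier G) (leavitt_ideal G) scale"
  by unfold_locales
    (use leavitt_ideal_subset in \<open>auto intro: free_carrier_intros scale_minus_one scale_diff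
      leavitt_ideal.intros\<close>)

locale ultragraph_ideal = ideal_of "free_carrier G" J scale
  for G :: "('v, 'e) ultragraph" and J :: "('v, 'e, 'k::field) free set" +
  assumes wf: "wf_ultragraph G" and leavitt_subset: "leavitt_ideal G \<subseteq> J"
begin

notation cong (infix "\<approx>" 50)

lemma pr_S: "A \<in> generalized_vertices G \<Longrightarrow> pr A \<in> (free_carrier G :: ('v, 'e, 'k) free set)"
  and ed_S: "e \<in> uedges G \<Longrightarrow> ed e \<in> (free_carrier G :: ('v, 'e, 'k) free set)"
  and gh_S: "e \<in> uedges G \<Longrightarrow> gh e \<in> (free_carrier G :: ('v, 'e, 'k) free set)"
  by (simp_all add: free_carrier_intros)

lemma source_gv: "e \<in> uedges G \<Longrightarrow> {usource G e} \<in> generalized_vertices G"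
  and range_gv: "e \<in> uedges G \<Longrightarrow> urange G e \<in> generalized_vertices G"
  using range_nonempty_gv[OF wf] by auto

lemma relation_cong: "(x, y) \<in> leavitt_relations G \<Longrightarrow> x \<approx> y"
  using leavitt_relation_carrier[OF wf] leavitt_ideal.relation leavitt_subset
  unfolding cong_def by blast

lemma pr_empty: "pr {} \<approx> 0"
  and pr_pr: "A \<in> generalized_vertices G \<Longrightarrow> B \<in> generalized_vertices G \<Longrightarrow> pr A * pr B \<approx> pr (A \<inter> B)"
  and pr_Un: "A \<in> generalized_vertices G \<Longrightarrow> B \<in> generalized_vertices G \<Longrightarrow>
    pr (A \<union> B) \<approx> pr A + pr B - pr (A \<inter> B)"
  and source_ed: "e \<in> uedges G \<Longrightarrow> pr {usource G e} * ed e \<approx> ed e"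
  and ed_range: "e \<in> uedges G \<Longrightarrow> ed e * pr (urange G e) \<approx> ed e"
  and range_gh: "e \<in> uedges G \<Longrightarrow> pr (urange G e) * gh e \<approx> gh e"
  and gh_source: "e \<in> uedges G \<Longrightarrow> gh e * pr {usource G e} \<approx> gh e"
  and gh_ed_if: "e \<in> uedges G \<Longrightarrow> f \<in> uedges G \<Longrightarrow>
    gh e * ed f \<approx> (if e = f then pr (urange G e) else 0)"
  and regular: "v \<in> regular_vertices G \<Longrightarrow> pr {v} \<approx> (\<Sum>e\<in>edges_from G v. ed e * gh e)"
  by (rule relation_cong, unfold leavitt_relations_def, blast)+

lemma gh_ed: "e \<in> uedges G \<Longrightarrow> gh e * ed e \<approx> pr (urange G e)"
  using gh_ed_if[of e e] by simp

lemma cong_zero_left: "x \<approx> 0 \<Longrightarrow> y \<in> free_carrier G \<Longrightarrow> x * y \<approx> 0"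
  and cong_zero_right: "x \<approx> 0 \<Longrightarrow> y \<in> free_carrier G \<Longrightarrow> y * x \<approx> 0"
  by (simp_all add: cong_0_iff J_left J_right)

text \<open>Since s_e = p_{s(e)} s_e, multiplication by p_B only sees B \<inter> {s(e)}, which is
  {s(e)} or empty.\<close>

lemma pr_ed:
  assumes "B \<in> generalized_vertices G" "e \<in> uedges G"
  shows "pr B * ed e \<approx> (if usource G e \<in> B then ed e else 0)"
proof -
  note S = assms pr_S ed_S source_gv
  have "pr B * ed e \<approx> pr B * (pr {usource G e} * ed e)"
    using S by (intro cong_left cong_sym[OF source_ed]) auto
  also have "\<dots> \<approx> pr (B \<inter> {usource G e}) * ed e"
    unfolding mult.assoc[symmetric] using S by (intro cong_right pr_pr) auto
  also have "\<dots> \<approx> (if usource G e \<in> B then ed e else 0)"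
    using S source_ed[of e] cong_zero_left[OF pr_empty, of "ed e"] by auto
  finally show ?thesis .
qed

lemma gh_pr:
  assumes "B \<in> generalized_vertices G" "e \<in> uedges G"
  shows "gh e * pr B \<approx> (if usource G e \<in> B then gh e else 0)"
proof -
  note S = assms pr_S gh_S source_gv
  have "gh e * pr B \<approx> (gh e * pr {usource G e}) * pr B"
    using S by (intro cong_right cong_sym[OF gh_source]) auto
  also have "\<dots> \<approx> gh e * pr ({usource G e} \<inter> B)"
    unfolding mult.assoc using S by (intro cong_left pr_pr) auto
  also have "\<dots> \<approx> (if usource G e \<in> B then gh e else 0)"
    using S gh_source[of e] cong_zero_right[OF pr_empty, of "gh e"] by auto
  finally show ?thesis .
qed

lemma ed_pr:
  assumes "B \<in> generalized_vertices G" "e \<in> uedges G"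
  shows "ed e * pr B \<approx> ed e * pr (urange G e \<inter> B)"
proof -
  note S = assms pr_S ed_S range_gv
  have "ed e * pr B \<approx> (ed e * pr (urange G e)) * pr B"
    using S by (intro cong_right cong_sym[OF ed_range]) auto
  also have "\<dots> \<approx> ed e * pr (urange G e \<inter> B)"
    unfolding mult.assoc using S by (intro cong_left pr_pr) auto
  finally show ?thesis .
qed

lemma pr_gh:
  assumes "B \<in> generalized_vertices G" "e \<in> uedges G"
  shows "pr B * gh e \<approx> pr (B \<inter> urange G e) * gh e"
proof -
  note S = assms pr_S gh_S range_gv
  have "pr B * gh e \<approx> pr B * (pr (urange G e) * gh e)"
    using S by (intro cong_left cong_sym[OF range_gh]) auto
  also have "\<dots> \<approx> pr (B \<inter> urange G e) * gh e"
    unfolding mult.assoc[symmetric] using S by (intro cong_right pr_pr) auto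
  finally show ?thesis .
qed

end


section \<open>Two by two matrices over a commutative ring\<close>

definition hall :: "'a::ring \<Rightarrow> 'a \<Rightarrow> 'a \<Rightarrow> 'a" where
  "hall x y z = (x * y - y * x) * (x * y - y * x) * z - z * ((x * y - y * x) * (x * y - y * x))"

text \<open>A two-sided unit of the form \<open>a True * b True + a False * b False\<close> already
  makes the family of all \<open>b i * x * a j\<close> an injective and multiplicative matrix
  picture of x modulo \<open>J\<close>.\<close>

locale matrix_decomposition = ideal_of S J sc
  for S J :: "'a::ring set" and sc :: "'k::field \<Rightarrow> 'a \<Rightarrow> 'a" +
  fixes a b :: "bool \<Rightarrow> 'a"
  assumes a_S: "a i \<in> S" and b_S: "b i \<in> S"
    and unit_left: "x \<in> S \<Longrightarrow> (a True * b True + a False * b False) * x \<approx> x"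
    and unit_right: "x \<in> S \<Longrightarrow> x * (a True * b True + a False * b False) \<approx> x"
begin

definition entry :: "'a \<Rightarrow> bool \<Rightarrow> bool \<Rightarrow> 'a" where
  "entry x i j = b i * x * a j"

lemma entry_S: "x \<in> S \<Longrightarrow> entry x i j \<in> S"
  by (simp add: entry_def S_mult a_S b_S)

lemma entry_add: "entry (x + y) i j = entry x i j + entry y i j"
  and entry_diff: "entry (x - y) i j = entry x i j - entry y i j"
  by (simp_all add: entry_def algebra_simps)

lemma entry_mult:
  assumes "x \<in> S" "y \<in> S"
  shows "entry (x * y) i j \<approx> entry x i True * entry y True j + entry x i False * entry y False j"
proof -
  have "(b i * x) * (y * a j) \<approx> (b i * x) * ((a True * b True + a False * b False) * (y * a j))"
    using assms by (intro cong_left cong_sym[OF unit_left] S_mult a_S b_S)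
  then show ?thesis
    by (simp add: entry_def algebra_simps)
qed

text \<open>Multiplying by the unit on both sides rebuilds w as the sum of the
  \<open>a i * entry w i j * b j\<close>, so the entries determine w.\<close>

lemma entry_ext:
  assumes "x \<in> S" "y \<in> S" and "\<And>i j. entry x i j \<approx> entry y i j"
  shows "x \<approx> y"
proof -
  let ?u = "a True * b True + a False * b False"
  have u: "?u \<in> S"
    by (intro S_add S_mult a_S b_S)
  have *: "w \<approx> a True * (entry w True True * b True) + a True * (entry w True False * b False)
      + (a False * (entry w False True * b True) + a False * (entry w False False * b False))"
    if "w \<in> S" for w
  proof -
    have "?u * (w * ?u) \<approx> w"
      using cong_trans[OF unit_left[OF S_mult[OF that u]] unit_right[OF that]] .
    then show ?thesis
      by (intro cong_sym[of _ w]) (simp add: entry_def algebra_simps)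
  qed
  show ?thesis
    by (rule cong_trans[OF *[OF assms(1)] cong_trans[OF _ cong_sym[OF *[OF assms(2)]]]])
      (intro cong_add cong_mult cong_refl a_S b_S assms)
qed

text \<open>A commutator q of matrices with commuting entries has trace zero, so by Cayley-Hamilton
  its square is scalar: the off-diagonal entries of q q contain the factor q11 + q22, and both
  diagonal entries equal q11 q11 + q12 q21. Scalar matrices commute with z.\<close>

lemma hall_identity:
  assumes commute: "\<And>x y i j k l. x \<in> S \<Longrightarrow> y \<in> S \<Longrightarrow>
      entry x i j * entry y k l \<approx> entry y k l * entry x i j"
    and S: "x \<in> S" "y \<in> S" "z \<in> S"
  shows "hall x y z \<in> J"
proof -
  define q where "q = x * y - y * x"
  have q: "q \<in> S"
    using S by (simp add: q_def S_diff S_mult)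
  note E = entry_S[OF S(1)] entry_S[OF S(2)] entry_S[OF q]
  \<comment> \<open>Products of diagonal entries cancel by commutativity; the mixed products that
    remain reappear in \<open>q22\<close> with opposite sign.\<close>
  have q11: "entry q True True \<approx>
      entry x True False * entry y False True - entry y True False * entry x False True"
  proof -
    have "entry q True True \<approx>
        (entry x True True * entry y True True + entry x True False * entry y False True)
        - (entry y True True * entry x True True + entry y True False * entry x False True)"
      unfolding q_def entry_diff by (intro cong_diff entry_mult S)
    also have "\<dots> \<approx> (entry y True True * entry x True True + entry x True False * entry y False True)
        - (entry y True True * entry x True True + entry y True False * entry x False True)"
      by (intro cong_diff cong_add commute cong_refl S_add S_mult E S)
    finally show ?thesis
      by simp
  qed
  have q22: "entry q False False \<approx> - entry q True True"
  proof -
    have "entry q False False \<approx>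
        (entry x False True * entry y True False + entry x False False * entry y False False)
        - (entry y False True * entry x True False + entry y False False * entry x False False)"
      unfolding q_def entry_diff by (intro cong_diff entry_mult S)
    also have "\<dots> \<approx>
        (entry y True False * entry x False True + entry y False False * entry x False False)
        - (entry x True False * entry y False True + entry y False False * entry x False False)"
      by (intro cong_diff cong_add commute cong_refl S_add S_mult E S)
    also have "\<dots> = - (entry x True False * entry y False True
        - entry y True False * entry x False True)"
      by simp
    also have "\<dots> \<approx> - entry q True True"
      by (intro cong_uminus cong_sym[OF q11])
    finally show ?thesis .
  qed
  define s where "s = q * q"
  have s: "s \<in> S"
    using q by (simp add: s_def S_mult)
  have s12: "entry s True False \<approx> 0"
  proof -
    have "entry s True False \<approx>
        entry q True True * entry q True False + entry q True False * entry q False False"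
      unfolding s_def by (intro entry_mult q)
    also have "\<dots> \<approx>
        entry q True False * entry q True True + entry q True False * (- entry q True True)"
      by (intro cong_add commute cong_left q22 q E)
    finally show ?thesis
      by simp
  qed
  have s21: "entry s False True \<approx> 0"
  proof -
    have "entry s False True \<approx>
        entry q False True * entry q True True + entry q False False * entry q False True"
      unfolding s_def by (intro entry_mult q)
    also have "\<dots> \<approx>
        entry q True True * entry q False True + (- entry q True True) * entry q False True"
      by (intro cong_add commute cong_right q22 q E)
    finally show ?thesis
      by simp
  qed
  have s22: "entry s False False \<approx> entry s True True"
  proof -
    have "entry s False False \<approx>
        entry q False True * entry q True False + entry q False False * entry q False False"
      unfolding s_def by (intro entry_mult q)
    also have "\<dots> \<approx> entry q True False * entry q False True
        + (- entry q True True) * (- entry q True True)"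
      by (intro cong_add commute cong_mult q22 q E)
    also have "\<dots> = entry q True True * entry q True True
        + entry q True False * entry q False True"
      by simp
    also have "\<dots> \<approx> entry s True True"
      unfolding s_def by (intro cong_sym[OF entry_mult] q)
    finally show ?thesis .
  qed
  have s_diag: "entry s i j \<approx> (if i = j then entry s True True else 0)" for i j
    using s12 s21 s22 cong_refl[OF entry_S[OF s, of True True]] by (cases i; cases j) auto
  note Es = entry_S[OF s] entry_S[OF S(3)]
  have "s * z \<approx> z * s"
  proof (rule entry_ext)
    fix i j
    have "entry (s * z) i j \<approx> entry s i True * entry z True j + entry s i False * entry z False j"
      by (intro entry_mult s S)
    also have "\<dots> \<approx> (if i = True then entry s True True else 0) * entry z True j
        + (if i = False then entry s True True else 0) * entry z False j"
      by (intro cong_add cong_right s_diag Es)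
    also have "\<dots> = entry s True True * entry z i j"
      by simp
    also have "\<dots> \<approx> entry z i j * entry s True True"
      by (intro commute s S)
    also have "\<dots> = entry z i True * (if True = j then entry s True True else 0)
        + entry z i False * (if False = j then entry s True True else 0)"
      by simp
    also have "\<dots> \<approx> entry z i True * entry s True j + entry z i False * entry s False j"
      by (intro cong_add cong_left cong_sym[OF s_diag] Es)
    also have "\<dots> \<approx> entry (z * s) i j"
      by (intro cong_sym[OF entry_mult] s S)
    finally show "entry (s * z) i j \<approx> entry (z * s) i j" .
  qed (intro S_mult s S)+
  then show ?thesis
    by (simp add: hall_def q_def s_def cong_def)
qed

text \<open>The two sides are kept apart because d is not assumed to commute with the entries of
  x.\<close>

lemma scalar_matrix_mult:
  assumes "z \<in> S" "d \<in> S" "x \<in> S"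
    and z: "\<And>i j. entry z i j \<approx> (if i = j then d else 0)"
  shows "entry (z * x) i j \<approx> d * entry x i j" "entry (x * z) i j \<approx> entry x i j * d"
proof -
  note E = entry_S[OF assms(3)]
  have "entry (z * x) i j \<approx> entry z i True * entry x True j + entry z i False * entry x False j"
    by (intro entry_mult assms)
  also have "\<dots> \<approx> (if i = True then d else 0) * entry x True j
      + (if i = False then d else 0) * entry x False j"
    by (intro cong_add cong_right z E)
  finally show "entry (z * x) i j \<approx> d * entry x i j"
    by (cases i) simp_all
  have "entry (x * z) i j \<approx> entry x i True * entry z True j + entry x i False * entry z False j"
    by (intro entry_mult assms)
  also have "\<dots> \<approx> entry x i True * (if True = j then d else 0)
      + entry x i False * (if False = j then d else 0)"
    by (intro cong_add cong_left z E)
  finally show "entry (x * z) i j \<approx> entry x i j * d"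
    by (cases j) simp_all
qed

end


section \<open>The algebras of the ultragraph\<close>

lemma ultragraph_G_simps [simp]:
  "v \<in> uverts ultragraph_G" "d \<in> uedges ultragraph_G"
  "usource ultragraph_G E0 = V" "usource ultragraph_G (En n) = W n"
  "urange ultragraph_G E0 = range W" "urange ultragraph_G (En n) = {W n}"
  by (cases v; cases d; auto simp: ultragraph_G_def)+

lemma edges_from_G: "edges_from ultragraph_G V = {E0}" "edges_from ultragraph_G (W n) = {En n}"
proof -
  have "usource ultragraph_G d = V \<longleftrightarrow> d = E0" "usource ultragraph_G d = W n \<longleftrightarrow> d = En n" for d
    by (cases d; auto)+
  then show "edges_from ultragraph_G V = {E0}" "edges_from ultragraph_G (W n) = {En n}"
    by (auto simp: edges_from_def)
qed

lemma V_notin_range_W [simp]: "V \<notin> range W"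
  by auto

lemma gv_G:
  "{} \<in> generalized_vertices ultragraph_G" "{v} \<in> generalized_vertices ultragraph_G"
  "range W \<in> generalized_vertices ultragraph_G"
  using generalized_vertices.range[of E0 ultragraph_G]
  by (auto intro: generalized_vertices.empty generalized_vertices.vertex)

locale ideal_G = ultragraph_ideal ultragraph_G J
  for J :: "(vertex, edge, 'k::field) free set"
begin

notation cong (infix "\<approx>" 50)

abbreviation "pW \<equiv> pr (range W) :: (vertex, edge, 'k) free"

text \<open>Together with \<open>eb\<close>: the sum of the products is p_A + s_e s_e^* = p_A + p_v,
  the unit. So \<open>True\<close> indexes the block of A and \<open>False\<close> the block of v,
  which conjugation by s_e moves into the corner at p_A.\<close>

definition ea :: "bool \<Rightarrow> (vertex, edge, 'k) free" where
  "ea i = (if i then pW else ed E0)"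

definition eb :: "bool \<Rightarrow> (vertex, edge, 'k) free" where
  "eb i = (if i then pW else gh E0)"

lemma ea_S: "ea i \<in> free_carrier ultragraph_G" and eb_S: "eb i \<in> free_carrier ultragraph_G"
  by (simp_all add: ea_def eb_def pr_S gv_G ed_S gh_S)

lemma pW_pr: "B \<in> generalized_vertices ultragraph_G \<Longrightarrow> pW * pr B \<approx> pr (range W \<inter> B)"
  and pr_pW: "B \<in> generalized_vertices ultragraph_G \<Longrightarrow> pr B * pW \<approx> pr (B \<inter> range W)"
  by (intro pr_pr gv_G; assumption)+

lemma pV_cong: "pr {V} \<approx> ed E0 * gh E0"
  using regular[of V] by (simp add: edges_from_G regular_vertices_def)

lemma pWn_cong: "pr {W n} \<approx> ed (En n) * gh (En n)"
  using regular[of "W n"] by (simp add: edges_from_G regular_vertices_def)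

lemma unit_cong: "ea True * eb True + ea False * eb False \<approx> pW + pr {V}"
  using cong_add[OF pW_pr[OF gv_G(3)] cong_sym[OF pV_cong]] by (simp add: ea_def eb_def)

lemma unit_gen:
  assumes "g \<in> generators ultragraph_G"
  shows "(pW + pr {V}) * gen g \<approx> gen g" "gen g * (pW + pr {V}) \<approx> gen g"
proof -
  \<comment> \<open>Every vertex is v or some w_n, so B splits into two disjoint pieces, which the
    two summands of the unit cut out.\<close>
  have UN: "insert V (range W) = UNIV"
    using vertex.exhaust by blast
  have "(pW + pr {V}) * gen g \<approx> gen g \<and> gen g * (pW + pr {V}) \<approx> gen g"
  proof (cases g)
    case (Proj B)
    then have B: "B \<in> generalized_vertices ultragraph_G"
      using assms by (auto simp: generators_def)
    have disj: "(range W \<inter> B) \<inter> ({V} \<inter> B) = {}"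
      by auto
    have "pr (range W \<inter> B) + pr ({V} \<inter> B) = pr (range W \<inter> B) + pr ({V} \<inter> B) - 0"
      by simp
    also have "\<dots> \<approx> pr (range W \<inter> B) + pr ({V} \<inter> B) - pr ((range W \<inter> B) \<inter> ({V} \<inter> B))"
      unfolding disj using cong_sym[OF pr_empty]
      by (intro cong_diff cong_refl S_add pr_S generalized_vertices.inter gv_G B)
    also have "\<dots> \<approx> pr ((range W \<inter> B) \<union> ({V} \<inter> B))"
      by (intro cong_sym[OF pr_Un] generalized_vertices.inter gv_G B)
    also have "(range W \<inter> B) \<union> ({V} \<inter> B) = B"
      using UN by blast
    finally have *: "pr (range W \<inter> B) + pr ({V} \<inter> B) \<approx> pr B" .
    have "pW * pr B + pr {V} * pr B \<approx> pr B" "pr B * pW + pr B * pr {V} \<approx> pr B"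
      using cong_trans[OF cong_add[OF pW_pr pr_pr] *]
        cong_trans[OF cong_add[OF pr_pW pr_pr[of B "{V}"]]] * B gv_G
      by (simp_all add: Int_commute)
    then show ?thesis
      by (simp add: Proj pr_gen algebra_simps)
  next
    case (Edge e)
    have "pW * ed e + pr {V} * ed e \<approx> ed e"
      using cong_add[OF pr_ed[OF gv_G(3), of e] pr_ed[OF gv_G(2), of e V]] by (cases e) auto
    \<comment> \<open>Ranges of edges lie in A, so p_A contributes the whole range and p_v only
      \<open>pr {}\<close>.\<close>
    moreover have "ed e * pW + ed e * pr {V} \<approx> ed e * pr (urange ultragraph_G e) + ed e * pr {}"
      using cong_add[OF ed_pr[OF gv_G(3), of e] ed_pr[OF gv_G(2), of e V]]
      by (cases e) (auto simp: image_iff)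
    then have "ed e * pW + ed e * pr {V} \<approx> ed e"
      using cong_trans[OF _ cong_add[OF ed_range[of e] cong_zero_right[OF pr_empty ed_S]]] by simp
    ultimately show ?thesis
      by (simp add: Edge ed_gen algebra_simps)
  next
    case (Ghost e)
    have "gh e * pW + gh e * pr {V} \<approx> gh e"
      using cong_add[OF gh_pr[OF gv_G(3), of e] gh_pr[OF gv_G(2), of e V]] by (cases e) auto
    moreover have "pW * gh e + pr {V} * gh e \<approx> pr (urange ultragraph_G e) * gh e + pr {} * gh e"
      using cong_add[OF pr_gh[OF gv_G(3), of e] pr_gh[OF gv_G(2), of e V]]
      by (cases e) (auto simp: image_iff)
    then have "pW * gh e + pr {V} * gh e \<approx> gh e"
      using cong_trans[OF _ cong_add[OF range_gh[of e] cong_zero_left[OF pr_empty gh_S]]] by simp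
    ultimately show ?thesis
      by (simp add: Ghost gh_gen algebra_simps)
  qed
  then show "(pW + pr {V}) * gen g \<approx> gen g" "gen g * (pW + pr {V}) \<approx> gen g"
    by blast+
qed

section \<open>Commutativity of the corner at p_A\<close>

definition supported :: "nat \<Rightarrow> (vertex, edge, 'k) free \<Rightarrow> bool" where
  "supported n x \<longleftrightarrow> x * pr {W n} \<approx> x \<and> pr {W n} * x \<approx> x"

lemma supported_En: "supported n (ed (En n))" "supported n (gh (En n))"
  using source_ed[of "En n"] ed_range[of "En n"] gh_source[of "En n"] range_gh[of "En n"]
  by (simp_all add: supported_def)

lemma supported_S: "supported n x \<Longrightarrow> x \<in> free_carrier ultragraph_G"
  by (auto simp: supported_def dest: cong_S)

lemma supported_left:
  assumes "supported n x" "y \<in> free_carrier ultragraph_G" "pr {W n} * y \<approx> c"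
  shows "x * y \<approx> x * c"
proof -
  have "x * y \<approx> x * pr {W n} * y"
    using assms by (intro cong_right cong_sym[of "x * pr {W n}" x]) (auto simp: supported_def)
  also have "\<dots> \<approx> x * c"
    unfolding mult.assoc using assms supported_S by (intro cong_left)
  finally show ?thesis .
qed

lemma supported_right:
  assumes "supported n x" "y \<in> free_carrier ultragraph_G" "y * pr {W n} \<approx> c"
  shows "y * x \<approx> c * x"
proof -
  have "y * x \<approx> y * (pr {W n} * x)"
    using assms by (intro cong_left cong_sym[of "pr {W n} * x" x]) (auto simp: supported_def)
  also have "\<dots> \<approx> c * x"
    unfolding mult.assoc[symmetric] using assms supported_S by (intro cong_right)
  finally show ?thesis .
qed

lemma supported_neq:
  assumes "supported n x" "supported m y" "n \<noteq> m"
  shows "x * y \<approx> 0"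
proof -
  have "pr {W n} * y \<approx> pr ({W n} \<inter> {W m}) * y"
    using assms by (intro supported_right[of m] pr_pr pr_S gv_G)
  also have "\<dots> \<approx> 0"
    using assms(3) cong_zero_left[OF pr_empty supported_S[OF assms(2)]] by simp
  finally have "x * y \<approx> x * 0"
    using supported_left assms supported_S by blast
  then show ?thesis
    by simp
qed

lemma supported_pr:
  assumes "supported n x" and B: "B \<in> generalized_vertices ultragraph_G"
  shows "x * pr B \<approx> (if W n \<in> B then x else 0)" "pr B * x \<approx> (if W n \<in> B then x else 0)"
proof -
  have "x * pr B \<approx> x * pr ({W n} \<inter> B)" "pr B * x \<approx> pr (B \<inter> {W n}) * x"
    using supported_left[OF assms(1) pr_S[OF B] pr_pr[OF gv_G(2) B]]
      supported_right[OF assms(1) pr_S[OF B] pr_pr[OF B gv_G(2)]] .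
  then show "x * pr B \<approx> (if W n \<in> B then x else 0)" "pr B * x \<approx> (if W n \<in> B then x else 0)"
    using assms(1) cong_trans cong_zero_left[OF pr_empty supported_S[OF assms(1)]]
      cong_zero_right[OF pr_empty supported_S[OF assms(1)]]
    unfolding supported_def by (auto split: if_splits)
qed

lemma pW_ed: "pW * ed E0 \<approx> 0" and gh_pW: "gh E0 * pW \<approx> 0"
  using pr_ed[OF gv_G(3), of E0] gh_pr[OF gv_G(3), of E0] by simp_all

lemma supported_ends: 
  assumes "supported n x"
  shows "x * ed E0 \<approx> 0" "gh E0 * x \<approx> 0"
proof -
  have "pr {W n} * ed E0 \<approx> 0" "gh E0 * pr {W n} \<approx> 0"
    using pr_ed[OF gv_G(2), of E0 "W n"] gh_pr[OF gv_G(2), of E0 "W n"] by simp_all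
  then show "x * ed E0 \<approx> 0" "gh E0 * x \<approx> 0"
    using supported_left[OF assms ed_S, of E0 0] supported_right[OF assms gh_S, of E0 0] by simp_all
qed

definition basic :: "(vertex, edge, 'k) free set" where
  "basic = {pr B | B. B \<in> generalized_vertices ultragraph_G}
    \<union> range (\<lambda>n. ed (En n)) \<union> range (\<lambda>n. gh (En n))"

text \<open>Each w_n emits only its loop, so s_{e_n} is unitary in the corner at p_{w_n} and
  commutes with its adjoint; elements at different w_n annihilate each other, and projections act on
  them by 0 or 1 from both sides.\<close>

lemma basic_commute:
  assumes "x \<in> basic" "y \<in> basic"
  shows "x * y \<approx> y * x"
proof -
  have comm_pr: "y * x \<approx> x * y \<and> x * y \<approx> y * x"
    if "supported n x" "y \<in> basic" "y = pr B" "B \<in> generalized_vertices ultragraph_G" for x y B n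
    using supported_pr[OF that(1,4)] that(3) cong_sym cong_trans by metis
  have loop: "ed (En n) * gh (En n) \<approx> gh (En n) * ed (En n)" for n
    using cong_trans[OF cong_sym[OF pWn_cong[of n]], of "gh (En n) * ed (En n)"]
      cong_sym[OF gh_ed[of "En n"]] by simp
  have comm_supp: "x * y \<approx> y * x"
    if "supported n x" "supported m y" "x = ed (En n) \<or> x = gh (En n)" "y = ed (En m) \<or> y = gh (En m)"
    for x y n m
  proof (cases "n = m")
    case True
    then show ?thesis
      using that loop[of n] cong_sym[OF loop[of n]] cong_refl[OF S_mult] supported_S by auto
  next
    case False
    then show ?thesis
      using supported_neq that cong_trans cong_sym by metis
  qed
  have pp: "pr B * pr C \<approx> pr C * pr B"
    if "B \<in> generalized_vertices ultragraph_G" "C \<in> generalized_vertices ultragraph_G" for B C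
    using pr_pr[OF that] cong_sym[OF pr_pr[OF that(2,1)]] cong_trans by (metis Int_commute)
  consider (pr) B where "x = pr B" "B \<in> generalized_vertices ultragraph_G"
    | (s) n where "supported n x" "x = ed (En n) \<or> x = gh (En n)"
    using assms(1) supported_En unfolding basic_def by blast
  then show ?thesis
  proof cases
    case x: pr
    show ?thesis
      using assms(2) supported_En comm_pr[OF _ assms(1) x] pp[OF x(2)] unfolding basic_def x(1) by blast
  next
    case x: s
    show ?thesis
      using assms(2) supported_En comm_pr[OF x(1) assms(2)] comm_supp[OF x(1) _ x(2)]
      unfolding basic_def by blast
  qed
qed

lemma unit:
  assumes "x \<in> free_carrier ultragraph_G"
  shows "(pW + pr {V}) * x \<approx> x" "x * (pW + pr {V}) \<approx> x"
proof -
  have u: "pW + pr {V} \<in> free_carrier ultragraph_G"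
    by (intro S_add pr_S gv_G)
  have "(pW + pr {V}) * x \<approx> x \<and> x * (pW + pr {V}) \<approx> x"
    using assms
  proof (induction x rule: free_carrier_induct)
    case zero
    then show ?case
      by (simp add: cong_refl S_zero)
  next
    case (add x y)
    then show ?case
      unfolding distrib_left[of "pW + pr {V}"] distrib_right[of _ _ "pW + pr {V}"]
      by (intro conjI cong_add) auto
  next
    case (scale c x)
    then show ?case
      by (auto simp: scale_mult_left[symmetric] scale_mult_right[symmetric] intro: cong_scale)
  next
    case (mult x y)
    then have "(pW + pr {V}) * x * y \<approx> x * y" "x * (y * (pW + pr {V})) \<approx> x * y"
      by (intro cong_right cong_left; simp)+
    then show ?case
      by (simp add: mult.assoc)
  qed (simp add: unit_gen)
  then show "(pW + pr {V}) * x \<approx> x" "x * (pW + pr {V}) \<approx> x"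
    by blast+
qed

sublocale matrix_decomposition "free_carrier ultragraph_G" J scale ea eb
proof
  fix x :: "(vertex, edge, 'k) free"
  assume x: "x \<in> free_carrier ultragraph_G"
  show "(ea True * eb True + ea False * eb False) * x \<approx> x"
    "x * (ea True * eb True + ea False * eb False) \<approx> x"
    using cong_trans[OF cong_right[OF unit_cong x] unit(1)[OF x]]
      cong_trans[OF cong_left[OF x unit_cong] unit(2)[OF x]] .
qed (simp_all add: ea_S eb_S)

text \<open>As v is not in A, both p_A s_e and s_e^* p_A vanish, which kills most entries. The
  others follow from s_e^* s_e = p_A; a loop survives only in the entry
  \<open>True True\<close>.\<close>

lemma gen_entry:
  assumes "g \<in> generators ultragraph_G"
  shows "\<exists>y\<in>basic. entry (gen g) i j \<approx> y"
proof -
  have basic_pr: "pr B \<in> basic" if "B \<in> generalized_vertices ultragraph_G" for B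
    using that by (auto simp: basic_def)
  \<comment> \<open>Zero is represented inside \<open>basic\<close> by \<open>pr {}\<close>.\<close>
  have zero: "\<exists>y\<in>basic. x \<approx> y" if "x \<approx> 0" for x
    using cong_trans[OF that cong_sym[OF pr_empty]] basic_pr[OF gv_G(1)] by blast
  have left0: "x * y * z \<approx> 0" if "x * y \<approx> 0" "z \<in> free_carrier ultragraph_G" for x y z
    using cong_zero_left[OF that] .
  have right0: "x * y * z \<approx> 0" if "y * z \<approx> 0" "x \<in> free_carrier ultragraph_G" for x y z
    using cong_zero_right[OF that] by (simp add: mult.assoc)
  have pWpW: "pW * pW \<approx> pW"
    using pW_pr[OF gv_G(3)] by simp
  have supp: "\<exists>y\<in>basic. entry x i j \<approx> y" if x: "supported n x" "x \<in> basic" for n x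
  proof -
    have "pW * x * pW \<approx> x * pW"
      using supported_pr(2)[OF x(1) gv_G(3)] by (intro cong_right pr_S gv_G) simp
    also have "x * pW \<approx> x"
      using supported_pr(1)[OF x(1) gv_G(3)] by simp
    finally have "pW * x * pW \<approx> x" .
    moreover have "pW * x * ed E0 \<approx> 0"
      using right0[OF supported_ends(1)[OF x(1)]] pr_S gv_G by blast
    moreover have "gh E0 * x * y \<approx> 0" if "y \<in> free_carrier ultragraph_G" for y
      using left0[OF supported_ends(2)[OF x(1)] that] .
    ultimately show ?thesis
      using x(2) zero ea_S[of j] by (cases i; cases j) (auto simp: entry_def ea_def eb_def)
  qed
  show ?thesis
  proof (cases g)
    case (Proj B)
    then have B: "B \<in> generalized_vertices ultragraph_G"
      using assms by (auto simp: generators_def)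
    then have BW: "range W \<inter> B \<in> generalized_vertices ultragraph_G"
      by (intro generalized_vertices.inter gv_G)
    have "pW * pr B * pW \<approx> pr (range W \<inter> B \<inter> range W)"
      using cong_trans[OF cong_right[OF pW_pr[OF B] pr_S[OF gv_G(3)]] pr_pW[OF BW]] .
    moreover have "pr B * ed E0 \<approx> (if V \<in> B then ed E0 else 0)"
      using pr_ed[OF B, of E0] by simp
    then have "pW * (pr B * ed E0) \<approx> pW * (if V \<in> B then ed E0 else 0)"
      "gh E0 * (pr B * ed E0) \<approx> gh E0 * (if V \<in> B then ed E0 else 0)"
      by (intro cong_left pr_S gv_G gh_S; simp)+
    then have "pW * (pr B * ed E0) \<approx> 0"
      "gh E0 * (pr B * ed E0) \<approx> (if V \<in> B then pW else pr {})"
      using cong_trans[OF _ pW_ed] cong_trans[OF _ gh_ed[of E0]] cong_trans[OF _ cong_sym[OF pr_empty]]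
      by (auto split: if_splits)
    moreover have "gh E0 * pr B \<approx> (if V \<in> B then gh E0 else 0)"
      using gh_pr[OF B, of E0] by simp
    then have "gh E0 * pr B * pW \<approx> (if V \<in> B then gh E0 else 0) * pW"
      by (intro cong_right pr_S gv_G)
    then have "gh E0 * pr B * pW \<approx> 0"
      using cong_trans[OF _ gh_pW] by (auto split: if_splits)
    ultimately show ?thesis
      using zero basic_pr[OF gv_G(3)] basic_pr[OF gv_G(1)]
        basic_pr[OF generalized_vertices.inter[OF BW gv_G(3)]]
      by (cases i; cases j; cases "V \<in> B") (auto simp: Proj pr_gen[symmetric] entry_def ea_def eb_def mult.assoc)
  next
    case (Edge e)
    show ?thesis
    proof (cases e)
      case E0
      have "pW * ed E0 * ea j \<approx> 0"
        by (intro left0 pW_ed ea_S)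
      moreover have "gh E0 * ed E0 * pW \<approx> pW"
        using cong_trans[OF cong_right[OF gh_ed[of E0] pr_S[OF gv_G(3)]]] pWpW by simp
      moreover have "gh E0 * ed E0 * ed E0 \<approx> 0"
        using cong_trans[OF cong_right[OF gh_ed[of E0] ed_S]] pW_ed by simp
      ultimately show ?thesis
        using zero basic_pr[OF gv_G(3)]
        by (cases i; cases j) (auto simp: Edge E0 ed_gen[symmetric] entry_def ea_def eb_def)
    next
      case (En n)
      then show ?thesis
        using supp[OF supported_En(1)[of n]] by (simp add: Edge ed_gen[symmetric] basic_def)
    qed
  next
    case (Ghost e)
    show ?thesis
    proof (cases e)
      case E0
      have "eb i * gh E0 * pW \<approx> 0"
        by (intro right0 gh_pW eb_S)
      moreover have "pW * (gh E0 * ed E0) \<approx> pW"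
        using cong_trans[OF cong_left[OF pr_S[OF gv_G(3)] gh_ed[of E0]]] pWpW by simp
      moreover have "gh E0 * (gh E0 * ed E0) \<approx> 0"
        using cong_trans[OF cong_left[OF gh_S gh_ed[of E0]]] gh_pW by simp
      ultimately show ?thesis
        using zero basic_pr[OF gv_G(3)]
        by (cases i; cases j)
          (auto simp: Ghost E0 gh_gen[symmetric] entry_def ea_def eb_def mult.assoc)
    next
      case (En n)
      then show ?thesis
        using supp[OF supported_En(2)[of n]] by (simp add: Ghost gh_gen[symmetric] basic_def)
    qed
  qed
qed

lemma entry_scale: "entry (scale c x) i j = scale c (entry x i j)"
  by (simp add: entry_def scale_mult_left[symmetric] scale_mult_right[symmetric])

text \<open>Entries of a product are sums of products of entries, so the elements all of whose
  entries commute with c form a subalgebra, and only generators have to be tested.\<close>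

lemma commute_entries:
  assumes "c \<in> free_carrier ultragraph_G" "x \<in> free_carrier ultragraph_G"
    and gen: "\<And>g i j. g \<in> generators ultragraph_G \<Longrightarrow> c * entry (gen g) i j \<approx> entry (gen g) i j * c"
  shows "c * entry x i j \<approx> entry x i j * c"
  using assms(2)
proof (induction x arbitrary: i j rule: free_carrier_induct)
  case zero
  then show ?case
    by (simp add: entry_def cong_refl S_zero)
next
  case (add x y)
  then show ?case
    by (simp add: entry_add distrib_left distrib_right cong_add)
next
  case (scale k x)
  then show ?case
    by (simp add: entry_scale scale_mult_left[symmetric] scale_mult_right[symmetric] cong_scale)
next
  case (mult x y)
  have comm: "c * (entry x i k * entry y k j) \<approx> entry x i k * entry y k j * c" for k
  proof -
    have "c * (entry x i k * entry y k j) \<approx> entry x i k * c * entry y k j"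
      unfolding mult.assoc[symmetric] by (intro cong_right mult entry_S)
    also have "\<dots> \<approx> entry x i k * (entry y k j * c)"
      unfolding mult.assoc by (intro cong_left mult entry_S)
    finally show ?thesis
      by (simp add: mult.assoc)
  qed
  have "c * entry (x * y) i j \<approx>
      c * (entry x i True * entry y True j + entry x i False * entry y False j)"
    by (intro cong_left assms entry_mult mult)
  also have "\<dots> \<approx> (entry x i True * entry y True j + entry x i False * entry y False j) * c"
    unfolding distrib_left[of c] distrib_right[of _ _ c] by (intro cong_add comm)
  also have "\<dots> \<approx> entry (x * y) i j * c"
    by (intro cong_right assms cong_sym[OF entry_mult] mult)
  finally show ?case .
qed (rule gen)

text \<open>The reduction to generators is used twice, once in each factor; entries of two
  generators are congruent to commuting elements of \<open>basic\<close>.\<close>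

lemma entries_commute:
  assumes "x \<in> free_carrier ultragraph_G" "y \<in> free_carrier ultragraph_G"
  shows "entry x i j * entry y k l \<approx> entry y k l * entry x i j"
proof (rule commute_entries[OF entry_S])
  fix h k l assume h: "h \<in> generators ultragraph_G"
  have "entry (gen h) k l * entry x i j \<approx> entry x i j * entry (gen h) k l"
  proof (rule commute_entries[OF entry_S])
    fix g i j assume g: "g \<in> generators ultragraph_G"
    obtain u v where "u \<in> basic" "v \<in> basic" "entry (gen h) k l \<approx> u" "entry (gen g) i j \<approx> v"
      using gen_entry[OF g] gen_entry[OF h] by meson
    then show "entry (gen h) k l * entry (gen g) i j \<approx> entry (gen g) i j * entry (gen h) k l"
      using cong_trans[OF cong_mult cong_trans[OF basic_commute cong_sym[OF cong_mult]]] by blast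
  qed (use assms h free_carrier_gen in auto)
  then show "entry x i j * entry (gen h) k l \<approx> entry (gen h) k l * entry x i j"
    by (rule cong_sym)
qed (use assms in auto)

lemma hall_G:
  assumes "x \<in> free_carrier ultragraph_G" "y \<in> free_carrier ultragraph_G" "z \<in> free_carrier ultragraph_G"
  shows "hall x y z \<in> J"
  by (rule hall_identity[OF entries_commute assms])

text \<open>The scalar matrix with p_{w_n} in both diagonal places; the second summand is the copy
  of p_{w_n} under v, carried there by s_e.\<close>

definition central :: "nat \<Rightarrow> (vertex, edge, 'k) free" where
  "central n = pr {W n} + ed E0 * pr {W n} * gh E0"

lemma central_S: "central n \<in> free_carrier ultragraph_G"
  unfolding central_def by (intro S_add S_mult pr_S ed_S gh_S gv_G) simp_all

lemma central_entry: "entry (central n) i j \<approx> (if i = j then pr {W n} else 0)"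
proof -
  have BW: "pW * pr {W n} \<approx> pr {W n}" "pr {W n} * pW \<approx> pr {W n}"
    using pW_pr[OF gv_G(2), of "W n"] pr_pW[OF gv_G(2), of "W n"] by simp_all
  have b: "eb i * ed E0 \<approx> (if i then 0 else pW)" for i
    using pW_ed gh_ed[of E0] by (simp add: eb_def)
  have a: "gh E0 * ea j \<approx> (if j then 0 else pW)" for j
    using gh_pW gh_ed[of E0] by (simp add: ea_def)
  have pa: "pr {W n} * ea j \<approx> (if j then pr {W n} else 0)" for j
    using BW(2) pr_ed[OF gv_G(2), of E0 "W n"] by (simp add: ea_def)
  have pb: "eb i * pr {W n} \<approx> (if i then pr {W n} else 0)" for i
    using BW(1) gh_pr[OF gv_G(2), of E0 "W n"] by (simp add: eb_def)
  have "eb i * (pr {W n} * ea j) \<approx> eb i * (if j then pr {W n} else 0)"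
    by (intro cong_left pa eb_S)
  also have "\<dots> \<approx> (if i \<and> j then pr {W n} else 0)"
    using pb[of i] cong_refl[OF S_zero] by auto
  finally have 1: "eb i * (pr {W n} * ea j) \<approx> (if i \<and> j then pr {W n} else 0)" .
  have "(eb i * ed E0) * pr {W n} * (gh E0 * ea j) \<approx>
      (if i then 0 else pW) * pr {W n} * (if j then 0 else pW)"
    by (intro cong_mult a b cong_refl pr_S gv_G)
  also have "\<dots> \<approx> (if \<not> i \<and> \<not> j then pr {W n} else 0)"
    using cong_trans[OF cong_right[OF BW(1) pr_S[OF gv_G(3)]] BW(2)] cong_refl[OF S_zero] by auto
  finally have 2: "(eb i * ed E0) * pr {W n} * (gh E0 * ea j) \<approx> (if \<not> i \<and> \<not> j then pr {W n} else 0)" .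
  show ?thesis
    using cong_add[OF 1 2] by (cases i; cases j) (simp_all add: entry_def central_def algebra_simps)
qed

lemma central_commutes:
  assumes x: "x \<in> free_carrier ultragraph_G"
  shows "central n * x \<approx> x * central n"
proof (rule entry_ext)
  fix i j
  have pn: "(pr {W n} :: (vertex, edge, 'k) free) \<in> free_carrier ultragraph_G"
    by (intro pr_S gv_G)
  note m = scalar_matrix_mult[OF central_S pn x central_entry]
  \<comment> \<open>p_{w_n} is itself an entry of an element, so \<open>entries_commute\<close>
    applies to it.\<close>
  have e: "entry (central n) True True \<approx> pr {W n}"
    using central_entry[of n True True] by simp
  have "entry (central n * x) i j \<approx> pr {W n} * entry x i j"
    by (rule m)
  also have "\<dots> \<approx> entry (central n) True True * entry x i j"
    by (intro cong_right cong_sym[OF e] entry_S x)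
  also have "\<dots> \<approx> entry x i j * entry (central n) True True"
    by (intro entries_commute central_S x)
  also have "\<dots> \<approx> entry x i j * pr {W n}"
    by (intro cong_left e entry_S x)
  also have "\<dots> \<approx> entry (x * central n) i j"
    by (rule cong_sym[OF m(2)])
  finally show "entry (central n * x) i j \<approx> entry (x * central n) i j" .
qed (intro S_mult central_S x)+

lemma central_mult: "central n * central m \<approx> (if n = m then central n else 0)"
proof (rule entry_ext)
  fix i j
  have pn: "(pr {W n} :: (vertex, edge, 'k) free) \<in> free_carrier ultragraph_G" for n
    by (intro pr_S gv_G)
  have "entry (central n * central m) i j \<approx> pr {W n} * entry (central m) i j"
    by (rule scalar_matrix_mult[OF central_S pn central_S central_entry])
  also have "\<dots> \<approx> pr {W n} * (if i = j then pr {W m} else 0)"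
    by (intro cong_left pn central_entry)
  also have "\<dots> \<approx> (if n = m \<and> i = j then pr {W n} else 0)"
    using pr_pr[OF gv_G(2,2), of "W n" "W m"] cong_trans[OF _ pr_empty] cong_refl[OF S_zero] by auto
  also have "\<dots> \<approx> entry (if n = m then central n else 0) i j"
    using cong_sym[OF central_entry[of n i j]] cong_refl[OF S_zero]
    by (cases "n = m") (simp_all add: entry_def)
  finally show "entry (central n * central m) i j \<approx> entry (if n = m then central n else 0) i j" .
qed (auto intro: S_mult central_S S_zero)

end


section \<open>Two-dimensional representations\<close>

definition extend :: "('w \<Rightarrow> 'k) \<Rightarrow> ('w \<Rightarrow>\<^sub>0 'k) \<Rightarrow> 'k::field" where
  "extend \<phi> x = (\<Sum>w\<in>Poly_Mapping.keys x. Poly_Mapping.lookup x w * \<phi> w)"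

lemma extend_superset:
  assumes "finite I" "Poly_Mapping.keys x \<subseteq> I"
  shows "extend \<phi> x = (\<Sum>w\<in>I. Poly_Mapping.lookup x w * \<phi> w)"
  unfolding extend_def using assms by (intro sum.mono_neutral_left) (auto simp: in_keys_iff)

lemma extend_0 [simp]: "extend \<phi> 0 = 0"
  by (simp add: extend_def)

lemma extend_single [simp]: "extend \<phi> (Poly_Mapping.single w c) = c * \<phi> w"
  by (simp add: extend_superset[of "{w}"])

lemma extend_add: "extend \<phi> (x + y) = extend \<phi> x + extend \<phi> y"
  using Poly_Mapping.keys_add[of x y]
  by (simp add: extend_superset[of "Poly_Mapping.keys x \<union> Poly_Mapping.keys y"] lookup_add
      distrib_right sum.distrib)

lemma extend_scale: "extend \<phi> (scale c x) = c * extend \<phi> x"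
proof -
  have "extend \<phi> (scale c x) = (\<Sum>w\<in>Poly_Mapping.keys x. Poly_Mapping.lookup (scale c x) w * \<phi> w)"
    by (rule extend_superset) (auto simp: in_keys_iff)
  then show ?thesis
    by (simp add: extend_def sum_distrib_left mult.assoc)
qed

text \<open>The n-th representation acts on a plane with basis v, w_n, where \<open>True\<close>
  stands for v (opposite to the convention of \<open>ea\<close>). The edge e is the matrix unit from
  w_n to v, the loop e_n is the projection onto w_n, and all other loops act as zero.\<close>

fun letter_entry :: "nat \<Rightarrow> (vertex, edge) letter \<Rightarrow> bool \<Rightarrow> bool \<Rightarrow> 'k::field" where
  "letter_entry n (Proj B) i j = of_bool (i = j \<and> (if i then V \<in> B else W n \<in> B))"
| "letter_entry n (Edge E0) i j = of_bool (i \<and> \<not> j)"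
| "letter_entry n (Ghost E0) i j = of_bool (\<not> i \<and> j)"
| "letter_entry n (Edge (En m)) i j = of_bool (m = n \<and> \<not> i \<and> \<not> j)"
| "letter_entry n (Ghost (En m)) i j = of_bool (m = n \<and> \<not> i \<and> \<not> j)"

fun word_entry :: "nat \<Rightarrow> (vertex, edge) letter list \<Rightarrow> bool \<Rightarrow> bool \<Rightarrow> 'k::field" where
  "word_entry n [] i j = of_bool (i = j)"
| "word_entry n (g # ls) i j = letter_entry n g i True * word_entry n ls True j
    + letter_entry n g i False * word_entry n ls False j"

lemma word_entry_append:
  "word_entry n (u @ v) i j = word_entry n u i True * word_entry n v True j
    + word_entry n u i False * word_entry n v False j"
  by (induction u arbitrary: i) (auto simp: algebra_simps)

definition rep :: "nat \<Rightarrow> (vertex, edge, 'k::field) free \<Rightarrow> bool \<Rightarrow> bool \<Rightarrow> 'k" where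
  "rep n x i j = extend (\<lambda>w. word_entry n (letters w) i j) x"

lemma rep_0 [simp]: "rep n 0 i j = 0"
  and rep_add [simp]: "rep n (x + y) i j = rep n x i j + rep n y i j"
  and rep_scale [simp]: "rep n (scale c x) i j = c * rep n x i j"
  and rep_single [simp]: "rep n (Poly_Mapping.single w c) i j = c * word_entry n (letters w) i j"
  by (simp_all add: rep_def extend_add extend_scale)

lemma rep_uminus [simp]: "rep n (- x) i j = - rep n x i j"
  using rep_scale[of n "- 1" x i j] by (simp add: scale_minus_one)

lemma rep_diff [simp]: "rep n (x - y) i j = rep n x i j - rep n y i j"
  using rep_add[of n x "- y" i j] by simp

lemma rep_mult [simp]:
  "rep n (x * y) i j = rep n x i True * rep n y True j + rep n x i False * rep n y False j"
proof (induction x rule: free_induct)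
  case (single w c)
  show ?case
    by (induction y rule: free_induct)
      (simp_all add: mult_single plus_word_def word_entry_append algebra_simps)
qed (simp_all add: algebra_simps)

lemma rep_gen [simp]: "rep n (gen g) i j = letter_entry n g i j"
  by (cases j) (simp_all add: gen_def)

lemma rep_relation:
  assumes "(x, y) \<in> leavitt_relations ultragraph_G"
  shows "rep n x i j = rep n y i j"
  using assms unfolding leavitt_relations_def
proof (elim UnE)
  assume "(x, y) \<in> {(gh e * ed f, if e = f then pr (urange ultragraph_G e) else 0) |e f.
      e \<in> uedges ultragraph_G \<and> f \<in> uedges ultragraph_G}"
  then obtain e f where "x = gh e * ed f" "y = (if e = f then pr (urange ultragraph_G e) else 0)"
    by blast
  then show ?thesis
    by (cases e; cases f) (auto simp: pr_gen ed_gen gh_gen)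
next
  assume "(x, y) \<in> {(pr {v}, \<Sum>e\<in>edges_from ultragraph_G v. ed e * gh e) |v.
      v \<in> regular_vertices ultragraph_G}"
  then obtain v where "x = pr {v}" "y = (\<Sum>e\<in>edges_from ultragraph_G v. ed e * gh e)"
    by blast
  then show ?thesis
    by (cases v) (auto simp: edges_from_G pr_gen ed_gen gh_gen)
next
  assume "(x, y) \<in> {(pr {usource ultragraph_G e} * ed e, ed e) |e. e \<in> uedges ultragraph_G}"
  then obtain e where "x = pr {usource ultragraph_G e} * ed e" "y = ed e"
    by blast
  then show ?thesis
    by (cases e) (auto simp: pr_gen ed_gen)
next
  assume "(x, y) \<in> {(ed e * pr (urange ultragraph_G e), ed e) |e. e \<in> uedges ultragraph_G}"
  then obtain e where "x = ed e * pr (urange ultragraph_G e)" "y = ed e"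
    by blast
  then show ?thesis
    by (cases e) (auto simp: pr_gen ed_gen)
next
  assume "(x, y) \<in> {(pr (urange ultragraph_G e) * gh e, gh e) |e. e \<in> uedges ultragraph_G}"
  then obtain e where "x = pr (urange ultragraph_G e) * gh e" "y = gh e"
    by blast
  then show ?thesis
    by (cases e) (auto simp: pr_gen gh_gen)
next
  assume "(x, y) \<in> {(gh e * pr {usource ultragraph_G e}, gh e) |e. e \<in> uedges ultragraph_G}"
  then obtain e where "x = gh e * pr {usource ultragraph_G e}" "y = gh e"
    by blast
  then show ?thesis
    by (cases e) (auto simp: pr_gen gh_gen)
qed (auto simp: pr_gen)

lemma rep_leavitt_ideal: "x \<in> leavitt_ideal ultragraph_G \<Longrightarrow> rep n x i j = 0"
  by (induction arbitrary: i j rule: leavitt_ideal.induct) (auto simp: rep_relation)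

text \<open>Singletons contain at most one w_n and A contains all of them; being finite or cofinite
  among the w_n is preserved by unions and intersections.\<close>

lemma gv_G_eventually:
  assumes "B \<in> generalized_vertices ultragraph_G"
  shows "\<exists>N b. \<forall>n\<ge>N. (W n \<in> B) = b"
  using assms
proof induction
  case (vertex v)
  show ?case
  proof (cases v)
    case (W m)
    then show ?thesis
      by (intro exI[of _ "Suc m"] exI[of _ False]) auto
  qed auto
next
  case (range e)
  show ?case
  proof (cases e)
    case (En m)
    then show ?thesis
      by (intro exI[of _ "Suc m"] exI[of _ False]) auto
  qed auto
next
  case (union A B)
  then obtain N M b c where "\<forall>n\<ge>N. (W n \<in> A) = b" "\<forall>n\<ge>M. (W n \<in> B) = c"
    by blast
  then show ?case
    by (intro exI[of _ "max N M"] exI[of _ "b \<or> c"]) auto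
next
  case (inter A B)
  then obtain N M b c where "\<forall>n\<ge>N. (W n \<in> A) = b" "\<forall>n\<ge>M. (W n \<in> B) = c"
    by blast
  then show ?case
    by (intro exI[of _ "max N M"] exI[of _ "b \<and> c"]) auto
qed auto

text \<open>The index depends on the element, through the finitely many generators occurring in it.
  Finite generation would remove this dependence.\<close>

lemma rep_eventually_constant:
  assumes "x \<in> free_carrier ultragraph_G"
  shows "\<exists>N m. \<forall>n\<ge>N. rep n x = m"
  using assms
proof (induction x rule: free_carrier_induct)
  case zero
  have "\<forall>n\<ge>0. rep n 0 = (\<lambda>_ _. 0)"
    by (simp add: fun_eq_iff)
  then show ?case
    by blast
next
  case (add x y)
  then obtain N M a b where "\<forall>n\<ge>N. rep n x = a" "\<forall>n\<ge>M. rep n y = b"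
    by blast
  then have "\<forall>n\<ge>max N M. rep n (x + y) = (\<lambda>i j. a i j + b i j)"
    by (simp add: fun_eq_iff)
  then show ?case
    by blast
next
  case (scale c x)
  then obtain N a where "\<forall>n\<ge>N. rep n x = a"
    by blast
  then have "\<forall>n\<ge>N. rep n (scale c x) = (\<lambda>i j. c * a i j)"
    by (simp add: fun_eq_iff)
  then show ?case
    by blast
next
  case (mult x y)
  then obtain N M a b where "\<forall>n\<ge>N. rep n x = a" "\<forall>n\<ge>M. rep n y = b"
    by blast
  then have "\<forall>n\<ge>max N M. rep n (x * y) = (\<lambda>i j. a i True * b True j + a i False * b False j)"
    by (simp add: fun_eq_iff)
  then show ?case
    by blast
next
  case (generator g)
  have "\<exists>N m. \<forall>n\<ge>N. letter_entry n g = (m :: bool \<Rightarrow> bool \<Rightarrow> 'a)"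
  proof (cases g)
    case (Proj B)
    then obtain N b where "\<forall>n\<ge>N. (W n \<in> B) = b"
      using generator gv_G_eventually[of B] by (auto simp: generators_def)
    then have "\<forall>n\<ge>N. letter_entry n g = (\<lambda>i j. of_bool (i = j \<and> (if i then V \<in> B else b)) :: 'a)"
      by (simp add: fun_eq_iff Proj)
    then show ?thesis
      by blast
  next
    case (Edge e)
    show ?thesis
    proof (cases e)
      case (En m)
      then have "\<forall>n\<ge>Suc m. letter_entry n g = (\<lambda>i j. 0 :: 'a)"
        by (simp add: fun_eq_iff Edge)
      then show ?thesis
        by blast
    next
      case E0
      then have "\<forall>n\<ge>0. letter_entry n g = (\<lambda>i j. of_bool (i \<and> \<not> j) :: 'a)"
        by (simp add: fun_eq_iff Edge)
      then show ?thesis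
        by blast
    qed
  next
    case (Ghost e)
    show ?thesis
    proof (cases e)
      case (En m)
      then have "\<forall>n\<ge>Suc m. letter_entry n g = (\<lambda>i j. 0 :: 'a)"
        by (simp add: fun_eq_iff Ghost)
      then show ?thesis
        by blast
    next
      case E0
      then have "\<forall>n\<ge>0. letter_entry n g = (\<lambda>i j. of_bool (\<not> i \<and> j) :: 'a)"
        by (simp add: fun_eq_iff Ghost)
      then show ?thesis
        by blast
    qed
  qed
  moreover have "rep n (gen g) = letter_entry n g" for n
    by (simp add: fun_eq_iff)
  ultimately show ?case
    by simp
qed


section \<open>The universal norm\<close>

lemma star_letter_invol [simp]: "star_letter (star_letter g) = g"
  by (cases g) simp_all

lemma star_word_invol [simp]: "star_word (star_word w) = w"
  by (cases w) (simp add: star_word_def rev_map o_def)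

lemma inj_star_word: "inj star_word"
  by (metis injI star_word_invol)

lemma lookup_star: "Poly_Mapping.lookup (star x) w = cnj (Poly_Mapping.lookup x (star_word w))"
  by (simp add: star_def Poly_Mapping.map.rep_eq map_key.rep_eq inj_star_word when_def)

lemma star_0 [simp]: "star 0 = 0"
  by (rule poly_mapping_eqI) (simp add: lookup_star)

lemma star_add: "star (x + y) = star x + star y"
  by (rule poly_mapping_eqI) (simp add: lookup_star lookup_add)

lemma star_diff: "star (x - y) = star x - star y"
  by (rule poly_mapping_eqI) (simp add: lookup_star lookup_minus)

lemma star_scale: "star (scale c x) = scale (cnj c) (star x)"
  by (rule poly_mapping_eqI) (simp add: lookup_star)

lemma star_star [simp]: "star (star x) = x"
  by (rule poly_mapping_eqI) (simp add: lookup_star)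

lemma star_single: "star (Poly_Mapping.single w c) = Poly_Mapping.single (star_word w) (cnj c)"
  by (rule poly_mapping_eqI) (auto simp: lookup_star lookup_single when_def)

lemma star_mult: "star (x * y) = star y * star x"
proof (induction x rule: free_induct)
  case (single w c)
  show ?case
    by (induction y rule: free_induct)
      (simp_all add: mult_single star_single star_add star_word_def plus_word_def algebra_simps)
qed (simp_all add: star_add algebra_simps)

lemma star_pr [simp]: "star (pr A) = pr A"
  and star_ed [simp]: "star (ed e) = gh e"
  and star_gh [simp]: "star (gh e) = ed e"
  by (simp_all add: pr_def ed_def gh_def star_single star_word_def)

lemma star_free_carrier:
  assumes "x \<in> free_carrier G"
  shows "star x \<in> free_carrier G"
  using assms
proof (induction x rule: free_carrier_induct)
  case (generator g)
  then show ?case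
    by (cases g) (auto simp: generators_def pr_gen[symmetric] ed_gen[symmetric] gh_gen[symmetric]
      intro!: free_carrier_intros)
qed (auto simp: star_add star_scale star_mult intro: free_carrier_intros)

lemma cstar_relation_carrier:
  assumes "wf_ultragraph G" "(x, y) \<in> cstar_relations G"
  shows "x \<in> free_carrier G" "y \<in> free_carrier G"
  using assms(2) range_nonempty_gv[OF assms(1)]
  unfolding cstar_relations_def
  by (auto intro!: free_carrier_intros generalized_vertices.empty generalized_vertices.union
      generalized_vertices.inter intro: generalized_vertices.vertex
      simp: regular_vertices_def edges_from_def)

locale seminorm =
  fixes G :: "('v, 'e) ultragraph" and p :: "('v, 'e, complex) free \<Rightarrow> real"
  assumes wf: "wf_ultragraph G" and seminorm: "cstar_seminorm G p"
begin

lemma nonneg: "x \<in> free_carrier G \<Longrightarrow> 0 \<le> p x"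
  and triangle: "x \<in> free_carrier G \<Longrightarrow> y \<in> free_carrier G \<Longrightarrow> p (x + y) \<le> p x + p y"
  and scale: "x \<in> free_carrier G \<Longrightarrow> p (scale c x) = cmod c * p x"
  and mult: "x \<in> free_carrier G \<Longrightarrow> y \<in> free_carrier G \<Longrightarrow> p (x * y) \<le> p x * p y"
  and cstar: "x \<in> free_carrier G \<Longrightarrow> p (star x * x) = (p x)\<^sup>2"
  and relation: "(x, y) \<in> cstar_relations G \<Longrightarrow> p (x - y) = 0"
  using seminorm unfolding cstar_seminorm_def by blast+

lemma zero: "p 0 = 0"
  using scale[OF free_carrier_0, of 0] by simp

lemma p_uminus: "x \<in> free_carrier G \<Longrightarrow> p (- x) = p x"
  using scale[of x "- 1"] by (simp add: scale_minus_one)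

text \<open>The C*-identity and submultiplicativity give
  \<open>(p y)\<^sup>2 = p (star y * y) \<le> p (star y) * p y\<close>. Cancelling
  \<open>p y\<close> yields one inequality, and applying it to \<open>star y\<close> the
  other.\<close>

lemma p_star:
  assumes "x \<in> free_carrier G"
  shows "p (star x) = p x"
proof -
  have "p y \<le> p (star y)" if y: "y \<in> free_carrier G" for y
  proof -
    have "(p y)\<^sup>2 \<le> p (star y) * p y"
      using cstar[OF y] mult[OF star_free_carrier[OF y] y] by simp
    then show ?thesis
      using nonneg[OF y] nonneg[OF star_free_carrier[OF y]]
      by (cases "p y = 0") (simp_all add: power2_eq_square)
  qed
  from this[OF assms] this[OF star_free_carrier[OF assms]] show ?thesis
    by simp
qed

definition null :: "('v, 'e, complex) free set" where
  "null = {x \<in> free_carrier G. p x = 0}"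

sublocale ideal_of "free_carrier G" null scale
proof
  fix x y :: "('v, 'e, complex) free" and c
  show "x \<in> null \<Longrightarrow> y \<in> null \<Longrightarrow> x + y \<in> null"
    using triangle[of x y] nonneg[of "x + y"] by (auto simp: null_def free_carrier_add)
  show "x \<in> null \<Longrightarrow> scale c x \<in> null"
    by (auto simp: null_def free_carrier_scale scale)
  show "y \<in> free_carrier G \<Longrightarrow> x \<in> null \<Longrightarrow> y * x \<in> null"
    using mult[of y x] nonneg[of "y * x"] by (auto simp: null_def free_carrier_mult)
  show "x \<in> null \<Longrightarrow> y \<in> free_carrier G \<Longrightarrow> x * y \<in> null"
    using mult[of x y] nonneg[of "x * y"] by (auto simp: null_def free_carrier_mult)
qed (auto intro: free_carrier_intros simp: scale_minus_one scale_diff null_def zero)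

notation cong (infix "\<approx>" 50)

lemma cong_iff: "x \<approx> y \<longleftrightarrow> x \<in> free_carrier G \<and> y \<in> free_carrier G \<and> p (x - y) = 0"
  unfolding cong_def by (auto simp: null_def free_carrier_diff)

lemma p_cong: "x \<approx> y \<Longrightarrow> p x = p y"
  using triangle[of "x - y" y] triangle[of "y - x" x] p_uminus[of "x - y"]
  by (auto simp: cong_iff free_carrier_diff)

lemma star_cong: "x \<approx> y \<Longrightarrow> star x \<approx> star y"
  using p_star[of "x - y"]
  by (auto simp: cong_iff star_free_carrier star_diff free_carrier_diff)

lemma relation_cong: "(x, y) \<in> cstar_relations G \<Longrightarrow> x \<approx> y"
  using cstar_relation_carrier[OF wf] relation
  by (auto simp: cong_iff)

text \<open>The C*-relations speak of partial isometries with orthogonal range projections.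
  Inserting s_e = s_e s_e^* s_e recovers the Leavitt relations: for distinct edges, s_e^* s_f
  acquires the null factor s_e s_e^* s_f s_f^* in the middle. The relations for ghosts are adjoints
  of those for edges.\<close>

lemma leavitt_relation_cong:
  assumes "(x, y) \<in> leavitt_relations G"
  shows "x \<approx> y"
proof -
  note gv = range_nonempty_gv[OF wf]
  have ed_S: "ed e \<in> (free_carrier G :: ('v, 'e, complex) free set)"
    and gh_S: "gh e \<in> (free_carrier G :: ('v, 'e, complex) free set)"
    and pr_S: "pr (urange G e) \<in> (free_carrier G :: ('v, 'e, complex) free set)"
      "pr {usource G e} \<in> (free_carrier G :: ('v, 'e, complex) free set)"
    if "e \<in> uedges G" for e
    using that gv[OF that] by (simp_all add: free_carrier_intros)
  have edghed: "ed e * gh e * ed e \<approx> ed e" and ghed: "gh e * ed e \<approx> pr (urange G e)"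
    and predgh: "pr {usource G e} * (ed e * gh e) \<approx> ed e * gh e" if "e \<in> uedges G" for e
    by (rule relation_cong, unfold cstar_relations_def star_ed, use that in blast)+
  have orth: "(ed e * gh e) * (ed f * gh f) \<approx> 0" if "e \<in> uedges G" "f \<in> uedges G" "e \<noteq> f" for e f
    by (rule relation_cong, unfold cstar_relations_def star_ed, use that in blast)
  have source_ed: "pr {usource G e} * ed e \<approx> ed e" if e: "e \<in> uedges G" for e
  proof -
    have "pr {usource G e} * ed e \<approx> pr {usource G e} * (ed e * gh e * ed e)"
      using e by (intro cong_left cong_sym[OF edghed] pr_S)
    also have "\<dots> = pr {usource G e} * (ed e * gh e) * ed e"
      by (simp add: mult.assoc)
    also have "\<dots> \<approx> ed e * gh e * ed e"
      using e by (intro cong_right predgh ed_S)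
    also have "\<dots> \<approx> ed e"
      using e by (rule edghed)
    finally show ?thesis .
  qed
  have ed_range: "ed e * pr (urange G e) \<approx> ed e" if e: "e \<in> uedges G" for e
  proof -
    have "ed e * pr (urange G e) \<approx> ed e * (gh e * ed e)"
      using e by (intro cong_left cong_sym[OF ghed] ed_S)
    then show ?thesis
      using cong_trans edghed[OF e] by (simp add: mult.assoc)
  qed
  have ghedgh: "gh e * (ed e * gh e) \<approx> gh e" if e: "e \<in> uedges G" for e
    using star_cong[OF edghed[OF e]] by (simp add: star_mult mult.assoc)
  have gh_ed: "gh e * ed f \<approx> 0" if ef: "e \<in> uedges G" "f \<in> uedges G" "e \<noteq> f" for e f
  proof -
    have "gh e * ed f \<approx> gh e * (ed e * gh e) * (ed f * gh f * ed f)"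
      using ef by (intro cong_mult cong_sym[OF ghedgh] cong_sym[OF edghed])
    also have "\<dots> = gh e * ((ed e * gh e) * (ed f * gh f)) * ed f"
      by (simp add: mult.assoc)
    also have "\<dots> \<approx> gh e * 0 * ed f"
      using ef by (intro cong_left cong_right orth ed_S gh_S)
    finally show ?thesis
      by simp
  qed
  show ?thesis
    using assms unfolding leavitt_relations_def
  proof (elim UnE)
    assume "(x, y) \<in> {(gh e * ed f, if e = f then pr (urange G e) else 0) |e f.
        e \<in> uedges G \<and> f \<in> uedges G}"
    then show ?thesis
      using ghed gh_ed by auto
  next
    assume "(x, y) \<in> {(pr (urange G e) * gh e, gh e) |e. e \<in> uedges G}"
    then show ?thesis
      using star_cong[OF ed_range] by (auto simp: star_mult)
  next
    assume "(x, y) \<in> {(gh e * pr {usource G e}, gh e) |e. e \<in> uedges G}"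
    then show ?thesis
      using star_cong[OF source_ed] by (auto simp: star_mult)
  next
    assume "(x, y) \<in> {(pr {usource G e} * ed e, ed e) |e. e \<in> uedges G}"
    then show ?thesis
      using source_ed by auto
  next
    assume "(x, y) \<in> {(ed e * pr (urange G e), ed e) |e. e \<in> uedges G}"
    then show ?thesis
      using ed_range by auto
  qed (rule relation_cong, unfold cstar_relations_def star_ed, blast)+
qed

lemma leavitt_ideal_null: "x \<in> leavitt_ideal G \<Longrightarrow> x \<in> null"
  by (induction rule: leavitt_ideal.induct)
    (auto intro: J_zero J_add J_scale J_left J_right cong_self_zero leavitt_relation_cong)

text \<open>For a projection the C*-identity reads t^2 = t, so its seminorm is 0 or 1; for an edge
  the square of the seminorm is that of the projection s_e^* s_e.\<close>

lemma generator_le_1: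
  assumes "g \<in> generators G"
  shows "p (gen g) \<le> 1"
proof -
  have pr: "p (pr A) \<le> 1" if A: "A \<in> generalized_vertices G" for A
  proof -
    have "pr A * pr A \<approx> pr A"
      by (rule relation_cong, unfold cstar_relations_def, use A in blast)
    then have "(p (pr A))\<^sup>2 = p (pr A)"
      using cstar[of "pr A"] p_cong A by (simp add: free_carrier_pr)
    then show ?thesis
      by (metis eq_iff mult_cancel_left1 power2_eq_square zero_le_one)
  qed
  have ed: "p (ed e) \<le> 1" if e: "e \<in> uedges G" for e
  proof -
    have "gh e * ed e \<approx> pr (urange G e)"
      by (rule relation_cong, unfold cstar_relations_def star_ed, use e in blast)
    then have "(p (ed e))\<^sup>2 = p (pr (urange G e))"
      using cstar[of "ed e"] p_cong e by (simp add: free_carrier_ed)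
    then have "(p (ed e))\<^sup>2 \<le> 1\<^sup>2"
      using pr range_nonempty_gv(2)[OF wf e] by simp
    then show ?thesis
      by (rule power2_le_imp_le) simp
  qed
  show ?thesis
    using assms pr ed p_star[of "ed _"]
    by (auto simp: generators_def pr_gen[symmetric] ed_gen[symmetric] gh_gen[symmetric]
        free_carrier_ed)
qed

lemma word_le_1:
  assumes "letters w \<noteq> []" "set (letters w) \<subseteq> generators G"
  shows "p (Poly_Mapping.single w 1) \<le> 1"
proof -
  have "p (Poly_Mapping.single (Word ls) 1) \<le> 1" if "ls \<noteq> []" "set ls \<subseteq> generators G" for ls
    using that
  proof (induction ls rule: list_nonempty_induct)
    case (single g)
    then show ?case
      using generator_le_1[of g] by (simp add: gen_def)
  next
    case (cons g ls)
    then have S: "gen g \<in> (free_carrier G :: ('v, 'e, complex) free set)"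
      "Poly_Mapping.single (Word ls) 1 \<in> (free_carrier G :: ('v, 'e, complex) free set)"
      by (auto intro!: free_carrier_gen free_carrier_single)
    have "p (gen g * Poly_Mapping.single (Word ls) 1) \<le> 1 * 1"
      using cons generator_le_1[of g] nonneg[OF S(1)] nonneg[OF S(2)]
      by (intro order_trans[OF mult[OF S]] mult_mono) auto
    then show ?case
      by (simp add: word_Cons)
  qed
  then show ?thesis
    using assms by (cases w) simp
qed

text \<open>The bound is uniform in the seminorm: it makes the supremum in
  \<open>universal_norm\<close> finite and later yields continuity of the gauge action.\<close>

lemma le_sum_norms:
  assumes "x \<in> free_carrier G"
  shows "p x \<le> (\<Sum>w\<in>Poly_Mapping.keys x. cmod (Poly_Mapping.lookup x w))"
proof -
  have "p (\<Sum>w\<in>I. Poly_Mapping.single w (Poly_Mapping.lookup x w))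
      \<le> (\<Sum>w\<in>I. cmod (Poly_Mapping.lookup x w))" if "finite I" "I \<subseteq> Poly_Mapping.keys x" for I
    using that
  proof (induction I rule: finite_induct)
    case (insert w I)
    have words: "Poly_Mapping.single v c \<in> free_carrier G" if "v \<in> Poly_Mapping.keys x" for v c
      using assms that by (simp add: free_carrier_def)
    have "p (Poly_Mapping.single w (Poly_Mapping.lookup x w)) \<le> cmod (Poly_Mapping.lookup x w)"
      using scale[of "Poly_Mapping.single w 1" "Poly_Mapping.lookup x w"] words[of w 1]
        word_le_1[of w] insert.prems assms
      by (auto simp: free_carrier_def intro: mult_left_le)
    then show ?case
      using insert words
      by (auto intro!: order_trans[OF triangle] free_carrier_sum)
  qed (simp add: zero)
  from this[OF finite_keys order_refl] show ?thesis
    by (simp add: sum_monomials)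
qed

end

text \<open>Ensures that the supremum is not taken over the empty set.\<close>

lemma cstar_seminorm_zero: "cstar_seminorm G (\<lambda>_. 0)"
  by (auto simp: cstar_seminorm_def)

section \<open>Norm properties of the supremum\<close>

context
  fixes G :: "('v, 'e) ultragraph"
  assumes wf: "wf_ultragraph G"
begin

lemma seminormI: "cstar_seminorm G p \<Longrightarrow> seminorm G p"
  by (simp add: seminorm_def wf)

lemma le_universal_norm:
  assumes "cstar_seminorm G p" "x \<in> free_carrier G"
  shows "p x \<le> universal_norm G x"
  unfolding universal_norm_def
  by (rule cSUP_upper) (use assms seminorm.le_sum_norms[OF seminormI] in \<open>auto intro!: bdd_aboveI2\<close>)

lemma universal_norm_le:
  assumes "\<And>p. cstar_seminorm G p \<Longrightarrow> p x \<le> c"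
  shows "universal_norm G x \<le> c"
  unfolding universal_norm_def
  by (rule cSUP_least) (use assms cstar_seminorm_zero in auto)

lemma un_nonneg: "x \<in> free_carrier G \<Longrightarrow> 0 \<le> universal_norm G x"
  using le_universal_norm[OF cstar_seminorm_zero] .

lemma un_triangle:
  assumes "x \<in> free_carrier G" "y \<in> free_carrier G"
  shows "universal_norm G (x + y) \<le> universal_norm G x + universal_norm G y"
proof (rule universal_norm_le)
  fix p assume p: "cstar_seminorm G p"
  then have "p (x + y) \<le> p x + p y"
    by (rule seminorm.triangle[OF seminormI assms])
  then show "p (x + y) \<le> universal_norm G x + universal_norm G y"
    using le_universal_norm[OF p assms(1)] le_universal_norm[OF p assms(2)] by simp
qed

lemma un_mult:
  assumes "x \<in> free_carrier G" "y \<in> free_carrier G"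
  shows "universal_norm G (x * y) \<le> universal_norm G x * universal_norm G y"
proof (rule universal_norm_le)
  fix p assume p: "cstar_seminorm G p"
  then have "p (x * y) \<le> p x * p y"
    by (rule seminorm.mult[OF seminormI assms])
  also have "\<dots> \<le> universal_norm G x * universal_norm G y"
    using p assms seminorm.nonneg[OF seminormI] un_nonneg le_universal_norm
    by (intro mult_mono) auto
  finally show "p (x * y) \<le> universal_norm G x * universal_norm G y" .
qed

lemma un_scale_le:
  assumes "x \<in> free_carrier G"
  shows "universal_norm G (scale c x) \<le> cmod c * universal_norm G x"
proof (rule universal_norm_le)
  fix p assume p: "cstar_seminorm G p"
  then show "p (scale c x) \<le> cmod c * universal_norm G x"
    using seminorm.scale[OF seminormI[OF p] assms] le_universal_norm[OF p assms]
    by (simp add: mult_left_mono)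
qed

lemma un_leavitt_ideal:
  assumes "x \<in> leavitt_ideal G"
  shows "universal_norm G x = 0"
proof (rule antisym)
  show "universal_norm G x \<le> 0"
    by (rule universal_norm_le)
      (use seminorm.leavitt_ideal_null[OF seminormI assms] seminorm.null_def[OF seminormI] in force)
  show "0 \<le> universal_norm G x"
    using leavitt_ideal_subset[OF wf] assms by (blast intro: un_nonneg)
qed

lemma un_0: "universal_norm G 0 = 0"
  using un_leavitt_ideal[OF leavitt_ideal.zero] .

lemma un_uminus: "x \<in> free_carrier G \<Longrightarrow> universal_norm G (- x) = universal_norm G x"
  using un_scale_le[of x "- 1"] un_scale_le[of "- x" "- 1"]
  by (simp add: scale_minus_one free_carrier_uminus)

lemma un_minus_commute:
  "x \<in> free_carrier G \<Longrightarrow> y \<in> free_carrier G \<Longrightarrow> universal_norm G (x - y) = universal_norm G (y - x)"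
  using un_uminus[of "x - y"] by (simp add: free_carrier_diff)

lemma un_word:
  assumes "letters w \<noteq> []" "set (letters w) \<subseteq> generators G"
  shows "universal_norm G (Poly_Mapping.single w 1) \<le> 1"
  by (rule universal_norm_le) (rule seminorm.word_le_1[OF seminormI assms])

lemma un_generator: "g \<in> generators G \<Longrightarrow> universal_norm G (gen g) \<le> 1"
  using un_word[of "Word [g]"] by (simp add: gen_def)

lemma ideal_of_null: "ideal_of (free_carrier G) {x \<in> free_carrier G. universal_norm G x = 0} scale"
proof
  fix x y :: "('v, 'e, complex) free" and c
  let ?J = "{x \<in> free_carrier G. universal_norm G x = 0}"
  show "x \<in> ?J \<Longrightarrow> y \<in> ?J \<Longrightarrow> x + y \<in> ?J"
    using un_triangle[of x y] un_nonneg[of "x + y"] by (auto simp: free_carrier_add)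
  show "x \<in> ?J \<Longrightarrow> scale c x \<in> ?J"
    using un_scale_le[of x c] un_nonneg[of "scale c x"] by (auto simp: free_carrier_scale)
  show "y \<in> free_carrier G \<Longrightarrow> x \<in> ?J \<Longrightarrow> y * x \<in> ?J"
    using un_mult[of y x] un_nonneg[of "y * x"] by (auto simp: free_carrier_mult)
  show "x \<in> ?J \<Longrightarrow> y \<in> free_carrier G \<Longrightarrow> x * y \<in> ?J"
    using un_mult[of x y] un_nonneg[of "x * y"] by (auto simp: free_carrier_mult)
qed (auto intro: free_carrier_intros simp: scale_minus_one scale_diff un_0)

lemma ultragraph_ideal_null:
  "ultragraph_ideal G {x \<in> free_carrier G. universal_norm G x = 0}"
  using ideal_of_null wf un_leavitt_ideal leavitt_ideal_subset[OF wf]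
  unfolding ultragraph_ideal_def ultragraph_ideal_axioms_def by blast

end


section \<open>Graph algebras with finitely many essential vertices and edges\<close>

context correspondence
begin

lemma unit_transfer:
  assumes "u \<in> S" and u: "\<And>x. x \<in> S \<Longrightarrow> u * x - x \<in> J"
  shows "\<exists>u'\<in>S'. \<forall>x\<in>S'. u' * x - x \<in> J'"
proof -
  obtain u' where u': "rel u u'"
    using rel_total[OF assms(1)] ..
  have "u' * x' - x' \<in> J'" if x': "x' \<in> S'" for x'
  proof -
    obtain x where x: "rel x x'"
      using rel_surj[OF x'] ..
    show ?thesis
      using rel_J[OF rel_diff[OF rel_mult[OF u' x] x]] u rel_S[OF x] by blast
  qed
  then show ?thesis
    using rel_S[OF u'] by blast
qed

lemma hall_transfer:
  assumes "\<And>x y z. x \<in> S \<Longrightarrow> y \<in> S \<Longrightarrow> z \<in> S \<Longrightarrow> hall x y z \<in> J"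
    and "x' \<in> S'" "y' \<in> S'" "z' \<in> S'"
  shows "hall x' y' z' \<in> J'"
proof -
  obtain x y z where r: "rel x x'" "rel y y'" "rel z z'"
    using assms(2-) rel_surj by meson
  have "rel (hall x y z) (hall x' y' z')"
    unfolding hall_def by (intro rel_diff rel_mult r)
  then show ?thesis
    using rel_J assms(1) rel_S r by blast
qed

lemma central_idempotents_transfer:
  fixes z :: "nat \<Rightarrow> 'a"
  assumes "\<And>n. z n \<in> S" and "\<And>n. z n \<notin> J"
    and "\<And>n x. x \<in> S \<Longrightarrow> z n * x - x * z n \<in> J"
    and "\<And>n m. z n * z m - (if n = m then z n else 0) \<in> J"
  obtains z' where "\<And>n. z' n \<in> S'" and "\<And>n :: nat. z' n \<notin> J'"
    and "\<And>n x. x \<in> S' \<Longrightarrow> z' n * x - x * z' n \<in> J'"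
    and "\<And>n m. z' n * z' m - (if n = m then z' n else 0) \<in> J'"
proof -
  obtain z' where z': "\<And>n. rel (z n) (z' n)"
    using rel_total[OF assms(1)] by metis
  show ?thesis
  proof (rule that[of z'])
    show "z' n \<in> S'" for n
      using rel_S z' by blast
    show "z' n \<notin> J'" for n
      using rel_J[OF z'] assms(2) by blast
    show "z' n * x' - x' * z' n \<in> J'" if x': "x' \<in> S'" for n x'
    proof -
      obtain x where x: "rel x x'"
        using rel_surj[OF x'] ..
      show ?thesis
        using rel_J[OF rel_diff[OF rel_mult[OF z' x] rel_mult[OF x z']]] assms(3) rel_S[OF x]
        by blast
    qed
    show "z' n * z' m - (if n = m then z' n else 0) \<in> J'" for n m
    proof (cases "n = m")
      case True
      then show ?thesis
        using rel_J[OF rel_diff[OF rel_mult[OF z' z'] z']] assms(4)[of n n] by auto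
    next
      case False
      then show ?thesis
        using rel_J[OF rel_mult[OF z' z']] assms(4)[of n m] by auto
    qed
  qed
qed

end

section \<open>Supports and essential generators in a graph algebra\<close>

lemma ultragraph_of_graph_simps [simp]:
  "uverts (ultragraph_of_graph E) = verts E" "uedges (ultragraph_of_graph E) = arcs E"
  "usource (ultragraph_of_graph E) = tail E" "urange (ultragraph_of_graph E) e = {head E e}"
  by (simp_all add: ultragraph_of_graph_def)

lemma gv_graph:
  assumes "wf_digraph E" "B \<in> generalized_vertices (ultragraph_of_graph E)"
  shows "finite B \<and> B \<subseteq> verts E"
  using assms(2) by induction (use assms(1) in \<open>auto simp: wf_digraph_def\<close>)

lemma finite_gv_graph:
  assumes "finite B" "B \<subseteq> verts E"
  shows "B \<in> generalized_vertices (ultragraph_of_graph E)"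
  using assms
proof (induction B rule: finite_induct)
  case (insert v B)
  then show ?case
    using generalized_vertices.union[OF generalized_vertices.vertex[of v "ultragraph_of_graph E"], of B]
    by simp
qed (rule generalized_vertices.empty)

locale graph_ideal = ultragraph_ideal "ultragraph_of_graph E" J
  for E :: "('v, 'e) pre_digraph" and J :: "('v, 'e, 'k::field) free set" +
  assumes wf_digraph: "wf_digraph E"
begin

notation cong (infix "\<approx>" 50)

abbreviation "S \<equiv> free_carrier (ultragraph_of_graph E) :: ('v, 'e, 'k) free set"

lemma tail_E: "e \<in> arcs E \<Longrightarrow> tail E e \<in> verts E"
  and head_E: "e \<in> arcs E \<Longrightarrow> head E e \<in> verts E"
  using wf_digraph by (auto simp: wf_digraph_def)

lemma vertex_gv: "v \<in> verts E \<Longrightarrow> {v} \<in> generalized_vertices (ultragraph_of_graph E)"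
  by (rule finite_gv_graph) auto

lemma vertex_S: "v \<in> verts E \<Longrightarrow> pr {v} \<in> S"
  by (intro pr_S vertex_gv)

lemma arc_S: "e \<in> arcs E \<Longrightarrow> ed e \<in> S" "e \<in> arcs E \<Longrightarrow> gh e \<in> S"
  by (simp_all add: ed_S gh_S)

lemma ed_head: "e \<in> arcs E \<Longrightarrow> ed e * pr {head E e} \<approx> ed e"
  and head_gh: "e \<in> arcs E \<Longrightarrow> pr {head E e} * gh e \<approx> gh e"
  and gh_ed_head: "e \<in> arcs E \<Longrightarrow> gh e * ed e \<approx> pr {head E e}"
  using ed_range[of e] range_gh[of e] gh_ed[of e] by simp_all

lemma pr_idem: "v \<in> verts E \<Longrightarrow> pr {v} * pr {v} \<approx> pr {v}"
  using pr_pr[OF vertex_gv vertex_gv, of v v] by simp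

text \<open>Every generator ends at finitely many vertices, and an element involves finitely many
  generators. Applied to the unit, or to an approximation of it, this makes all but finitely many
  vertex projections vanish.\<close>

lemma right_support:
  assumes "x \<in> S"
  shows "\<exists>F. finite F \<and> F \<subseteq> verts E \<and> (\<forall>v\<in>verts E - F. x * pr {v} \<in> J)"
  using assms
proof (induction x rule: free_carrier_induct)
  case zero
  then show ?case
    by (intro exI[of _ "{}"]) (simp add: J_zero)
next
  case (add x y)
  then obtain F H where "finite F \<and> F \<subseteq> verts E \<and> (\<forall>v\<in>verts E - F. x * pr {v} \<in> J)"
    "finite H \<and> H \<subseteq> verts E \<and> (\<forall>v\<in>verts E - H. y * pr {v} \<in> J)"
    by blast
  then show ?case
    by (intro exI[of _ "F \<union> H"]) (auto simp: distrib_right intro: J_add)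
next
  case (scale c x)
  then obtain F where "finite F \<and> F \<subseteq> verts E \<and> (\<forall>v\<in>verts E - F. x * pr {v} \<in> J)"
    by blast
  then show ?case
    by (intro exI[of _ F]) (auto simp: scale_mult_left[symmetric] intro: J_scale)
next
  case (mult x y)
  then obtain F where "finite F \<and> F \<subseteq> verts E \<and> (\<forall>v\<in>verts E - F. y * pr {v} \<in> J)"
    by blast
  then show ?case
    using mult by (intro exI[of _ F]) (auto simp: mult.assoc intro: J_left)
next
  case (generator g)
  show ?case
  proof (cases g)
    case (Proj B)
    then have B: "B \<in> generalized_vertices (ultragraph_of_graph E)"
      using generator by (auto simp: generators_def)
    have "pr B * pr {v} \<in> J" if "v \<in> verts E - B" for v
      using cong_trans[OF pr_pr[OF B vertex_gv[of v]], of 0] pr_empty that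
      by (simp add: cong_0_iff[symmetric])
    then show ?thesis
      using gv_graph[OF wf_digraph B] by (intro exI[of _ B]) (simp add: Proj pr_gen[symmetric])
  next
    case (Edge e)
    then have e: "e \<in> arcs E"
      using generator by (auto simp: generators_def)
    have "ed e * pr {v} \<in> J" if "v \<in> verts E - {head E e}" for v
      using cong_trans[OF ed_pr[OF vertex_gv[of v], of e], of 0] that e
        cong_zero_right[OF pr_empty arc_S(1)[OF e]] by (simp add: cong_0_iff[symmetric])
    then show ?thesis
      using head_E[OF e] by (intro exI[of _ "{head E e}"]) (simp add: Edge ed_gen[symmetric])
  next
    case (Ghost e)
    then have e: "e \<in> arcs E"
      using generator by (auto simp: generators_def)
    have "gh e * pr {v} \<in> J" if "v \<in> verts E - {tail E e}" for v
      using gh_pr[OF vertex_gv[of v], of e] that e by (auto simp: cong_0_iff[symmetric])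
    then show ?thesis
      using tail_E[OF e] by (intro exI[of _ "{tail E e}"]) (simp add: Ghost gh_gen[symmetric])
  qed
qed

text \<open>For three edges into u the elements X_ab = s_a s_b^* are three by three matrix units.
  With x = X_ef and y = X_fe the commutator is X_ee - X_ff, its square is X_ee + X_ff, and the
  commutator of the latter with X_fg is X_fg itself. So X_fg vanishes, and with it p_u = s_f^* X_fg
  s_g.\<close>

lemma matrix_units_3:
  assumes arcs: "e \<in> arcs E" "f \<in> arcs E" "g \<in> arcs E"
    and distinct: "e \<noteq> f" "e \<noteq> g" "f \<noteq> g"
    and head: "head E e = u" "head E f = u" "head E g = u"
    and hall: "\<And>x y z. x \<in> S \<Longrightarrow> y \<in> S \<Longrightarrow> z \<in> S \<Longrightarrow> hall x y z \<in> J"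
  shows "pr {u} \<in> J"
proof -
  define X where "X a b = ed a * (gh b :: ('v, 'e, 'k) free)" for a b
  have u: "u \<in> verts E"
    using head_E[OF arcs(1)] head by simp
  have XS: "X a b \<in> S" if "a \<in> {e, f, g}" "b \<in> {e, f, g}" for a b
    using that arcs by (auto simp: X_def intro!: S_mult arc_S)
  have XX: "X a b * X c d \<approx> (if b = c then X a d else 0)"
    if "a \<in> {e, f, g}" "b \<in> {e, f, g}" "c \<in> {e, f, g}" "d \<in> {e, f, g}" for a b c d
  proof -
    have A: "a \<in> arcs E" "b \<in> arcs E" "c \<in> arcs E" "d \<in> arcs E" "head E b = u" "head E a = u"
      using that arcs head by auto
    have "X a b * X c d = ed a * (gh b * ed c) * gh d"
      by (simp add: X_def mult.assoc)
    also have "\<dots> \<approx> ed a * (if b = c then pr {u} else 0) * gh d"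
      using gh_ed_if[of b c] A by (intro cong_left cong_right arc_S) auto
    also have "\<dots> \<approx> (if b = c then X a d else 0)"
      using cong_right[OF ed_head[of a], of "gh d"] A arc_S cong_refl[OF S_zero] by (auto simp: X_def)
    finally show ?thesis .
  qed
  let ?q = "X e f * X f e - X f e * X e f"
  have q: "?q \<approx> X e e - X f f"
    using XX[of e f f e] XX[of f e e f] by (intro cong_diff) auto
  have "?q * ?q \<approx> (X e e - X f f) * (X e e - X f f)"
    by (intro cong_mult q)
  also have "\<dots> = X e e * X e e - X e e * X f f - (X f f * X e e - X f f * X f f)"
    by (simp add: algebra_simps)
  also have "\<dots> \<approx> X e e - 0 - (0 - X f f)"
    using XX[of e e e e] XX[of e e f f] XX[of f f e e] XX[of f f f f] distinct
    by (intro cong_diff) auto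
  finally have qq: "?q * ?q \<approx> X e e + X f f"
    by simp
  have "?q * ?q * X f g - X f g * (?q * ?q) \<approx>
      (X e e + X f f) * X f g - X f g * (X e e + X f f)"
    by (intro cong_diff cong_left cong_right qq XS) auto
  also have "\<dots> = X e e * X f g + X f f * X f g - (X f g * X e e + X f g * X f f)"
    by (simp add: algebra_simps)
  also have "\<dots> \<approx> 0 + X f g - (0 + 0)"
    using XX[of e e f g] XX[of f f f g] XX[of f g e e] XX[of f g f f] distinct
    by (intro cong_diff cong_add) auto
  finally have "hall (X e f) (X f e) (X f g) \<approx> X f g"
    by (simp add: hall_def)
  moreover have "hall (X e f) (X f e) (X f g) \<in> J"
    by (intro hall XS) auto
  ultimately have "X f g \<approx> 0"
    using cong_J_iff cong_0_iff by metis
  then have "gh f * X f g * ed g \<in> J"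
    using arcs by (intro J_left J_right arc_S) (simp_all add: cong_0_iff)
  moreover have "gh f * X f g * ed g = (gh f * ed f) * (gh g * ed g)"
    by (simp add: X_def mult.assoc)
  then have "gh f * X f g * ed g \<approx> pr {u} * pr {u}"
    using cong_mult[OF gh_ed_head[OF arcs(2)] gh_ed_head[OF arcs(3)]] head by simp
  then have "gh f * X f g * ed g \<approx> pr {u}"
    using cong_trans pr_idem[OF u] by blast
  ultimately show ?thesis
    using cong_J_iff by blast
qed

text \<open>A vertex with nonzero projection receives at most two edges, and all such vertices lie
  in F.\<close>

lemma finite_essential_arcs:
  assumes "finite F" and F: "\<And>v. v \<in> verts E - F \<Longrightarrow> pr {v} \<in> J"
    and hall: "\<And>x y z. x \<in> S \<Longrightarrow> y \<in> S \<Longrightarrow> z \<in> S \<Longrightarrow> hall x y z \<in> J"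
  shows "finite {f \<in> arcs E. pr {head E f} \<notin> J}"
proof -
  have fib: "finite {f \<in> arcs E. head E f = u}" if "pr {u} \<notin> J" for u
  proof (rule ccontr)
    assume "infinite {f \<in> arcs E. head E f = u}"
    then obtain T where T: "T \<subseteq> {f \<in> arcs E. head E f = u}" "card T = 3"
      using infinite_arbitrarily_large by blast
    then obtain e f g where "T = {e, f, g}" "e \<noteq> f" "e \<noteq> g" "f \<noteq> g"
      by (auto simp: card_3_iff)
    then show False
      using matrix_units_3[of e f g u] hall T(1) that by auto
  qed
  have "{f \<in> arcs E. pr {head E f} \<notin> J} \<subseteq> (\<Union>u\<in>{u \<in> F. pr {u} \<notin> J}. {f \<in> arcs E. head E f = u})"
    using F head_E by blast
  then show ?thesis
    by (rule finite_subset) (use assms(1) fib in auto)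
qed

lemma inessential_arc:
  assumes "f \<in> arcs E" "pr {head E f} \<in> J"
  shows "ed f \<in> J" "gh f \<in> J"
  using cong_J_iff[OF ed_head[OF assms(1)]] cong_J_iff[OF head_gh[OF assms(1)]]
    J_left[OF arc_S(1)[OF assms(1)] assms(2)] J_right[OF assms(2) arc_S(2)[OF assms(1)]] by simp_all

text \<open>Finite generation in the form of an induction rule: P is closed under congruence, so
  generators in \<open>J\<close> count as zero and only the vertices in F and the edges with nonzero
  head projection need checking.\<close>

lemma essential_induct:
  assumes F: "\<And>v. v \<in> verts E - F \<Longrightarrow> pr {v} \<in> J"
    and cong: "\<And>x y. x \<approx> y \<Longrightarrow> P y \<Longrightarrow> P x"
    and "P 0" and add: "\<And>x y. P x \<Longrightarrow> P y \<Longrightarrow> P (x + y)"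
    and "\<And>x y. P x \<Longrightarrow> P y \<Longrightarrow> P (x * y)" and "\<And>c x. P x \<Longrightarrow> P (scale c x)"
    and pr: "\<And>v. v \<in> F \<inter> verts E \<Longrightarrow> P (pr {v})"
    and edge: "\<And>f. f \<in> arcs E \<Longrightarrow> pr {head E f} \<notin> J \<Longrightarrow> P (ed f) \<and> P (gh f)"
    and "x \<in> S"
  shows "P x"
proof -
  have J: "P x" if "x \<in> J" for x
    using that cong assms(3) cong_0_iff by blast
  have vertex: "P (pr {v})" if "v \<in> verts E" for v
    using that pr F J by blast
  have set: "P (pr B)" if "finite B" "B \<subseteq> verts E" for B
    using that
  proof (induction B rule: finite_induct)
    case empty
    then show ?case
      using cong[OF pr_empty] assms(3) by blast
  next
    case (insert v B)
    have "pr ({v} \<union> B) \<approx> pr {v} + pr B - pr ({v} \<inter> B)"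
      using insert by (intro pr_Un finite_gv_graph) auto
    also have "\<dots> \<approx> pr {v} + pr B - 0"
      using insert pr_empty
      by (intro cong_diff cong_refl S_add pr_S finite_gv_graph) auto
    finally show ?case
      using insert add[OF vertex[of v]] cong by simp
  qed
  have arc: "P (ed f)" "P (gh f)" if "f \<in> arcs E" for f
    using that edge[of f] J[OF inessential_arc(1)] J[OF inessential_arc(2)] by blast+
  show ?thesis
    using \<open>x \<in> S\<close>
  proof (induction x rule: free_carrier_induct)
    case (generator g)
    then show ?case
      using set gv_graph[OF wf_digraph] arc
      by (cases g) (auto simp: generators_def pr_gen[symmetric] ed_gen[symmetric] gh_gen[symmetric])
  qed (use assms in auto)
qed

end


section \<open>The Leavitt path algebra of a graph\<close>

theorem leavitt_not_isomorphic:
  fixes E :: "('v, 'e) pre_digraph"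
  assumes "wf_digraph E"
  shows "\<not> alg_isomorphic (ultragraph_leavitt_algebra TYPE('k::field) ultragraph_G)
    (leavitt_path_algebra TYPE('k) E)"
proof
  let ?JG = "leavitt_ideal ultragraph_G :: (vertex, edge, 'k) free set"
  let ?JE = "leavitt_ideal (ultragraph_of_graph E) :: ('v, 'e, 'k) free set"
  assume "alg_isomorphic (ultragraph_leavitt_algebra TYPE('k) ultragraph_G)
    (leavitt_path_algebra TYPE('k) E)"
  then obtain h where h: "alg_isomorphism (ultragraph_leavitt_algebra TYPE('k) ultragraph_G)
      (leavitt_path_algebra TYPE('k) E) h"
    unfolding alg_isomorphic_def by blast
  interpret G: ideal_G ?JG
    unfolding ideal_G_def ultragraph_ideal_def ultragraph_ideal_axioms_def
    by (simp add: ideal_of_leavitt wf_ultragraph_G)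
  interpret E: graph_ideal E ?JE
    unfolding graph_ideal_def ultragraph_ideal_def ultragraph_ideal_axioms_def graph_ideal_axioms_def
    by (simp add: ideal_of_leavitt wf_ultragraph_of_graph assms)
  have "alg_isomorphism G.quot E.quot h"
    using h by (simp add: ultragraph_leavitt_algebra_def leavitt_path_algebra_def G.quot_def
        E.quot_def G.R_def E.R_def leavitt_cong_def free_alg_def)
  then obtain rel where "correspondence (free_carrier ultragraph_G) ?JG scale
      (free_carrier (ultragraph_of_graph E)) ?JE scale rel"
    using correspondence_exists G.ideal_of_axioms E.ideal_of_axioms by blast
  then interpret correspondence "free_carrier ultragraph_G" ?JG scale
      "free_carrier (ultragraph_of_graph E)" ?JE scale rel .
  have hall: "hall x y z \<in> ?JE" if "x \<in> E.S" "y \<in> E.S" "z \<in> E.S" for x y z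
    using hall_transfer[OF G.hall_G that] .
  have uG: "G.pW + pr {V} \<in> free_carrier ultragraph_G"
    by (intro G.S_add G.pr_S gv_G)
  obtain u where u: "u \<in> E.S" "\<And>x. x \<in> E.S \<Longrightarrow> u * x - x \<in> ?JE"
    using unit_transfer[OF uG] G.unit(1) G.cong_self_zero by blast
  obtain F where F: "finite F" "\<And>v. v \<in> verts E - F \<Longrightarrow> u * pr {v} \<in> ?JE"
    using E.right_support[OF u(1)] by blast
  \<comment> \<open>Both u p_v and u p_v - p_v vanish.\<close>
  have F': "pr {v} \<in> ?JE" if v: "v \<in> verts E - F" for v
    using E.J_diff[OF F(2)[OF v] u(2)[OF E.vertex_S[of v]]] v by simp
  define D where "D = {f \<in> arcs E. pr {head E f} \<notin> ?JE}"
  have D: "finite D"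
    unfolding D_def by (rule E.finite_essential_arcs[OF F(1) F' hall])
  \<comment> \<open>One preimage suffices: preimages of congruent elements differ by an element of
    the Leavitt ideal, on which every \<open>rep n\<close> is zero.\<close>
  define stable where "stable N x \<longleftrightarrow> (\<exists>x' m. rel x' x \<and> (\<forall>n\<ge>N. rep n x' = m))" for N x
  have stable_mono: "stable M x" if "stable N x" "N \<le> M" for N M x
    using that unfolding stable_def by (meson order_trans)
  have stable_ex: "\<exists>N. stable N x" if x: "x \<in> E.S" for x
  proof -
    obtain x' where x': "rel x' x"
      using rel_surj[OF x] by blast
    then show ?thesis
      using rep_eventually_constant[of x'] rel_S[OF x'] unfolding stable_def by blast
  qed
  define \<Gamma> where "\<Gamma> = (\<lambda>v. pr {v}) ` (F \<inter> verts E) \<union> ed ` D \<union> (gh ` D :: ('v, 'e, 'k) free set)"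
  have \<Gamma>: "finite \<Gamma>" "\<Gamma> \<subseteq> E.S"
    using F(1) D E.vertex_S E.arc_S by (auto simp: \<Gamma>_def D_def)
  \<comment> \<open>Finiteness of the generating set enters here: the largest of finitely many
    thresholds serves all generators.\<close>
  then have "\<exists>N. \<forall>x\<in>\<Gamma>. stable N x"
  proof (induction \<Gamma> rule: finite_induct)
    case (insert x \<Gamma>)
    then obtain M where M: "\<forall>x\<in>\<Gamma>. stable M x"
      by auto
    obtain N where N: "stable N x"
      using stable_ex[of x] insert.prems by auto
    show ?case
      using stable_mono[OF N, of "max N M"] stable_mono[of M _ "max N M"] M
      by (intro exI[of _ "max N M"]) auto
  qed simp
  then obtain N where N: "\<And>x. x \<in> \<Gamma> \<Longrightarrow> stable N x"
    by blast
  have rep_cong: "rep n x' = rep n y'" if "x' - y' \<in> ?JG" for n x' y'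
    using rep_leavitt_ideal[OF that, of n] by (simp add: fun_eq_iff)
  have cong: "stable N x" if xy: "E.cong x y" and y: "stable N y" for x y
  proof -
    obtain x' y' m where r: "rel x' x" "rel y' y" and m: "\<forall>n\<ge>N. rep n y' = m"
      using rel_surj[OF E.cong_S(1)[OF xy]] y unfolding stable_def by blast
    have "x' - y' \<in> ?JG"
      using rel_cong[OF r] E.cong_self_zero[OF xy] by blast
    then show ?thesis
      using r(1) m rep_cong[of x' y'] unfolding stable_def by auto
  qed
  have zero: "stable N 0"
  proof -
    obtain y where "rel 0 y"
      using rel_total[OF G.S_zero] by blast
    then have "rel (0 - 0) (y - y)"
      by (intro rel_diff)
    moreover have "rep n 0 = (\<lambda>_ _. 0)" for n
      by (simp add: fun_eq_iff)
    ultimately show ?thesis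
      unfolding stable_def by auto
  qed
  have add: "stable N (x + y)" and mult: "stable N (x * y)" if x: "stable N x" and y: "stable N y" for x y
  proof -
    obtain x' y' a b where r: "rel x' x" "rel y' y"
      and *: "\<forall>n\<ge>N. rep n x' = a" "\<forall>n\<ge>N. rep n y' = b"
      using x y unfolding stable_def by blast
    have "\<forall>n\<ge>N. rep n (x' + y') = (\<lambda>i j. a i j + b i j)"
      "\<forall>n\<ge>N. rep n (x' * y') = (\<lambda>i j. a i True * b True j + a i False * b False j)"
      using * by (simp_all add: fun_eq_iff)
    then show "stable N (x + y)" "stable N (x * y)"
      using rel_add[OF r] rel_mult[OF r] unfolding stable_def by blast+
  qed
  have scale: "stable N (scale c x)" if x: "stable N x" for c x
  proof -
    obtain x' a where r: "rel x' x" and *: "\<forall>n\<ge>N. rep n x' = a"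
      using x unfolding stable_def by blast
    then have "\<forall>n\<ge>N. rep n (scale c x') = (\<lambda>i j. c * a i j)"
      by (simp add: fun_eq_iff)
    then show ?thesis
      using rel_scale[OF r] unfolding stable_def by blast
  qed
  have vertex: "stable N (pr {v})" if "v \<in> F \<inter> verts E" for v
    using that by (intro N) (simp add: \<Gamma>_def)
  have arc: "stable N (ed f) \<and> stable N (gh f)" if "f \<in> arcs E" "pr {head E f} \<notin> ?JE" for f
    using that by (intro conjI N) (simp_all add: \<Gamma>_def D_def)
  have all: "stable N x" if "x \<in> E.S" for x
    using F' cong zero add mult scale vertex arc that by (rule E.essential_induct)
  \<comment> \<open>Both N and N + 1 lie in the range where the representations must agree, yet p at
    w_{N+1} is nonzero in representation N + 1 and zero in representation N.\<close>
  have w: "(pr {W (Suc N)} :: (vertex, edge, 'k) free) \<in> free_carrier ultragraph_G"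
    by (intro G.pr_S gv_G)
  then obtain x where x: "rel (pr {W (Suc N)}) x"
    using rel_total by blast
  then obtain x' m where x': "rel x' x" and m: "\<forall>n\<ge>N. rep n x' = m"
    using all[of x] rel_S[OF x] unfolding stable_def by blast
  have "pr {W (Suc N)} - x' \<in> ?JG"
    using rel_cong[OF x x'] E.J_zero by simp
  then have "rep (Suc N) (pr {W (Suc N)} :: (vertex, edge, 'k) free) = m"
    "rep N (pr {W (Suc N)} :: (vertex, edge, 'k) free) = m"
    using rep_cong m by simp_all
  then have "rep (Suc N) (pr {W (Suc N)} :: (vertex, edge, 'k) free) False False
      = rep N (pr {W (Suc N)}) False False"
    by simp
  then show False
    by (simp add: pr_gen)
qed


section \<open>Nonvanishing in the C*-algebra of the ultragraph\<close>

lemma letter_entry_star: "letter_entry n (star_letter g) i j = cnj (letter_entry n g j i)"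
  by (cases "(n, g, i, j)" rule: letter_entry.cases) auto

lemma word_entry_star:
  "word_entry n (rev (map star_letter ls)) i j = cnj (word_entry n ls j i)"
  by (induction ls arbitrary: i j) (auto simp: word_entry_append letter_entry_star)

lemma rep_star [simp]: "rep n (star x) i j = cnj (rep n x j i)"
  by (induction x rule: free_induct)
    (simp_all add: star_add star_single star_word_def word_entry_star)

text \<open>The matrix \<open>rep n x\<close> as an operator on a two-dimensional Hilbert space,
  taken as a real inner product space, so that \<open>onorm\<close> provides a C*-seminorm.\<close>

definition lin :: "nat \<Rightarrow> (vertex, edge, complex) free \<Rightarrow> complex \<times> complex \<Rightarrow> complex \<times> complex" where
  "lin n x v = (rep n x True True * fst v + rep n x True False * snd v,
    rep n x False True * fst v + rep n x False False * snd v)"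

lemma lin_add: "lin n (x + y) = (\<lambda>v. lin n x v + lin n y v)"
  by (simp add: lin_def fun_eq_iff algebra_simps)

lemma lin_mult: "lin n (x * y) = lin n x \<circ> lin n y"
  by (simp add: lin_def fun_eq_iff algebra_simps)

text \<open>Pairs carry a real scaling, so the complex factor is compared through its modulus; the
  operator norm sees no more than that.\<close>

lemma lin_scale: "norm (lin n (scale c x) v) = norm (cmod c *\<^sub>R lin n x v)"
proof -
  have "lin n (scale c x) v = (c * fst (lin n x v), c * snd (lin n x v))"
    by (simp add: lin_def algebra_simps)
  moreover have "norm (c * a, c * b) = cmod c * norm (a, b)" for a b :: complex
    by (simp add: norm_Pair norm_mult power_mult_distrib flip: distrib_left)
      (simp add: real_sqrt_mult)
  ultimately show ?thesis
    by simp
qed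

lemma bounded_linear_lin: "bounded_linear (lin n x)"
  unfolding lin_def
  by (intro bounded_linear_Pair bounded_linear_add
      bounded_linear_compose[OF bounded_linear_mult_right bounded_linear_fst]
      bounded_linear_compose[OF bounded_linear_mult_right bounded_linear_snd])

lemma lin_star: "inner (lin n (star x) v) w = inner v (lin n x w)"
  by (simp add: lin_def inner_prod_def inner_complex_def algebra_simps)

text \<open>The substantial half of the C*-identity: the square of the length of x v is the inner
  product of x^* x v with v, bounded by Cauchy-Schwarz.\<close>

lemma onorm_lin_le: "(onorm (lin n x))\<^sup>2 \<le> onorm (lin n (star x * x))"
proof -
  let ?K = "onorm (lin n (star x * x))"
  have "0 \<le> ?K"
    by (intro onorm_pos_le bounded_linear_lin)
  have "norm (lin n x v) \<le> sqrt ?K * norm v" for v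
  proof (rule power2_le_imp_le)
    have "(norm (lin n x v))\<^sup>2 = inner (lin n (star x) (lin n x v)) v"
      by (simp add: lin_star power2_norm_eq_inner)
    also have "\<dots> = inner (lin n (star x * x) v) v"
      by (simp add: lin_mult)
    also have "\<dots> \<le> norm (lin n (star x * x) v) * norm v"
      using Cauchy_Schwarz_ineq2[of "lin n (star x * x) v" v] by linarith
    also have "\<dots> \<le> (?K * norm v) * norm v"
      by (intro mult_right_mono onorm bounded_linear_lin) simp
    also have "\<dots> = (sqrt ?K)\<^sup>2 * (norm v)\<^sup>2"
      using \<open>0 \<le> ?K\<close> by (simp add: power2_eq_square)
    finally show "(norm (lin n x v))\<^sup>2 \<le> (sqrt ?K * norm v)\<^sup>2"
      by (simp only: power_mult_distrib)
  qed (use \<open>0 \<le> ?K\<close> in simp)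
  then have "onorm (lin n x) \<le> sqrt ?K"
    by (intro onorm_bound) (use \<open>0 \<le> ?K\<close> in auto)
  then have "(onorm (lin n x))\<^sup>2 \<le> (sqrt ?K)\<^sup>2"
    by (intro power_mono onorm_pos_le bounded_linear_lin)
  then show ?thesis
    using \<open>0 \<le> ?K\<close> by simp
qed

lemma onorm_lin_mult: "onorm (lin n (x * y)) \<le> onorm (lin n x) * onorm (lin n y)"
  unfolding lin_mult by (intro onorm_compose bounded_linear_lin)

lemma onorm_lin_star_le: "onorm (lin n x) \<le> onorm (lin n (star x))"
proof -
  have "(onorm (lin n x))\<^sup>2 \<le> onorm (lin n (star x)) * onorm (lin n x)"
    using onorm_lin_le onorm_lin_mult by (rule order_trans)
  then show ?thesis
    using onorm_pos_le[OF bounded_linear_lin, of n x] onorm_pos_le[OF bounded_linear_lin, of n "star x"]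
    by (cases "onorm (lin n x) = 0") (simp_all add: power2_eq_square)
qed

lemma onorm_lin_cstar: "onorm (lin n (star x * x)) = (onorm (lin n x))\<^sup>2"
proof (rule antisym)
  have "onorm (lin n (star x * x)) \<le> onorm (lin n (star x)) * onorm (lin n x)"
    by (rule onorm_lin_mult)
  also have "\<dots> \<le> onorm (lin n x) * onorm (lin n x)"
    using onorm_lin_star_le[of n "star x"] by (intro mult_right_mono onorm_pos_le bounded_linear_lin) simp
  finally show "onorm (lin n (star x * x)) \<le> (onorm (lin n x))\<^sup>2"
    by (simp add: power2_eq_square)
qed (rule onorm_lin_le)

lemma rep_cstar_relation:
  assumes "(x, y) \<in> cstar_relations ultragraph_G"
  shows "rep n x i j = rep n y i j"
  using assms unfolding cstar_relations_def star_ed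
proof (elim UnE)
  assume "(x, y) \<in> {(ed e * gh e * ed e, ed e) |e. e \<in> uedges ultragraph_G}"
  then obtain e where "x = ed e * gh e * ed e" "y = ed e"
    by blast
  then show ?thesis
    by (cases e) (auto simp: ed_gen gh_gen)
next
  assume "(x, y) \<in> {(ed e * gh e * (ed f * gh f), 0) |e f.
      e \<in> uedges ultragraph_G \<and> f \<in> uedges ultragraph_G \<and> e \<noteq> f}"
  then obtain e f where "x = ed e * gh e * (ed f * gh f)" "y = 0" "e \<noteq> f"
    by blast
  then show ?thesis
    by (cases e; cases f) (auto simp: ed_gen gh_gen)
next
  assume "(x, y) \<in> {(gh e * ed e, pr (urange ultragraph_G e)) |e. e \<in> uedges ultragraph_G}"
  then obtain e where "x = gh e * ed e" "y = pr (urange ultragraph_G e)"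
    by blast
  then show ?thesis
    by (cases e) (auto simp: pr_gen ed_gen gh_gen)
next
  assume "(x, y) \<in> {(pr {usource ultragraph_G e} * (ed e * gh e), ed e * gh e) |e.
      e \<in> uedges ultragraph_G}"
  then obtain e where "x = pr {usource ultragraph_G e} * (ed e * gh e)" "y = ed e * gh e"
    by blast
  then show ?thesis
    by (cases e) (auto simp: pr_gen ed_gen gh_gen)
next
  assume "(x, y) \<in> {(pr {v}, \<Sum>e\<in>edges_from ultragraph_G v. ed e * gh e) |v.
      v \<in> regular_vertices ultragraph_G}"
  then obtain v where "x = pr {v}" "y = (\<Sum>e\<in>edges_from ultragraph_G v. ed e * gh e)"
    by blast
  then show ?thesis
    by (cases v) (auto simp: edges_from_G pr_gen ed_gen gh_gen)
qed (auto simp: pr_gen)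

lemma cstar_seminorm_rep: "cstar_seminorm ultragraph_G (\<lambda>x. onorm (lin n x))"
  unfolding cstar_seminorm_def
proof (intro conjI ballI allI; clarify?)
  fix x y :: "(vertex, edge, complex) free" and c
  show "0 \<le> onorm (lin n x)"
    by (intro onorm_pos_le bounded_linear_lin)
  show "onorm (lin n (x + y)) \<le> onorm (lin n x) + onorm (lin n y)"
    unfolding lin_add by (intro onorm_triangle bounded_linear_lin)
  have "onorm (lin n (scale c x)) = onorm (\<lambda>v. cmod c *\<^sub>R lin n x v)"
    unfolding onorm_def lin_scale ..
  then show "onorm (lin n (scale c x)) = cmod c * onorm (lin n x)"
    using onorm_scaleR[OF bounded_linear_lin, of "cmod c" n x] by simp
  show "onorm (lin n (x - y)) = 0" if "(x, y) \<in> cstar_relations ultragraph_G"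
  proof -
    have "lin n (x - y) = (\<lambda>v. 0)"
      using rep_cstar_relation[OF that] by (simp add: lin_def fun_eq_iff zero_prod_def)
    then show ?thesis
      by (simp add: onorm_zero)
  qed
qed (rule onorm_lin_mult onorm_lin_cstar)+

text \<open>The n-th representation maps this element to the identity of the plane, and its seminorm
  bounds the universal norm from below.\<close>

lemma universal_norm_central:
  "universal_norm ultragraph_G (pr {W n} + ed E0 * pr {W n} * gh E0) \<noteq> 0"
proof -
  let ?z = "pr {W n} + ed E0 * pr {W n} * gh E0 :: (vertex, edge, complex) free"
  have z: "?z \<in> free_carrier ultragraph_G"
    using gv_G by (intro free_carrier_intros) simp_all
  have "lin n ?z v = v" for v
    by (cases v) (simp add: lin_def pr_gen ed_gen gh_gen)
  then have "lin n ?z (1, 0) \<noteq> 0"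
    by (simp add: zero_prod_def)
  then have "0 < onorm (lin n ?z)"
    using onorm_pos_lt[OF bounded_linear_lin] by blast
  then show ?thesis
    using le_universal_norm[OF wf_ultragraph_G cstar_seminorm_rep z, of n] by simp
qed


section \<open>The gauge action\<close>

fun letter_degree :: "('v, 'e) letter \<Rightarrow> int" where
  "letter_degree (Proj A) = 0"
| "letter_degree (Edge e) = 1"
| "letter_degree (Ghost e) = - 1"

definition word_degree :: "('v, 'e) letter word \<Rightarrow> int" where
  "word_degree w = sum_list (map letter_degree (letters w))"

lemma word_degree_add: "word_degree (u + w) = word_degree u + word_degree w"
  by (simp add: word_degree_def plus_word_def)

lemma letter_degree_star: "letter_degree (star_letter g) = - letter_degree g"
  by (cases g) simp_all

lemma word_degree_star: "word_degree (star_word w) = - word_degree w"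
proof -
  have "sum_list (map letter_degree (rev (map star_letter ls))) = - sum_list (map letter_degree ls)" for ls
    by (induction ls) (simp_all add: letter_degree_star)
  then show ?thesis
    by (simp add: word_degree_def star_word_def)
qed

text \<open>The gauge action at the circle element exp(it), lifted to the free algebra. It is
  diagonal on words, hence defined before any relation is imposed.\<close>

definition gauge :: "real \<Rightarrow> ('v, 'e, complex) free \<Rightarrow> ('v, 'e, complex) free" where
  "gauge t x = Poly_Mapping.mapp (\<lambda>w c. cis (t * word_degree w) * c) x"

lemma lookup_gauge:
  "Poly_Mapping.lookup (gauge t x) w = cis (t * word_degree w) * Poly_Mapping.lookup x w"
  by (simp add: gauge_def lookup_mapp when_def in_keys_iff)

lemma gauge_add: "gauge t (x + y) = gauge t x + gauge t y"
  and gauge_diff: "gauge t (x - y) = gauge t x - gauge t y"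
  and gauge_scale: "gauge t (scale c x) = scale c (gauge t x)"
  and gauge_zero [simp]: "gauge t 0 = 0"
  and gauge_gauge: "gauge s (gauge t x) = gauge (s + t) x"
  and gauge_0 [simp]: "gauge 0 x = x"
  by (rule poly_mapping_eqI; simp add: lookup_gauge lookup_add lookup_minus algebra_simps cis_mult)+

lemma gauge_single:
  "gauge t (Poly_Mapping.single w c) = Poly_Mapping.single w (cis (t * word_degree w) * c)"
  by (rule poly_mapping_eqI) (auto simp: lookup_gauge lookup_single when_def)

lemma gauge_mult: "gauge t (x * y) = gauge t x * gauge t y"
proof (induction x rule: free_induct)
  case (single w c)
  show ?case
    by (induction y rule: free_induct)
      (simp_all add: mult_single gauge_single gauge_add word_degree_add cis_mult[symmetric]
        algebra_simps)
qed (simp_all add: gauge_add algebra_simps)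

lemma gauge_star: "gauge t (star x) = star (gauge t x)"
  by (rule poly_mapping_eqI) (simp add: lookup_gauge lookup_star word_degree_star cis_cnj)

lemma gauge_generators [simp]:
  "gauge t (pr A) = pr A" "gauge t (ed e) = scale (cis t) (ed e)"
  "gauge t (gh e) = scale (cis (- t)) (gh e)"
  by (simp_all add: pr_def ed_def gh_def gauge_single word_degree_def)

lemma gauge_carrier: "x \<in> free_carrier G \<Longrightarrow> gauge t x \<in> free_carrier G"
  by (auto simp: free_carrier_def in_keys_iff lookup_gauge)

lemma gauge_sum: "gauge t (sum f I) = (\<Sum>i\<in>I. gauge t (f i))"
  by (induction I rule: infinite_finite_induct) (auto simp: gauge_add)

lemma gauge_pr_pr [simp]: "gauge t (pr A * pr B) = pr A * pr B"
  by (simp add: gauge_mult)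

lemma gauge_ed_gh [simp]: "gauge t (ed e * gh e) = ed e * gh e" "gauge t (gh e * ed e) = gh e * ed e"
  by (simp_all add: gauge_mult scale_mult_left[symmetric] scale_mult_right[symmetric] scale_scale cis_mult)

text \<open>All relations are homogeneous, of degree 0 except for s_e s_e^* s_e = s_e of degree 1,
  so their differences are eigenvectors of the gauge action.\<close>

lemma gauge_relation:
  assumes "(x, y) \<in> cstar_relations G"
  shows "\<exists>c. gauge t (x - y) = scale c (x - y)"
proof -
  have "(\<exists>e. x = ed e * gh e * ed e \<and> y = ed e) \<or> gauge t (x - y) = x - y"
    using assms unfolding cstar_relations_def star_ed
  proof (elim UnE)
    assume "(x, y) \<in> {(ed e * gh e * (ed f * gh f), 0) |e f.
        e \<in> uedges G \<and> f \<in> uedges G \<and> e \<noteq> f}"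
    then obtain e f where "x = (ed e * gh e) * (ed f * gh f)" "y = 0"
      by blast
    then show ?thesis
      by (simp add: gauge_mult[of t "ed e * gh e"])
  next
    assume "(x, y) \<in> {(pr {usource G e} * (ed e * gh e), ed e * gh e) |e. e \<in> uedges G}"
    then obtain e where "x = pr {usource G e} * (ed e * gh e)" "y = ed e * gh e"
      by blast
    then show ?thesis
      by (simp add: gauge_diff gauge_mult[of t "pr _"])
  next
    assume "(x, y) \<in> {(pr {v}, \<Sum>e\<in>edges_from G v. ed e * gh e) |v. v \<in> regular_vertices G}"
    then show ?thesis
      by (auto simp: gauge_diff gauge_sum)
  qed (auto simp: gauge_diff gauge_add)
  then show ?thesis
  proof
    assume "\<exists>e. x = ed e * gh e * ed e \<and> y = ed e"
    then obtain e where "x = ed e * gh e * ed e" "y = ed e"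
      by blast
    then have "gauge t (x - y) = scale (cis t) (x - y)"
      by (simp add: gauge_diff gauge_mult[of t "ed e * gh e"] scale_mult_right[symmetric] scale_diff)
    then show ?thesis ..
  next
    assume "gauge t (x - y) = x - y"
    then show ?thesis
      by (intro exI[of _ 1]) simp
  qed
qed

text \<open>The gauge action permutes the C*-seminorms, so it preserves their supremum.\<close>

lemma cstar_seminorm_gauge:
  assumes "wf_ultragraph G" "cstar_seminorm G p"
  shows "cstar_seminorm G (\<lambda>x. p (gauge t x))"
proof -
  interpret seminorm G p
    using assms by unfold_locales
  show ?thesis
    unfolding cstar_seminorm_def
  proof (intro conjI ballI allI; clarify?)
    fix x y :: "('a, 'b, complex) free"
    assume "(x, y) \<in> cstar_relations G"
    then show "p (gauge t (x - y)) = 0"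
      using gauge_relation[of x y G t] relation[of x y] scale[of "x - y"]
        cstar_relation_carrier[OF wf, of x y] by (auto simp: free_carrier_diff)
  qed (auto simp: gauge_add gauge_scale gauge_mult gauge_star gauge_carrier nonneg triangle scale
      mult cstar)
qed

lemma universal_norm_gauge:
  assumes wf: "wf_ultragraph G" and x: "x \<in> free_carrier G"
  shows "universal_norm G (gauge t x) = universal_norm G x"
proof -
  have le: "universal_norm G (gauge t x) \<le> universal_norm G x" if x: "x \<in> free_carrier G" for t x
    by (rule universal_norm_le[OF wf])
      (use le_universal_norm[OF wf cstar_seminorm_gauge[OF wf] x] in blast)
  show ?thesis
    using le[OF x, of t] le[OF gauge_carrier[OF x], of "- t" t] by (simp add: gauge_gauge)
qed

lemma universal_norm_gauge_diff:
  assumes wf: "wf_ultragraph G" and x: "x \<in> free_carrier G"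
  shows "universal_norm G (x - gauge t x)
    \<le> (\<Sum>w\<in>Poly_Mapping.keys x. cmod (1 - cis (t * word_degree w)) * cmod (Poly_Mapping.lookup x w))"
proof (rule universal_norm_le[OF wf])
  fix p assume p: "cstar_seminorm G p"
  have d: "x - gauge t x \<in> free_carrier G"
    using x by (intro free_carrier_diff gauge_carrier)
  have lookup: "Poly_Mapping.lookup (x - gauge t x) w
      = (1 - cis (t * word_degree w)) * Poly_Mapping.lookup x w" for w
    by (simp add: lookup_minus lookup_gauge algebra_simps)
  then have "Poly_Mapping.keys (x - gauge t x) \<subseteq> Poly_Mapping.keys x"
    by (auto simp: in_keys_iff)
  then have "(\<Sum>w\<in>Poly_Mapping.keys (x - gauge t x). cmod (Poly_Mapping.lookup (x - gauge t x) w))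
      \<le> (\<Sum>w\<in>Poly_Mapping.keys x. cmod (Poly_Mapping.lookup (x - gauge t x) w))"
    by (intro sum_mono2) auto
  then show "p (x - gauge t x) \<le> (\<Sum>w\<in>Poly_Mapping.keys x.
      cmod (1 - cis (t * word_degree w)) * cmod (Poly_Mapping.lookup x w))"
    using seminorm.le_sum_norms[OF seminormI[OF wf p] d] by (simp add: lookup norm_mult)
qed

text \<open>Continuity is stated along the angles 2 pi / n because these are averaged later; each of
  the finitely many words contributes a term tending to 0.\<close>

lemma gauge_continuous:
  assumes wf: "wf_ultragraph G" and x: "x \<in> free_carrier G"
  shows "(\<lambda>n. universal_norm G (x - gauge (2 * pi / real n) x)) \<longlonglongrightarrow> 0"
proof (rule tendsto_sandwich)
  show "\<forall>\<^sub>F n in sequentially. 0 \<le> universal_norm G (x - gauge (2 * pi / real n) x)"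
    using x by (intro always_eventually allI un_nonneg[OF wf] free_carrier_diff gauge_carrier)
  show "\<forall>\<^sub>F n in sequentially. universal_norm G (x - gauge (2 * pi / real n) x)
      \<le> (\<Sum>w\<in>Poly_Mapping.keys x. cmod (1 - cis (2 * pi / real n * word_degree w))
        * cmod (Poly_Mapping.lookup x w))"
    by (intro always_eventually allI universal_norm_gauge_diff[OF wf x])
  have "(\<lambda>n. (\<Sum>w\<in>Poly_Mapping.keys x. cmod (1 - cis (2 * pi / real n * word_degree w))
        * cmod (Poly_Mapping.lookup x w)))
      \<longlonglongrightarrow> (\<Sum>w\<in>Poly_Mapping.keys x. cmod (1 - cis (0 * real_of_int (word_degree w)))
        * cmod (Poly_Mapping.lookup x w))"
    by (intro tendsto_intros lim_const_over_n)
  then show "(\<lambda>n. (\<Sum>w\<in>Poly_Mapping.keys x. cmod (1 - cis (2 * pi / real n * word_degree w))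
        * cmod (Poly_Mapping.lookup x w))) \<longlonglongrightarrow> 0"
    by simp
qed simp

section \<open>Averaging over roots of unity\<close>

definition degree_0_part :: "('v, 'e, complex) free \<Rightarrow> ('v, 'e, complex) free" where
  "degree_0_part x = Poly_Mapping.mapp (\<lambda>w c. if word_degree w = 0 then c else 0) x"

lemma lookup_degree_0_part:
  "Poly_Mapping.lookup (degree_0_part x) w
    = (if word_degree w = 0 then Poly_Mapping.lookup x w else 0)"
  by (simp add: degree_0_part_def lookup_mapp when_def in_keys_iff)

lemma degree_0_part_carrier: "x \<in> free_carrier G \<Longrightarrow> degree_0_part x \<in> free_carrier G"
  by (auto simp: free_carrier_def in_keys_iff lookup_degree_0_part split: if_splits)

text \<open>A geometric sum whose ratio is an n-th root of unity. The bound on d excludes that n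
  divides d, that is, that the ratio is 1.\<close>

lemma sum_cis_roots:
  assumes "d \<noteq> 0" "\<bar>d\<bar> < int n"
  shows "(\<Sum>k<n. cis (real k * (2 * pi / real n) * of_int d)) = 0"
proof -
  let ?z = "cis (2 * pi / real n * of_int d)"
  have n: "0 < n"
    using assms by simp
  have "?z \<noteq> 1"
  proof
    assume "?z = 1"
    then have "cos (2 * pi / real n * of_int d) = 1"
      by (simp add: complex_eq_iff)
    then obtain m :: int where "2 * pi / real n * of_int d = of_int m * 2 * pi"
      using cos_one_2pi_int by blast
    then have "real_of_int d = real_of_int m * real n"
      using n by (simp add: field_simps)
    then have d: "d = m * int n"
      by (metis of_int_eq_iff of_int_mult of_int_of_nat_eq)
    then have "m \<noteq> 0"
      using assms(1) by auto
    then have "int n \<le> \<bar>d\<bar>"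
      unfolding d abs_mult using n by (simp add: mult_le_cancel_right1)
    then show False
      using assms(2) by simp
  qed
  moreover have "?z ^ n = 1"
    using n cis_multiple_2pi[of "of_int d"] by (simp add: DeMoivre)
  moreover have "(\<Sum>k<n. cis (real k * (2 * pi / real n) * of_int d)) = (\<Sum>k<n. ?z ^ k)"
    by (simp add: DeMoivre mult.assoc)
  ultimately show ?thesis
    by (simp add: geometric_sum)
qed

text \<open>Replaces the integral over the circle by a finite average, which is exact once n exceeds
  all degrees occurring in x.\<close>

lemma gauge_average:
  assumes "0 < n" and "\<And>w. w \<in> Poly_Mapping.keys x \<Longrightarrow> \<bar>word_degree w\<bar> < int n"
  shows "scale (1 / of_nat n) (\<Sum>k<n. gauge (real k * (2 * pi / real n)) x) = degree_0_part x"
proof (rule poly_mapping_eqI)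
  fix w
  have "1 / of_nat n * (\<Sum>k<n. cis (real k * (2 * pi / real n) * of_int (word_degree w)))
      * Poly_Mapping.lookup x w = (if word_degree w = 0 then Poly_Mapping.lookup x w else 0)"
    using assms sum_cis_roots[of "word_degree w" n] by (cases "w \<in> Poly_Mapping.keys x") (auto simp: in_keys_iff)
  then show "Poly_Mapping.lookup (scale (1 / of_nat n) (\<Sum>k<n. gauge (real k * (2 * pi / real n)) x)) w
      = Poly_Mapping.lookup (degree_0_part x) w"
    by (simp add: lookup_sum lookup_gauge lookup_degree_0_part sum_distrib_right mult.assoc)
qed


section \<open>The algebra of Cauchy sequences\<close>

definition cauchy_seqs :: "('v, 'e) ultragraph \<Rightarrow> (nat \<Rightarrow> ('v, 'e, complex) free) set" where
  "cauchy_seqs G = Carrier (cauchy_alg G)"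

definition null_seqs :: "('v, 'e) ultragraph \<Rightarrow> (nat \<Rightarrow> ('v, 'e, complex) free) set" where
  "null_seqs G = {x \<in> cauchy_seqs G. (\<lambda>n. universal_norm G (x n)) \<longlonglongrightarrow> 0}"

definition seq_scale :: "complex \<Rightarrow> (nat \<Rightarrow> ('v, 'e, complex) free) \<Rightarrow> nat \<Rightarrow> ('v, 'e, complex) free" where
  "seq_scale c x = (\<lambda>n. scale c (x n))"

text \<open>The norm in the completion; on Cauchy sequences the limit exists by
  \<open>seq_norm_tendsto\<close>.\<close>

definition seq_norm :: "('v, 'e) ultragraph \<Rightarrow> (nat \<Rightarrow> ('v, 'e, complex) free) \<Rightarrow> real" where
  "seq_norm G x = lim (\<lambda>n. universal_norm G (x n))"

abbreviation const :: "'a \<Rightarrow> nat \<Rightarrow> 'a" where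
  "const x \<equiv> \<lambda>_. x"

lemma cauchy_seqs_carrier: "x \<in> cauchy_seqs G \<Longrightarrow> x n \<in> free_carrier G"
  by (simp add: cauchy_seqs_def cauchy_alg_def)

lemma cauchy_seqsD:
  "x \<in> cauchy_seqs G \<Longrightarrow> 0 < \<epsilon> \<Longrightarrow> \<exists>M. \<forall>m\<ge>M. \<forall>n\<ge>M. universal_norm G (x m - x n) < \<epsilon>"
  by (simp add: cauchy_seqs_def cauchy_alg_def)

lemma cauchy_seqsI:
  assumes "\<And>n. x n \<in> free_carrier G"
    and "\<And>\<epsilon>. 0 < \<epsilon> \<Longrightarrow> \<exists>M. \<forall>m\<ge>M. \<forall>n\<ge>M. universal_norm G (x m - x n) < \<epsilon>"
  shows "x \<in> cauchy_seqs G"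
  using assms by (simp add: cauchy_seqs_def cauchy_alg_def)

context
  fixes G :: "('v, 'e) ultragraph"
  assumes wf: "wf_ultragraph G"
begin

lemma un_triangle_minus:
  assumes "x \<in> free_carrier G" "y \<in> free_carrier G"
  shows "\<bar>universal_norm G x - universal_norm G y\<bar> \<le> universal_norm G (x - y)"
  using un_triangle[OF wf free_carrier_diff[OF assms] assms(2)]
    un_triangle[OF wf free_carrier_diff[OF assms(2,1)] assms(1)] un_minus_commute[OF wf assms]
  by simp

lemma cauchy_const: "x \<in> free_carrier G \<Longrightarrow> const x \<in> cauchy_seqs G"
  by (rule cauchy_seqsI) (simp_all add: un_0[OF wf])

lemma seq_norm_tendsto:
  assumes "x \<in> cauchy_seqs G"
  shows "(\<lambda>n. universal_norm G (x n)) \<longlonglongrightarrow> seq_norm G x"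
proof -
  note c = cauchy_seqs_carrier[OF assms]
  have "Cauchy (\<lambda>n. universal_norm G (x n))"
  proof (rule metric_CauchyI)
    fix \<epsilon> :: real
    assume "0 < \<epsilon>"
    then obtain M where "\<forall>m\<ge>M. \<forall>n\<ge>M. universal_norm G (x m - x n) < \<epsilon>"
      using cauchy_seqsD[OF assms] by blast
    then show "\<exists>M. \<forall>m\<ge>M. \<forall>n\<ge>M. dist (universal_norm G (x m)) (universal_norm G (x n)) < \<epsilon>"
      using un_triangle_minus[OF c c] unfolding dist_real_def by (meson order_le_less_trans)
  qed
  then show ?thesis
    by (simp add: seq_norm_def convergent_LIMSEQ_iff[symmetric] real_Cauchy_convergent)
qed

lemma cauchy_bounded:
  assumes "x \<in> cauchy_seqs G"
  shows "\<exists>B>0. \<forall>n. universal_norm G (x n) \<le> B"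
proof -
  have "Bseq (\<lambda>n. universal_norm G (x n))"
    using seq_norm_tendsto[OF assms] convergentI convergent_imp_Bseq by blast
  then show ?thesis
    unfolding Bseq_def by (metis abs_ge_self order_trans real_norm_def)
qed

lemma cauchy_add:
  assumes "x \<in> cauchy_seqs G" "y \<in> cauchy_seqs G"
  shows "x + y \<in> cauchy_seqs G"
proof (rule cauchy_seqsI)
  note c = cauchy_seqs_carrier[OF assms(1)] cauchy_seqs_carrier[OF assms(2)]
  show "(x + y) n \<in> free_carrier G" for n
    by (simp add: c free_carrier_add)
  fix \<epsilon> :: real
  assume "0 < \<epsilon>"
  then obtain M M' where M: "\<forall>m\<ge>M. \<forall>n\<ge>M. universal_norm G (x m - x n) < \<epsilon> / 2"
    "\<forall>m\<ge>M'. \<forall>n\<ge>M'. universal_norm G (y m - y n) < \<epsilon> / 2"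
    using cauchy_seqsD[OF assms(1), of "\<epsilon> / 2"] cauchy_seqsD[OF assms(2), of "\<epsilon> / 2"] by auto
  have "universal_norm G ((x + y) m - (x + y) n) < \<epsilon>" if "max M M' \<le> m" "max M M' \<le> n" for m n
  proof -
    have "universal_norm G ((x m - x n) + (y m - y n))
        \<le> universal_norm G (x m - x n) + universal_norm G (y m - y n)"
      by (intro un_triangle[OF wf] free_carrier_diff c)
    also have "\<dots> < \<epsilon> / 2 + \<epsilon> / 2"
      using M that by (intro add_strict_mono) auto
    finally show ?thesis
      by (simp add: algebra_simps)
  qed
  then show "\<exists>M. \<forall>m\<ge>M. \<forall>n\<ge>M. universal_norm G ((x + y) m - (x + y) n) < \<epsilon>"
    by blast
qed

lemma cauchy_mult:
  assumes "x \<in> cauchy_seqs G" "y \<in> cauchy_seqs G"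
  shows "x * y \<in> cauchy_seqs G"
proof (rule cauchy_seqsI)
  note c = cauchy_seqs_carrier[OF assms(1)] cauchy_seqs_carrier[OF assms(2)]
  show "(x * y) n \<in> free_carrier G" for n
    by (simp add: c free_carrier_mult)
  obtain B C where B: "0 < B" "\<And>n. universal_norm G (x n) \<le> B"
    and C: "0 < C" "\<And>n. universal_norm G (y n) \<le> C"
    using cauchy_bounded[OF assms(1)] cauchy_bounded[OF assms(2)] by blast
  fix \<epsilon> :: real
  assume "0 < \<epsilon>"
  then obtain M M' where M: "\<forall>m\<ge>M. \<forall>n\<ge>M. universal_norm G (x m - x n) < \<epsilon> / (2 * C)"
    "\<forall>m\<ge>M'. \<forall>n\<ge>M'. universal_norm G (y m - y n) < \<epsilon> / (2 * B)"
    using cauchy_seqsD[OF assms(1), of "\<epsilon> / (2 * C)"] cauchy_seqsD[OF assms(2), of "\<epsilon> / (2 * B)"] B C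
    by auto
  have "universal_norm G ((x * y) m - (x * y) n) < \<epsilon>" if "max M M' \<le> m" "max M M' \<le> n" for m n
  proof -
    have "universal_norm G ((x m - x n) * y m + x n * (y m - y n))
        \<le> universal_norm G ((x m - x n) * y m) + universal_norm G (x n * (y m - y n))"
      by (intro un_triangle[OF wf] free_carrier_diff free_carrier_mult c)
    also have "\<dots> \<le> universal_norm G (x m - x n) * universal_norm G (y m)
        + universal_norm G (x n) * universal_norm G (y m - y n)"
      by (intro add_mono un_mult[OF wf] free_carrier_diff c)
    also have "\<dots> \<le> universal_norm G (x m - x n) * C + B * universal_norm G (y m - y n)"
      by (intro add_mono mult_left_mono mult_right_mono B C un_nonneg[OF wf] free_carrier_diff c)
    also have "\<dots> < \<epsilon> / (2 * C) * C + B * (\<epsilon> / (2 * B))"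
      using M that B C by (intro add_strict_mono mult_strict_left_mono mult_strict_right_mono) auto
    finally show ?thesis
      using B C by (simp add: algebra_simps)
  qed
  then show "\<exists>M. \<forall>m\<ge>M. \<forall>n\<ge>M. universal_norm G ((x * y) m - (x * y) n) < \<epsilon>"
    by blast
qed

lemma cauchy_scale:
  assumes "x \<in> cauchy_seqs G"
  shows "seq_scale c x \<in> cauchy_seqs G"
proof (rule cauchy_seqsI)
  note carrier = cauchy_seqs_carrier[OF assms]
  show "seq_scale c x n \<in> free_carrier G" for n
    by (simp add: seq_scale_def carrier free_carrier_scale)
  fix \<epsilon> :: real
  assume "0 < \<epsilon>"
  \<comment> \<open>The denominator 1 + |c| avoids division by zero for c = 0.\<close>
  then obtain M where M: "\<forall>m\<ge>M. \<forall>n\<ge>M. universal_norm G (x m - x n) < \<epsilon> / (1 + cmod c)"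
    using cauchy_seqsD[OF assms, of "\<epsilon> / (1 + cmod c)"] by (auto simp: add_pos_nonneg)
  have "universal_norm G (seq_scale c x m - seq_scale c x n) < \<epsilon>" if "M \<le> m" "M \<le> n" for m n
  proof -
    have "universal_norm G (scale c (x m - x n)) \<le> cmod c * universal_norm G (x m - x n)"
      by (intro un_scale_le[OF wf] free_carrier_diff carrier)
    also have "\<dots> \<le> (1 + cmod c) * universal_norm G (x m - x n)"
      by (intro mult_right_mono un_nonneg[OF wf] free_carrier_diff carrier) simp
    also have "\<dots> < (1 + cmod c) * (\<epsilon> / (1 + cmod c))"
      using M that by (intro mult_strict_left_mono) (auto simp: add_pos_nonneg)
    also have "\<dots> = \<epsilon>"
      using norm_ge_zero[of c] by (simp add: field_simps add_nonneg_eq_0_iff)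
    finally show ?thesis
      by (simp add: seq_scale_def scale_diff)
  qed
  then show "\<exists>M. \<forall>m\<ge>M. \<forall>n\<ge>M. universal_norm G (seq_scale c x m - seq_scale c x n) < \<epsilon>"
    by blast
qed

lemma cauchy_diff:
  assumes "x \<in> cauchy_seqs G" "y \<in> cauchy_seqs G"
  shows "x - y \<in> cauchy_seqs G"
proof -
  have "x - y = x + seq_scale (- 1) y"
    by (simp add: fun_eq_iff seq_scale_def scale_minus_one)
  then show ?thesis
    using cauchy_add[OF assms(1) cauchy_scale[OF assms(2)]] by metis
qed

lemma seq_norm_const: "x \<in> free_carrier G \<Longrightarrow> seq_norm G (const x) = universal_norm G x"
  by (simp add: seq_norm_def)

lemma seq_norm_nonneg:
  assumes "x \<in> cauchy_seqs G"
  shows "0 \<le> seq_norm G x"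
  by (rule LIMSEQ_le_const[OF seq_norm_tendsto[OF assms]])
    (use un_nonneg[OF wf cauchy_seqs_carrier[OF assms]] in blast)

lemma seq_norm_triangle:
  assumes "x \<in> cauchy_seqs G" "y \<in> cauchy_seqs G"
  shows "seq_norm G (x + y) \<le> seq_norm G x + seq_norm G y"
  by (rule LIMSEQ_le[OF seq_norm_tendsto[OF cauchy_add[OF assms]]
        tendsto_add[OF seq_norm_tendsto[OF assms(1)] seq_norm_tendsto[OF assms(2)]]])
    (simp add: un_triangle[OF wf] assms cauchy_seqs_carrier)

lemma seq_norm_mult:
  assumes "x \<in> cauchy_seqs G" "y \<in> cauchy_seqs G"
  shows "seq_norm G (x * y) \<le> seq_norm G x * seq_norm G y"
  by (rule LIMSEQ_le[OF seq_norm_tendsto[OF cauchy_mult[OF assms]]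
        tendsto_mult[OF seq_norm_tendsto[OF assms(1)] seq_norm_tendsto[OF assms(2)]]])
    (simp add: un_mult[OF wf] assms cauchy_seqs_carrier)

lemma seq_norm_scale_le:
  assumes "x \<in> cauchy_seqs G"
  shows "seq_norm G (seq_scale c x) \<le> cmod c * seq_norm G x"
  by (rule LIMSEQ_le[OF seq_norm_tendsto[OF cauchy_scale[OF assms]]
        tendsto_mult[OF tendsto_const seq_norm_tendsto[OF assms]]])
    (simp add: un_scale_le[OF wf] assms cauchy_seqs_carrier seq_scale_def)

lemma null_seqs_iff: "x \<in> null_seqs G \<longleftrightarrow> x \<in> cauchy_seqs G \<and> seq_norm G x = 0"
  using seq_norm_tendsto[of x] LIMSEQ_unique[OF seq_norm_tendsto[of x], of 0]
  by (auto simp: null_seqs_def)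

lemma seq_norm_dense:
  assumes x: "x \<in> cauchy_seqs G" and "0 < \<epsilon>"
  shows "\<exists>y\<in>free_carrier G. seq_norm G (x - const y) < \<epsilon>"
proof -
  obtain M where M: "\<forall>m\<ge>M. \<forall>n\<ge>M. universal_norm G (x m - x n) < \<epsilon> / 2"
    using cauchy_seqsD[OF x, of "\<epsilon> / 2"] \<open>0 < \<epsilon>\<close> by auto
  have "x - const (x M) \<in> cauchy_seqs G"
    by (intro cauchy_diff x cauchy_const cauchy_seqs_carrier)
  then have "seq_norm G (x - const (x M)) \<le> \<epsilon> / 2"
    by (rule LIMSEQ_le_const2[OF seq_norm_tendsto])
      (use M in \<open>auto intro!: exI[of _ M] intro: less_imp_le\<close>)
  then show ?thesis
    using \<open>0 < \<epsilon>\<close> cauchy_seqs_carrier[OF x] by (intro bexI[of _ "x M"]) auto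
qed

text \<open>Pointwise operations make sequences a ring, so the completion is one more instance of
  the congruence calculus.\<close>

lemma ideal_of_cauchy: "ideal_of (cauchy_seqs G) (null_seqs G) seq_scale"
proof
  fix x y :: "nat \<Rightarrow> ('v, 'e, complex) free" and c
  show "0 \<in> cauchy_seqs G"
    using cauchy_const[OF free_carrier_0] by (simp add: zero_fun_def)
  then show "0 \<in> null_seqs G"
    using seq_norm_const[OF free_carrier_0] un_0[OF wf] by (simp add: null_seqs_iff zero_fun_def)
  show "seq_scale (- 1) x = - x"
    by (simp add: fun_eq_iff seq_scale_def scale_minus_one)
  show "seq_scale c (x - y) = seq_scale c x - seq_scale c y"
    by (simp add: fun_eq_iff seq_scale_def scale_diff)
  show "null_seqs G \<subseteq> cauchy_seqs G"
    by (auto simp: null_seqs_def)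
  show "x + y \<in> null_seqs G" if "x \<in> null_seqs G" "y \<in> null_seqs G"
    using that seq_norm_triangle[of x y] seq_norm_nonneg[of "x + y"]
    by (auto simp: null_seqs_iff cauchy_add)
  show "seq_scale c x \<in> null_seqs G" if "x \<in> null_seqs G"
    using that seq_norm_scale_le[of x c] seq_norm_nonneg[of "seq_scale c x"]
    by (auto simp: null_seqs_iff cauchy_scale)
  show "y * x \<in> null_seqs G" if "y \<in> cauchy_seqs G" "x \<in> null_seqs G"
    using that seq_norm_mult[of y x] seq_norm_nonneg[of "y * x"]
    by (auto simp: null_seqs_iff cauchy_mult)
  show "x * y \<in> null_seqs G" if "x \<in> null_seqs G" "y \<in> cauchy_seqs G"
    using that seq_norm_mult[of x y] seq_norm_nonneg[of "x * y"]
    by (auto simp: null_seqs_iff cauchy_mult)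
qed (simp_all add: cauchy_add cauchy_mult cauchy_scale)

lemma quot_cauchy:
  "quotient_alg (cauchy_alg G) (null_cong G) = ideal_of.quot (cauchy_seqs G) (null_seqs G) seq_scale"
proof -
  interpret ideal_of "cauchy_seqs G" "null_seqs G" seq_scale
    by (rule ideal_of_cauchy)
  have "cauchy_alg G = \<lparr>Carrier = cauchy_seqs G, Add = (+), Mult = (*), Scale = seq_scale\<rparr>"
    by (simp add: cauchy_seqs_def cauchy_alg_def fun_eq_iff seq_scale_def)
  moreover have "null_cong G = R"
    unfolding R_def by (auto simp: null_cong_def null_seqs_def cauchy_seqs_def[symmetric] cauchy_diff)
  ultimately show ?thesis
    by (simp add: quot_def)
qed

lemma gauge_cauchy:
  assumes "x \<in> cauchy_seqs G"
  shows "gauge t \<circ> x \<in> cauchy_seqs G" "seq_norm G (gauge t \<circ> x) = seq_norm G x"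
proof -
  note c = cauchy_seqs_carrier[OF assms]
  show "gauge t \<circ> x \<in> cauchy_seqs G"
    using cauchy_seqsD[OF assms]
    by (intro cauchy_seqsI)
      (simp_all add: gauge_carrier c gauge_diff[symmetric] universal_norm_gauge[OF wf] free_carrier_diff)
  show "seq_norm G (gauge t \<circ> x) = seq_norm G x"
    by (simp add: seq_norm_def universal_norm_gauge[OF wf] c)
qed

end


section \<open>Central idempotents are approximated in degree zero\<close>

text \<open>A difference d of commuting idempotents behaves like a function with values -1, 0, 1,
  whence d^3 = d.\<close>

lemma (in ideal_of) commuting_idempotents_diff:
  assumes z: "z * z \<approx> z" and g: "g * g \<approx> g" and zg: "z * g \<approx> g * z"
  shows "(z - g) * (z - g) * (z - g) \<approx> z - g"
proof -
  have S: "z \<in> S" "g \<in> S"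
    using z g cong_S by blast+
  note r = cong_refl[OF S_mult[OF S]]
  have gz: "g * z \<approx> z * g"
    using zg by (rule cong_sym)
  have zgz: "z * g * z \<approx> z * g"
  proof -
    have "z * (g * z) \<approx> z * (z * g)"
      by (intro cong_left gz S)
    also have "\<dots> = (z * z) * g"
      by (simp add: mult.assoc)
    also have "\<dots> \<approx> z * g"
      by (intro cong_right z S)
    finally show ?thesis
      by (simp add: mult.assoc)
  qed
  have zgg: "z * g * g \<approx> z * g"
    unfolding mult.assoc by (intro cong_left g S)
  have "(z - g) * (z - g) = z * z - z * g - g * z + g * g"
    by (simp add: algebra_simps)
  also have "\<dots> \<approx> z - z * g - z * g + g"
    by (intro cong_add cong_diff z g gz r)
  finally have "(z - g) * (z - g) * (z - g) \<approx> (z - z * g - z * g + g) * (z - g)"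
    by (intro cong_right S_diff S)
  also have "\<dots> = z * z - z * g * z - z * g * z + g * z - (z * g - z * g * g - z * g * g + g * g)"
    by (simp add: algebra_simps)
  also have "\<dots> \<approx> z - z * g - z * g + z * g - (z * g - z * g - z * g + g)"
    by (intro cong_add cong_diff z g gz zgz zgg r)
  finally show ?thesis
    by simp
qed

context
  fixes G :: "('v, 'e) ultragraph"
  assumes wf: "wf_ultragraph G"
begin

interpretation C: ideal_of "cauchy_seqs G" "null_seqs G" seq_scale
  by (rule ideal_of_cauchy[OF wf])

lemma seq_norm_cong:
  assumes "C.cong x y"
  shows "seq_norm G x = seq_norm G y"
proof -
  have "seq_norm G x \<le> seq_norm G y" if "C.cong x y" for x y
    using seq_norm_triangle[OF wf, of "x - y" y] that null_seqs_iff[OF wf]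
    by (auto simp: C.cong_def cauchy_diff[OF wf])
  from this[OF assms] this[OF C.cong_sym[OF assms]] show ?thesis
    by simp
qed

text \<open>From d = d^3 the norm t of d satisfies t \<le> t^3, impossible for 0 < t < 1.\<close>

lemma small_difference_of_commuting_idempotents:
  assumes "C.cong (z * z) z" "C.cong (g * g) g" "C.cong (z * g) (g * z)"
    and small: "seq_norm G (z - g) < 1"
  shows "C.cong z g"
proof -
  have d: "z - g \<in> cauchy_seqs G"
    by (intro C.S_diff C.cong_S(2)[OF assms(1)] C.cong_S(2)[OF assms(2)])
  let ?N = "seq_norm G (z - g)"
  have "?N = seq_norm G ((z - g) * (z - g) * (z - g))"
    by (rule seq_norm_cong[OF C.commuting_idempotents_diff[OF assms(1-3)], symmetric])
  also have "\<dots> \<le> seq_norm G ((z - g) * (z - g)) * ?N"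
    by (intro seq_norm_mult[OF wf] C.S_mult d)
  also have "\<dots> \<le> (?N * ?N) * ?N"
    by (intro mult_right_mono seq_norm_mult[OF wf] seq_norm_nonneg[OF wf] d)
  finally have "?N \<le> (?N * ?N) * ?N" .
  moreover have "0 \<le> ?N"
    by (intro seq_norm_nonneg[OF wf] d)
  moreover have "?N * ?N < 1" if "0 < ?N"
    using mult_strict_mono[OF small small] that by simp
  ultimately have "?N = 0"
    using mult_strict_right_mono[of "?N * ?N" 1 ?N] by linarith
  then show ?thesis
    using C.cong_S(2)[OF assms(1)] C.cong_S(2)[OF assms(2)] d by (simp add: C.cong_def null_seqs_iff[OF wf])
qed

lemma gauge_seq_diff: "gauge t \<circ> (x - y) = (gauge t \<circ> x) - (gauge t \<circ> y)"
  by (simp add: fun_eq_iff gauge_diff)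

lemma gauge_seq_mult: "gauge t \<circ> (x * y) = (gauge t \<circ> x) * (gauge t \<circ> y)"
  by (simp add: fun_eq_iff gauge_mult)

lemma gauge_seq_cong:
  assumes "C.cong x y"
  shows "C.cong (gauge t \<circ> x) (gauge t \<circ> y)"
proof -
  have "gauge t \<circ> (x - y) \<in> null_seqs G"
    using gauge_cauchy[OF wf, of "x - y" t] C.cong_self_zero[OF assms] by (simp add: null_seqs_iff[OF wf])
  then show ?thesis
    using gauge_cauchy[OF wf] C.cong_S[OF assms] by (simp add: C.cong_def gauge_seq_diff)
qed

text \<open>A central z commutes with its rotated copy, and for small angles the two are at distance
  less than 1, so they coincide.\<close>

lemma gauge_invariant:
  assumes z: "C.cong (z * z) z" and central: "\<And>x. x \<in> cauchy_seqs G \<Longrightarrow> C.cong (z * x) (x * z)"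
  shows "\<exists>M. \<forall>n\<ge>M. C.cong z (gauge (2 * pi / real n) \<circ> z)"
proof -
  have zS: "z \<in> cauchy_seqs G"
    using z C.cong_S by blast
  \<comment> \<open>The bound 1 / 3 divides the required distance 1 among z - y, y -
    \<open>gauge t y\<close> and the rotated y - z, whose norm is that of z - y.\<close>
  obtain y where y: "y \<in> free_carrier G" "seq_norm G (z - const y) < 1 / 3"
    using seq_norm_dense[OF wf zS, of "1 / 3"] by auto
  have yS: "const y \<in> cauchy_seqs G"
    by (rule cauchy_const[OF wf y(1)])
  obtain M where M: "\<forall>n\<ge>M. universal_norm G (y - gauge (2 * pi / real n) y) < 1 / 3"
    using order_tendstoD(2)[OF gauge_continuous[OF wf y(1)], of "1 / 3"]
    by (auto simp: eventually_sequentially)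
  have "C.cong z (gauge (2 * pi / real n) \<circ> z)" if "M \<le> n" for n
  proof (rule small_difference_of_commuting_idempotents)
    define t where "t = 2 * pi / real n"
    have gz: "gauge t \<circ> z \<in> cauchy_seqs G"
      by (rule gauge_cauchy[OF wf zS])
    show "C.cong (z * z) z"
      by (rule z)
    show "C.cong ((gauge (2 * pi / real n) \<circ> z) * (gauge (2 * pi / real n) \<circ> z))
        (gauge (2 * pi / real n) \<circ> z)"
      using gauge_seq_cong[OF z] by (simp only: gauge_seq_mult)
    show "C.cong (z * (gauge (2 * pi / real n) \<circ> z)) ((gauge (2 * pi / real n) \<circ> z) * z)"
      using central[OF gz] by (simp only: t_def)
    have tri: "seq_norm G ((z - const y) + (const (y - gauge t y) + (gauge t \<circ> (const y - z))))
        \<le> seq_norm G (z - const y) + seq_norm G (const (y - gauge t y) + (gauge t \<circ> (const y - z)))"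
      by (intro seq_norm_triangle[OF wf] C.S_add C.S_diff zS yS gauge_cauchy[OF wf] cauchy_const[OF wf]
          free_carrier_diff gauge_carrier y)
    have eq: "(z - const y) + (const (y - gauge t y) + (gauge t \<circ> (const y - z)))
        = z - (gauge t \<circ> z)"
      by (simp add: fun_eq_iff gauge_diff)
    note tri[unfolded eq]
    moreover have "seq_norm G (const (y - gauge t y) + (gauge t \<circ> (const y - z)))
        \<le> seq_norm G (const (y - gauge t y)) + seq_norm G (gauge t \<circ> (const y - z))"
      by (intro seq_norm_triangle[OF wf] C.S_diff zS yS gauge_cauchy[OF wf] cauchy_const[OF wf]
          free_carrier_diff gauge_carrier y)
    moreover have "seq_norm G (gauge t \<circ> (const y - z)) = seq_norm G (const y - z)"
      by (intro gauge_cauchy[OF wf] C.S_diff zS yS)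
    moreover have "seq_norm G (const y - z) = seq_norm G (z - const y)"
      using un_minus_commute[OF wf y(1) cauchy_seqs_carrier[OF zS]] by (simp add: seq_norm_def)
    moreover have "seq_norm G (const (y - gauge t y)) = universal_norm G (y - gauge t y)"
      by (intro seq_norm_const[OF wf] free_carrier_diff gauge_carrier y)
    moreover have "universal_norm G (y - gauge t y) < 1 / 3"
      using M that by (simp add: t_def)
    ultimately have small: "seq_norm G (z - (gauge t \<circ> z)) < 1"
      using y(2) by linarith
    then show "seq_norm G (z - (gauge (2 * pi / real n) \<circ> z)) < 1"
      by (simp only: t_def)
  qed
  then show ?thesis
    by blast
qed

lemma gauge_invariant_multiples:
  assumes "C.cong z (gauge t \<circ> z)"
  shows "C.cong z (gauge (real k * t) \<circ> z)"
proof (induction k)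
  case 0
  have "gauge (real 0 * t) \<circ> z = z"
    by (simp add: fun_eq_iff)
  then show ?case
    using C.cong_refl[OF C.cong_S(1)[OF assms]] by (simp only:)
next
  case (Suc k)
  have "C.cong z (gauge t \<circ> (gauge (real k * t) \<circ> z))"
    by (rule C.cong_trans[OF assms gauge_seq_cong[OF Suc]])
  moreover have "gauge t \<circ> (gauge (real k * t) \<circ> z) = gauge (real (Suc k) * t) \<circ> z"
    by (simp add: fun_eq_iff gauge_gauge algebra_simps)
  ultimately show ?case
    by (simp only:)
qed

text \<open>Rotations by multiples of a small angle fix z and preserve the norm, so rotated copies
  of an approximant are equally close to z, and so is their average, the degree 0 part.\<close>

lemma degree_0_approximation:
  assumes z: "C.cong (z * z) z" and central: "\<And>x. x \<in> cauchy_seqs G \<Longrightarrow> C.cong (z * x) (x * z)"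
    and "0 < \<epsilon>"
  shows "\<exists>y\<in>free_carrier G. (\<forall>w\<in>Poly_Mapping.keys y. word_degree w = 0)
    \<and> seq_norm G (z - const y) < \<epsilon>"
proof -
  have zS: "z \<in> cauchy_seqs G"
    using z C.cong_S by blast
  obtain y where y: "y \<in> free_carrier G" "seq_norm G (z - const y) < \<epsilon>"
    using seq_norm_dense[OF wf zS \<open>0 < \<epsilon>\<close>] by blast
  define \<delta> where "\<delta> = seq_norm G (z - const y)"
  obtain M where M: "\<forall>n\<ge>M. C.cong z (gauge (2 * pi / real n) \<circ> z)"
    using gauge_invariant[OF z central] by blast
  obtain D where D: "\<forall>d\<in>(\<lambda>w. nat \<bar>word_degree w\<bar>) ` Poly_Mapping.keys y. d \<le> D"
    using finite_nat_set_iff_bounded_le[of "(\<lambda>w. nat \<bar>word_degree w\<bar>) ` Poly_Mapping.keys y"] by auto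
  \<comment> \<open>n \<ge> M makes z invariant under the angle 2 pi / n, and n > D makes the
    average exact.\<close>
  define n where "n = max M (Suc D)"
  define t where "t = 2 * pi / real n"
  have "nat \<bar>word_degree w\<bar> \<le> D" if "w \<in> Poly_Mapping.keys y" for w
    using D that by blast
  then have n: "0 < n" "\<And>w. w \<in> Poly_Mapping.keys y \<Longrightarrow> \<bar>word_degree w\<bar> < int n"
    by (force simp: n_def)+
  have inv: "C.cong z (gauge (real k * t) \<circ> z)" for k
    using M by (intro gauge_invariant_multiples) (simp add: n_def t_def)
  have bound: "seq_norm G (z - const (gauge (real k * t) y)) \<le> \<delta>" for k
  proof -
    let ?g = "gauge (real k * t)"
    have tri: "seq_norm G ((z - (?g \<circ> z)) + (?g \<circ> (z - const y)))
        \<le> seq_norm G (z - (?g \<circ> z)) + seq_norm G (?g \<circ> (z - const y))"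
      by (intro seq_norm_triangle[OF wf] C.S_diff zS gauge_cauchy[OF wf] cauchy_const[OF wf] y)
    have eq: "(z - (?g \<circ> z)) + (?g \<circ> (z - const y)) = z - const (?g y)"
      by (simp add: fun_eq_iff gauge_diff)
    note tri[unfolded eq]
    moreover have "seq_norm G (z - (?g \<circ> z)) = 0"
      using C.cong_self_zero[OF inv] null_seqs_iff[OF wf] by blast
    moreover have "seq_norm G (?g \<circ> (z - const y)) = \<delta>"
      unfolding \<delta>_def by (intro gauge_cauchy[OF wf] C.S_diff zS cauchy_const[OF wf] y)
    ultimately show ?thesis
      by linarith
  qed
  \<comment> \<open>Partial sums of the errors of the rotated approximants, each at most \<delta> in
    norm; dividing the n-th sum by n leaves the error of the average.\<close>
  define s where "s m = (\<lambda>i. \<Sum>k<m. z i - gauge (real k * t) y)" for m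
  have s: "s m \<in> cauchy_seqs G \<and> seq_norm G (s m) \<le> real m * \<delta>" for m
  proof (induction m)
    case 0
    then show ?case
      using seq_norm_const[OF wf free_carrier_0] cauchy_const[OF wf free_carrier_0]
      by (simp add: s_def un_0[OF wf])
  next
    case (Suc m)
    have d: "z - const (gauge (real m * t) y) \<in> cauchy_seqs G"
      by (intro C.S_diff zS cauchy_const[OF wf] gauge_carrier y)
    have eq: "s (Suc m) = s m + (z - const (gauge (real m * t) y))"
      by (simp add: s_def fun_eq_iff)
    have "seq_norm G (s (Suc m)) \<le> seq_norm G (s m) + seq_norm G (z - const (gauge (real m * t) y))"
      unfolding eq using Suc d by (intro seq_norm_triangle[OF wf]) auto
    also have "\<dots> \<le> real m * \<delta> + \<delta>"
      using Suc bound[of m] by (intro add_mono) auto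
    finally show ?case
      using Suc C.S_add[OF _ d, of "s m"] by (simp add: eq[symmetric] distrib_right)
  qed
  have "z - const (degree_0_part y) = seq_scale (1 / of_nat n) (s n)"
  proof
    fix i
    have "scale (1 / of_nat n) (\<Sum>k<n. z i) = z i"
      using n(1) by (intro poly_mapping_eqI) (simp only: lookup_scale lookup_sum, simp)
    moreover have "scale (1 / of_nat n) (\<Sum>k<n. gauge (real k * t) y) = degree_0_part y"
      unfolding t_def by (rule gauge_average[OF n])
    ultimately show "(z - const (degree_0_part y)) i = seq_scale (1 / of_nat n) (s n) i"
      by (simp add: seq_scale_def s_def sum_subtractf scale_diff del: sum_constant)
  qed
  then have "seq_norm G (z - const (degree_0_part y)) \<le> cmod (1 / of_nat n) * seq_norm G (s n)"
    using seq_norm_scale_le[OF wf, of "s n"] s by simp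
  also have "\<dots> \<le> cmod (1 / of_nat n) * (real n * \<delta>)"
    using s by (intro mult_left_mono) auto
  also have "\<dots> = \<delta>"
    using n(1) by (simp add: norm_divide)
  finally show ?thesis
    using y(2)[folded \<delta>_def] degree_0_part_carrier[OF y(1)]
    by (intro bexI[of _ "degree_0_part y"]) (auto simp: in_keys_iff lookup_degree_0_part split: if_splits)
qed

end


section \<open>Words acting on paths\<close>

text \<open>The products s_\<alpha> b and, for \<open>ghost_mult\<close>, b s_\<alpha>^*.
  Consecutive edges need not be composable: the multiplication rules below allow for the value
  0.\<close>

fun path_mult :: "'e list \<Rightarrow> ('v, 'e, 'k::field) free \<Rightarrow> ('v, 'e, 'k) free" where
  "path_mult [] b = b"
| "path_mult (f # \<alpha>) b = ed f * path_mult \<alpha> b"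

fun ghost_mult :: "'e list \<Rightarrow> ('v, 'e, 'k::field) free \<Rightarrow> ('v, 'e, 'k) free" where
  "ghost_mult [] b = b"
| "ghost_mult (f # \<alpha>) b = ghost_mult \<alpha> b * gh f"

text \<open>The situation that the unit and Hall's identity produce: all but finitely many
  generators by vertices and edges vanish.\<close>

locale essential_graph = graph_ideal E J
  for E :: "('v, 'e) pre_digraph" and J :: "('v, 'e, 'k::field) free set" +
  fixes F :: "'v set"
  assumes finite_F: "finite F"
    and inessential: "v \<in> verts E - F \<Longrightarrow> pr {v} \<in> J"
    and finite_D: "finite {f \<in> arcs E. pr {head E f} \<notin> J}"
begin

notation cong (infix "\<approx>" 50)

definition D :: "'e set" where
  "D = {f \<in> arcs E. pr {head E f} \<notin> J}"

lemma D_arcs: "f \<in> D \<Longrightarrow> f \<in> arcs E"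
  by (simp add: D_def)

text \<open>Vanishes for a regular vertex; equals the vertex projection for a sink.\<close>

definition defect :: "'v \<Rightarrow> ('v, 'e, 'k) free" where
  "defect v = pr {v} - (\<Sum>f\<in>{f \<in> D. tail E f = v}. ed f * gh f)"

lemma edgh_S: "f \<in> arcs E \<Longrightarrow> ed f * gh f \<in> S"
  by (intro S_mult arc_S)

lemma finite_D_from: "finite {f \<in> D. tail E f = v}"
  by (rule finite_subset[OF _ finite_D]) (auto simp: D_def)

lemma defect_S: "v \<in> verts E \<Longrightarrow> defect v \<in> S"
  unfolding defect_def by (intro S_diff S_sum vertex_S edgh_S) (auto simp: D_def)

lemma pr_defect:
  assumes v: "v \<in> verts E" and B: "B \<in> generalized_vertices (ultragraph_of_graph E)"
  shows "pr B * defect v \<approx> (if v \<in> B then defect v else 0)"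
proof -
  have "pr B * pr {v} \<approx> (if v \<in> B then pr {v} else 0)"
    using pr_pr[OF B vertex_gv[OF v]] cong_trans[OF pr_pr[OF B vertex_gv[OF v]], of 0] pr_empty by auto
  moreover have "pr B * (ed f * gh f) \<approx> (if v \<in> B then ed f * gh f else 0)"
    if "f \<in> {f \<in> D. tail E f = v}" for f
    using cong_right[OF pr_ed[OF B, of f] arc_S(2)] that D_arcs[of f] by (auto simp: mult.assoc)
  ultimately have "pr B * pr {v} - (\<Sum>f\<in>{f \<in> D. tail E f = v}. pr B * (ed f * gh f))
      \<approx> (if v \<in> B then pr {v} else 0) - (\<Sum>f\<in>{f \<in> D. tail E f = v}. if v \<in> B then ed f * gh f else 0)"
    by (intro cong_diff cong_sum)
  then show ?thesis
    by (simp add: defect_def right_diff_distrib sum_distrib_left split: if_splits)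
qed

text \<open>For an edge f of \<open>D\<close> starting at v the summand s_f s_f^* cancels p_v; for
  other edges of \<open>D\<close> both terms vanish, and edges outside \<open>D\<close> are zero
  anyway. Hence no ghost can act beyond the empty path at a defect.\<close>

lemma gh_defect:
  assumes v: "v \<in> verts E" and f: "f \<in> arcs E"
  shows "gh f * defect v \<approx> 0"
proof (cases "f \<in> D")
  case False
  then have "gh f \<in> J"
    using inessential_arc(2)[OF f] f by (simp add: D_def)
  then show ?thesis
    using J_right defect_S[OF v] by (simp add: cong_0_iff)
next
  case True
  have "gh f * pr {v} \<approx> (if tail E f = v then gh f else 0)"
    using gh_pr[OF vertex_gv[OF v], of f] f by simp
  moreover have "gh f * (ed g * gh g) \<approx> (if f = g then gh f else 0)" if "g \<in> {f \<in> D. tail E f = v}" for g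
  proof -
    have "gh f * (ed g * gh g) \<approx> (if f = g then pr {head E f} else 0) * gh g"
      using cong_right[OF gh_ed_if[of f g] arc_S(2)[of g]] f that D_arcs[of g]
      by (auto simp: mult.assoc split: if_splits)
    then show ?thesis
      using cong_trans[OF _ head_gh[OF f]] by (auto split: if_splits)
  qed
  ultimately have "gh f * pr {v} - (\<Sum>g\<in>{f \<in> D. tail E f = v}. gh f * (ed g * gh g))
      \<approx> (if tail E f = v then gh f else 0) - (\<Sum>g\<in>{f \<in> D. tail E f = v}. if f = g then gh f else 0)"
    by (intro cong_diff cong_sum)
  moreover have "(\<Sum>g\<in>{f \<in> D. tail E f = v}. if f = g then gh f else 0)
      = (if tail E f = v then gh f else (0 :: ('v, 'e, 'k) free))"
    using True finite_D_from by (simp add: sum.delta')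
  ultimately show ?thesis
    by (simp add: defect_def right_diff_distrib sum_distrib_left)
qed

text \<open>The properties shared by p_u and the defect of u on which the word calculus
  rests.\<close>

definition corner :: "'v \<Rightarrow> ('v, 'e, 'k) free \<Rightarrow> bool" where
  "corner u b \<longleftrightarrow> b \<in> S \<and> b * b \<approx> b \<and>
    (\<forall>B\<in>generalized_vertices (ultragraph_of_graph E). pr B * b \<approx> (if u \<in> B then b else 0))"

lemma corner_pr:
  assumes "u \<in> verts E"
  shows "corner u (pr {u})"
  unfolding corner_def
proof (intro conjI ballI)
  fix B assume B: "B \<in> generalized_vertices (ultragraph_of_graph E)"
  show "pr B * pr {u} \<approx> (if u \<in> B then pr {u} else 0)"
    using pr_pr[OF B vertex_gv[OF assms]] cong_trans[OF pr_pr[OF B vertex_gv[OF assms]], of 0] pr_empty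
    by auto
qed (use assms vertex_S pr_idem in auto)

lemma corner_defect:
  assumes "u \<in> verts E"
  shows "corner u (defect u)"
  unfolding corner_def
proof (intro conjI ballI)
  have "defect u * defect u = pr {u} * defect u - (\<Sum>f\<in>{f \<in> D. tail E f = u}. ed f * (gh f * defect u))"
    by (subst (1) defect_def) (simp add: left_diff_distrib sum_distrib_right mult.assoc)
  also have "\<dots> \<approx> defect u - (\<Sum>f\<in>{f \<in> D. tail E f = u}. ed f * 0)"
    using pr_defect[OF assms vertex_gv[OF assms]]
    by (intro cong_diff cong_sum cong_left gh_defect[OF assms] arc_S) (auto simp: D_def)
  finally show "defect u * defect u \<approx> defect u"
    by simp
qed (use assms defect_S pr_defect in auto)

lemma path_mult_S: "b \<in> S \<Longrightarrow> set \<alpha> \<subseteq> arcs E \<Longrightarrow> path_mult \<alpha> b \<in> S"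
  by (induction \<alpha>) (auto intro: S_mult arc_S)

lemma ghost_mult_S: "b \<in> S \<Longrightarrow> set \<alpha> \<subseteq> arcs E \<Longrightarrow> ghost_mult \<alpha> b \<in> S"
  by (induction \<alpha>) (auto intro: S_mult arc_S)

lemma pr_path_mult:
  assumes b: "corner u b" and \<alpha>: "set \<alpha> \<subseteq> arcs E"
    and B: "B \<in> generalized_vertices (ultragraph_of_graph E)"
  shows "pr B * path_mult \<alpha> b \<approx> 0 \<or> pr B * path_mult \<alpha> b \<approx> path_mult \<alpha> b"
proof (cases \<alpha>)
  case Nil
  then show ?thesis
    using b B by (auto simp: corner_def split: if_splits)
next
  case (Cons f \<beta>)
  have "pr B * ed f * path_mult \<beta> b \<approx> (if tail E f \<in> B then ed f else 0) * path_mult \<beta> b"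
    using pr_ed[OF B, of f] \<alpha> b by (intro cong_right path_mult_S) (auto simp: Cons corner_def)
  then show ?thesis
    by (simp add: Cons mult.assoc split: if_splits)
qed

lemma gh_ed_path_mult:
  assumes b: "corner u b" and \<alpha>: "set \<alpha> \<subseteq> arcs E" and fg: "f \<in> arcs E" "g \<in> arcs E"
  shows "gh f * (ed g * path_mult \<alpha> b) \<approx> 0 \<or> gh f * (ed g * path_mult \<alpha> b) \<approx> path_mult \<alpha> b"
proof -
  have "gh f * ed g * path_mult \<alpha> b \<approx> (if f = g then pr {head E f} else 0) * path_mult \<alpha> b"
    using gh_ed_if[of f g] fg \<alpha> b by (intro cong_right path_mult_S) (auto simp: corner_def)
  then show ?thesis
    using pr_path_mult[OF b \<alpha> vertex_gv[OF head_E[OF fg(1)]]] cong_trans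
    by (auto simp: mult.assoc split: if_splits)
qed

text \<open>A projection keeps a path or kills it, an edge prolongs it, a ghost removes its first
  edge or kills it. The last assumption handles ghosts at the empty path.\<close>

lemma generator_path_mult:
  assumes b: "corner u b" and \<alpha>: "set \<alpha> \<subseteq> arcs E"
    and g: "g \<in> generators (ultragraph_of_graph E)"
    and "\<alpha> \<noteq> [] \<or> (\<forall>f\<in>arcs E. gh f * b \<approx> 0)"
  shows "gen g * path_mult \<alpha> b \<approx> 0 \<or> (\<exists>\<beta>. set \<beta> \<subseteq> arcs E \<and>
    int (length \<beta>) = int (length \<alpha>) + letter_degree g \<and> gen g * path_mult \<alpha> b \<approx> path_mult \<beta> b)"
proof (cases g)
  case (Proj B)
  then have B: "B \<in> generalized_vertices (ultragraph_of_graph E)"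
    using g by (auto simp: generators_def)
  show ?thesis
    using pr_path_mult[OF b \<alpha> B] \<alpha> by (auto simp: Proj pr_gen[symmetric])
next
  case (Edge f)
  then have f: "f \<in> arcs E"
    using g by (auto simp: generators_def)
  have "path_mult (f # \<alpha>) b \<in> S"
    using f \<alpha> b by (intro path_mult_S) (auto simp: corner_def)
  then have "gen g * path_mult \<alpha> b \<approx> path_mult (f # \<alpha>) b"
    using cong_refl by (simp add: Edge ed_gen[symmetric])
  then show ?thesis
    using f \<alpha> by (intro disjI2 exI[of _ "f # \<alpha>"]) (simp add: Edge)
next
  case (Ghost f)
  then have f: "f \<in> arcs E"
    using g by (auto simp: generators_def)
  show ?thesis
  proof (cases \<alpha>)
    case Nil
    then show ?thesis
      using assms(4) f by (simp add: Ghost gh_gen[symmetric])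
  next
    case (Cons h \<beta>)
    then have "gh f * path_mult \<alpha> b \<approx> 0 \<or> gh f * path_mult \<alpha> b \<approx> path_mult \<beta> b"
      using gh_ed_path_mult[OF b _ f, of \<beta> h] \<alpha> by simp
    then show ?thesis
      using \<alpha> Cons by (auto simp: Ghost gh_gen[symmetric])
  qed
qed

text \<open>A word with at most as many letters as \<alpha> cannot ask for an edge of an exhausted
  path.\<close>

lemma word_path_mult:
  assumes b: "corner u b" and \<alpha>: "set \<alpha> \<subseteq> arcs E"
    and "set ls \<subseteq> generators (ultragraph_of_graph E)"
    and "length ls \<le> length \<alpha> \<or> (\<forall>f\<in>arcs E. gh f * b \<approx> 0)"
  shows "Poly_Mapping.single (Word ls) 1 * path_mult \<alpha> b \<approx> 0 \<or> (\<exists>\<beta>. set \<beta> \<subseteq> arcs E \<and>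
    int (length \<beta>) = int (length \<alpha>) + word_degree (Word ls) \<and>
    Poly_Mapping.single (Word ls) 1 * path_mult \<alpha> b \<approx> path_mult \<beta> b)"
  using assms(3,4)
proof (induction ls)
  case Nil
  have "Poly_Mapping.single (Word []) 1 * path_mult \<alpha> b \<approx> path_mult \<alpha> b"
    using path_mult_S[OF _ \<alpha>, of b] b cong_refl
    by (simp add: zero_word_def[symmetric] corner_def)
  then show ?case
    using \<alpha> by (intro disjI2 exI[of _ \<alpha>]) (simp add: word_degree_def)
next
  case (Cons g ls)
  let ?w = "Poly_Mapping.single (Word ls) 1 :: ('v, 'e, 'k) free"
  have g: "gen g \<in> S" "g \<in> generators (ultragraph_of_graph E)"
    using Cons.prems by (auto intro: free_carrier_gen)
  have eq: "Poly_Mapping.single (Word (g # ls)) 1 * path_mult \<alpha> b = gen g * (?w * path_mult \<alpha> b)"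
    by (simp add: word_Cons mult.assoc)
  have "?w * path_mult \<alpha> b \<approx> 0 \<or> (\<exists>\<beta>. set \<beta> \<subseteq> arcs E \<and>
      int (length \<beta>) = int (length \<alpha>) + word_degree (Word ls) \<and> ?w * path_mult \<alpha> b \<approx> path_mult \<beta> b)"
    using Cons by auto
  then consider "?w * path_mult \<alpha> b \<approx> 0"
    | \<beta> where "set \<beta> \<subseteq> arcs E" "int (length \<beta>) = int (length \<alpha>) + word_degree (Word ls)"
      "?w * path_mult \<alpha> b \<approx> path_mult \<beta> b"
    by blast
  then show ?case
  proof cases
    case 1
    then show ?thesis
      using cong_zero_right[OF 1 g(1)] by (simp add: eq)
  next
    case 2
    \<comment> \<open>Each letter shortens the path by at most 1, so when \<open>g\<close> acts, at
      least |\<alpha>| - |ls| \<ge> 1 edges remain.\<close>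
    have lower: "- int (length ls) \<le> word_degree (Word ls)" for ls :: "('v, 'e) letter list"
    proof (induction ls)
      case (Cons g ls)
      then show ?case
        by (cases g) (simp_all add: word_degree_def)
    qed (simp add: word_degree_def)
    have "\<beta> \<noteq> [] \<or> (\<forall>f\<in>arcs E. gh f * b \<approx> 0)"
      using Cons.prems(2) 2(2) lower[of ls] by auto
    from generator_path_mult[OF b 2(1) g(2) this] show ?thesis
    proof
      assume "gen g * path_mult \<beta> b \<approx> 0"
      then show ?thesis
        using cong_trans[OF cong_left[OF g(1) 2(3)]] by (simp add: eq)
    next
      assume "\<exists>\<gamma>. set \<gamma> \<subseteq> arcs E \<and> int (length \<gamma>) = int (length \<beta>) + letter_degree g \<and>
        gen g * path_mult \<beta> b \<approx> path_mult \<gamma> b"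
      then obtain \<gamma> where \<gamma>: "set \<gamma> \<subseteq> arcs E" "int (length \<gamma>) = int (length \<beta>) + letter_degree g"
        "gen g * path_mult \<beta> b \<approx> path_mult \<gamma> b"
        by blast
      then show ?thesis
        using cong_trans[OF cong_left[OF g(1) 2(3)] \<gamma>(3)] 2(2)
        by (intro disjI2 exI[of _ \<gamma>]) (simp add: eq word_degree_def)
    qed
  qed
qed

text \<open>Edges cancel in pairs from the front; a mismatch gives 0, and with equal lengths b b
  remains otherwise.\<close>

lemma ghost_path_mult:
  assumes b: "corner u b" and "set \<alpha> \<subseteq> arcs E" "set \<beta> \<subseteq> arcs E" "length \<alpha> = length \<beta>"
  shows "ghost_mult \<alpha> b * path_mult \<beta> b \<approx> 0 \<or> ghost_mult \<alpha> b * path_mult \<beta> b \<approx> b"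
  using assms(2-)
proof (induction \<alpha> arbitrary: \<beta>)
  case Nil
  then show ?case
    using b by (simp add: corner_def)
next
  case (Cons f \<alpha>)
  then obtain g \<gamma> where \<beta>: "\<beta> = g # \<gamma>"
    by (cases \<beta>) auto
  have G: "ghost_mult \<alpha> b \<in> S"
    using b Cons.prems by (intro ghost_mult_S) (auto simp: corner_def)
  have eq: "ghost_mult (f # \<alpha>) b * path_mult \<beta> b = ghost_mult \<alpha> b * (gh f * (ed g * path_mult \<gamma> b))"
    by (simp add: \<beta> mult.assoc)
  have "gh f * (ed g * path_mult \<gamma> b) \<approx> 0 \<or> gh f * (ed g * path_mult \<gamma> b) \<approx> path_mult \<gamma> b"
    using Cons.prems by (intro gh_ed_path_mult[OF b]) (auto simp: \<beta>)
  then show ?case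
  proof
    assume "gh f * (ed g * path_mult \<gamma> b) \<approx> 0"
    then have "ghost_mult \<alpha> b * (gh f * (ed g * path_mult \<gamma> b)) \<approx> ghost_mult \<alpha> b * 0"
      by (rule cong_left[OF G])
    then show ?thesis
      by (simp only: eq mult_zero_right simp_thms)
  next
    assume "gh f * (ed g * path_mult \<gamma> b) \<approx> path_mult \<gamma> b"
    then have "ghost_mult (f # \<alpha>) b * path_mult \<beta> b \<approx> ghost_mult \<alpha> b * path_mult \<gamma> b"
      unfolding eq by (rule cong_left[OF G])
    then show ?thesis
      using cong_trans Cons.IH[of \<gamma>] Cons.prems by (auto simp: \<beta>)
  qed
qed

text \<open>A word of degree 0 sends s_\<alpha> b to 0 or to some s_\<beta> b with \<beta> as long
  as \<alpha>, and then b s_\<alpha>^* s_\<beta> b is 0 or b.\<close>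

lemma degree_0_compression:
  assumes b: "corner u b" and \<alpha>: "set \<alpha> \<subseteq> arcs E" and y: "y \<in> S"
    and deg: "\<And>w. w \<in> Poly_Mapping.keys y \<Longrightarrow> word_degree w = 0"
    and len: "(\<forall>w\<in>Poly_Mapping.keys y. length (letters w) \<le> length \<alpha>) \<or> (\<forall>f\<in>arcs E. gh f * b \<approx> 0)"
  shows "\<exists>c. ghost_mult \<alpha> b * y * path_mult \<alpha> b \<approx> scale c b"
proof (induction y rule: free_induct)
  case zero
  then show ?case
    by (intro exI[of _ 0]) (simp add: cong_refl S_zero)
next
  case (add x y)
  then obtain c d where "ghost_mult \<alpha> b * x * path_mult \<alpha> b \<approx> scale c b"
    "ghost_mult \<alpha> b * y * path_mult \<alpha> b \<approx> scale d b"
    by blast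
  moreover have "scale c b + scale d b = scale (c + d) b"
    by (rule poly_mapping_eqI) (simp add: lookup_add algebra_simps)
  ultimately show ?case
    using cong_add by (intro exI[of _ "c + d"]) (fastforce simp: algebra_simps)
next
  case (single w c)
  have bS: "b \<in> S"
    using b by (simp add: corner_def)
  have G: "ghost_mult \<alpha> b \<in> S"
    by (rule ghost_mult_S[OF bS \<alpha>])
  let ?w = "Poly_Mapping.single (Word (letters w)) 1 :: ('v, 'e, 'k) free"
  have "?w * path_mult \<alpha> b \<approx> 0 \<or> (\<exists>\<beta>. set \<beta> \<subseteq> arcs E \<and> int (length \<beta>) = int (length \<alpha>)
      + word_degree (Word (letters w)) \<and> ?w * path_mult \<alpha> b \<approx> path_mult \<beta> b)"
    using single y len by (intro word_path_mult[OF b \<alpha>]) (auto simp: free_carrier_def)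
  then have "ghost_mult \<alpha> b * (?w * path_mult \<alpha> b) \<approx> 0 \<or> ghost_mult \<alpha> b * (?w * path_mult \<alpha> b) \<approx> b"
  proof
    assume "?w * path_mult \<alpha> b \<approx> 0"
    then show ?thesis
      using cong_left[OF G] by fastforce
  next
    assume "\<exists>\<beta>. set \<beta> \<subseteq> arcs E \<and> int (length \<beta>) = int (length \<alpha>)
      + word_degree (Word (letters w)) \<and> ?w * path_mult \<alpha> b \<approx> path_mult \<beta> b"
    then obtain \<beta> where \<beta>: "set \<beta> \<subseteq> arcs E" "length \<alpha> = length \<beta>" "?w * path_mult \<alpha> b \<approx> path_mult \<beta> b"
      using deg[OF single] by auto
    then have "ghost_mult \<alpha> b * (?w * path_mult \<alpha> b) \<approx> ghost_mult \<alpha> b * path_mult \<beta> b"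
      using cong_left[OF G] by blast
    then show ?thesis
      using ghost_path_mult[OF b \<alpha> \<beta>(1,2)] cong_trans by blast
  qed
  then obtain d where "ghost_mult \<alpha> b * (?w * path_mult \<alpha> b) \<approx> scale d b"
    using scale_zero_left scale_one by metis
  then have "scale c (ghost_mult \<alpha> b * (?w * path_mult \<alpha> b)) \<approx> scale c (scale d b)"
    by (rule cong_scale)
  moreover have w: "Poly_Mapping.single w c = scale c ?w"
    by simp
  have "scale c (ghost_mult \<alpha> b * (?w * path_mult \<alpha> b))
      = ghost_mult \<alpha> b * Poly_Mapping.single w c * path_mult \<alpha> b"
    unfolding w scale_mult_left[symmetric] scale_mult_right[symmetric] mult.assoc ..
  ultimately show ?case
    by (auto simp: scale_scale)
qed

text \<open>The essential vertex projections add up to a right unit, so a nonzero element is nonzero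
  at one of them.\<close>

lemma sum_essential:
  assumes "x \<in> S"
  shows "x * (\<Sum>v\<in>F \<inter> verts E. pr {v}) \<approx> x"
  using assms
proof (induction x rule: free_carrier_induct)
  case zero
  then show ?case
    by (simp add: cong_refl S_zero)
next
  case (add x y)
  then show ?case
    by (simp add: distrib_right cong_add)
next
  case (scale c x)
  then show ?case
    by (simp add: scale_mult_left[symmetric] cong_scale)
next
  case (mult x y)
  then show ?case
    by (simp add: mult.assoc cong_left)
next
  case (generator g)
  have fin: "finite (F \<inter> verts E)"
    using finite_F by simp
  have single: "x * (\<Sum>v\<in>F \<inter> verts E. pr {v}) \<approx> x"
    if x: "x * pr {u} \<approx> x" and u: "u \<in> verts E" for x u
  proof -
    have xS: "x \<in> S"
      using x cong_S by blast
    have pu: "pr {u} * pr {v} \<approx> (if v = u then pr {u} else 0)" if "v \<in> verts E" for v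
      using pr_idem[OF u] cong_trans[OF pr_pr[OF vertex_gv[OF u] vertex_gv[OF that]], of 0] pr_empty
      by auto
    have "x * (\<Sum>v\<in>F \<inter> verts E. pr {v}) \<approx> x * pr {u} * (\<Sum>v\<in>F \<inter> verts E. pr {v})"
      by (intro cong_right cong_sym[OF x] S_sum vertex_S) auto
    also have "\<dots> = x * (\<Sum>v\<in>F \<inter> verts E. pr {u} * pr {v})"
      by (simp add: sum_distrib_left mult.assoc)
    also have "\<dots> \<approx> x * (\<Sum>v\<in>F \<inter> verts E. if v = u then pr {u} else 0)"
      by (intro cong_left cong_sum xS pu) auto
    also have "(\<Sum>v\<in>F \<inter> verts E. if v = u then pr {u} else 0) = (if u \<in> F then pr {u} else (0 :: ('v, 'e, 'k) free))"
      using fin u by simp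
    also have "x * \<dots> \<approx> x * pr {u}"
      using inessential[of u] u cong_sym[of "pr {u}" 0] vertex_S[OF u]
      by (intro cong_left xS) (auto simp: cong_0_iff intro: cong_refl)
    finally show ?thesis
      using cong_trans x by blast
  qed
  have set: "pr B * (\<Sum>v\<in>F \<inter> verts E. pr {v}) \<approx> pr B" if "finite B" "B \<subseteq> verts E" for B
    using that
  proof (induction B rule: finite_induct)
    case empty
    have "pr {} * (\<Sum>v\<in>F \<inter> verts E. pr {v}) \<approx> 0"
      by (intro cong_zero_left pr_empty S_sum vertex_S) auto
    then show ?case
      by (rule cong_trans[OF _ cong_sym[OF pr_empty]])
  next
    case (insert v B)
    have "pr ({v} \<union> B) \<approx> pr {v} + pr B - pr ({v} \<inter> B)"
      using insert by (intro pr_Un finite_gv_graph) auto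
    also have "\<dots> \<approx> pr {v} + pr B - 0"
      using insert pr_empty by (intro cong_diff cong_refl S_add pr_S finite_gv_graph) auto
    finally have eq: "pr (insert v B) \<approx> pr {v} + pr B"
      by simp
    have "pr (insert v B) * (\<Sum>v\<in>F \<inter> verts E. pr {v}) \<approx> (pr {v} + pr B) * (\<Sum>v\<in>F \<inter> verts E. pr {v})"
      by (intro cong_right eq S_sum vertex_S) auto
    also have "\<dots> \<approx> pr {v} + pr B"
      unfolding distrib_right using insert by (intro cong_add[OF single[OF pr_idem]]) auto
    also have "\<dots> \<approx> pr (insert v B)"
      by (rule cong_sym[OF eq])
    finally show ?case .
  qed
  show ?case
  proof (cases g)
    case (Proj B)
    then show ?thesis
      using generator set gv_graph[OF wf_digraph, of B] by (auto simp: generators_def pr_gen[symmetric])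
  next
    case (Edge f)
    then have f: "f \<in> arcs E"
      using generator by (auto simp: generators_def)
    show ?thesis
      unfolding Edge ed_gen[symmetric] by (rule single[OF ed_head[OF f] head_E[OF f]])
  next
    case (Ghost f)
    then have f: "f \<in> arcs E"
      using generator by (auto simp: generators_def)
    have "gh f * pr {tail E f} \<approx> gh f"
      using gh_source[of f] f by simp
    then show ?thesis
      unfolding Ghost gh_gen[symmetric] by (rule single[OF _ tail_E[OF f]])
  qed
qed

end


section \<open>Central idempotents of a graph C*-algebra\<close>

locale cstar_graph = essential_graph E
    "{x \<in> free_carrier (ultragraph_of_graph E). universal_norm (ultragraph_of_graph E) x = 0}" F
  for E :: "('v, 'e) pre_digraph" and F :: "'v set"
begin

notation cong (infix "\<approx>" 50)

abbreviation "G \<equiv> ultragraph_of_graph E"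
abbreviation "un \<equiv> universal_norm G :: ('v, 'e, complex) free \<Rightarrow> real"
abbreviation "N \<equiv> seq_norm G :: (nat \<Rightarrow> ('v, 'e, complex) free) \<Rightarrow> real"
abbreviation "CS \<equiv> cauchy_seqs G :: (nat \<Rightarrow> ('v, 'e, complex) free) set"

sublocale C: ideal_of "cauchy_seqs G" "null_seqs G" seq_scale
  by (rule ideal_of_cauchy[OF wf])

lemma const_CS: "x \<in> S \<Longrightarrow> const x \<in> CS"
  by (rule cauchy_const[OF wf])

lemma const_cong:
  assumes "x \<approx> y"
  shows "C.cong (const x) (const y)"
proof -
  have "const x - const y = const (x - y)"
    by (simp add: fun_eq_iff)
  moreover have "const (x - y) \<in> null_seqs G"
    using cong_self_zero[OF assms] by (simp add: null_seqs_iff[OF wf] const_CS seq_norm_const[OF wf])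
  ultimately show ?thesis
    using cong_S[OF assms] by (simp only: C.cong_def const_CS simp_thms)
qed

lemma const_mult: "const (x * y) = const x * const y"
  by (simp add: fun_eq_iff)

lemma const_sum: "const (sum f I) = (\<Sum>i\<in>I. const (f i))"
  by (induction I rule: infinite_finite_induct) (simp_all add: fun_eq_iff)

lemma N_const: "x \<in> S \<Longrightarrow> N (const x) = un x"
  by (rule seq_norm_const[OF wf])

lemma null_iff: "x \<in> CS \<Longrightarrow> x \<in> null_seqs G \<longleftrightarrow> N x = 0"
  by (simp add: null_seqs_iff[OF wf])

lemma N_nonneg: "x \<in> CS \<Longrightarrow> 0 \<le> N x"
  by (rule seq_norm_nonneg[OF wf])

lemma N_cong: "C.cong x y \<Longrightarrow> N x = N y"
  by (rule seq_norm_cong[OF wf])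

text \<open>The norm t of an idempotent satisfies t \<le> t^2. This gap between 0 and 1 turns
  smallness into vanishing.\<close>

lemma idempotent_norm:
  assumes e: "C.cong (e * e) e" and "e \<notin> null_seqs G"
  shows "1 \<le> N e"
proof -
  have eS: "e \<in> CS"
    by (rule C.cong_S(2)[OF e])
  have "N e \<noteq> 0"
    using null_iff[OF eS] assms(2) by simp
  then have pos: "0 < N e"
    using N_nonneg[OF eS] by simp
  have "N e = N (e * e)"
    by (rule N_cong[OF e, symmetric])
  also have "\<dots> \<le> N e * N e"
    by (rule seq_norm_mult[OF wf eS eS])
  finally have "N e * 1 \<le> N e * N e"
    by simp
  then show ?thesis
    using pos by (simp only: mult_le_cancel_left_pos)
qed

lemma un_arc: "f \<in> arcs E \<Longrightarrow> un (ed f) \<le> 1" "f \<in> arcs E \<Longrightarrow> un (gh f) \<le> 1"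
  using un_generator[OF wf, of "Edge f"] un_generator[OF wf, of "Ghost f"]
  by (simp_all add: generators_def ed_gen gh_gen)

lemma un_path_mult:
  assumes b: "b \<in> S" and "set \<alpha> \<subseteq> arcs E"
  shows "un (path_mult \<alpha> b) \<le> un b" "un (ghost_mult \<alpha> b) \<le> un b"
proof -
  have "un (path_mult \<alpha> b) \<le> un b \<and> un (ghost_mult \<alpha> b) \<le> un b"
    using assms(2)
  proof (induction \<alpha>)
    case (Cons f \<alpha>)
    then have S: "path_mult \<alpha> b \<in> S" "ghost_mult \<alpha> b \<in> S" "f \<in> arcs E"
      using b path_mult_S ghost_mult_S by auto
    have "un (ed f * path_mult \<alpha> b) \<le> 1 * un b"
      using Cons S un_arc[OF S(3)] un_nonneg[OF wf]
      by (intro order_trans[OF un_mult[OF wf arc_S(1) S(1)]] mult_mono) auto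
    moreover have "un (ghost_mult \<alpha> b * gh f) \<le> un b * 1"
      using Cons S un_arc[OF S(3)] un_nonneg[OF wf] arc_S[OF S(3)] b
      by (intro order_trans[OF un_mult[OF wf S(2) arc_S(2)]] mult_mono) auto
    ultimately show ?case
      by simp
  qed simp
  then show "un (path_mult \<alpha> b) \<le> un b" "un (ghost_mult \<alpha> b) \<le> un b"
    by auto
qed

definition central_idempotent :: "(nat \<Rightarrow> ('v, 'e, complex) free) \<Rightarrow> bool" where
  "central_idempotent z \<longleftrightarrow> C.cong (z * z) z \<and> (\<forall>x\<in>CS. C.cong (z * x) (x * z))"

lemma central_idempotentD:
  assumes "central_idempotent z"
  shows "z \<in> CS" "C.cong (z * z) z" "x \<in> CS \<Longrightarrow> C.cong (z * x) (x * z)"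
  using assms C.cong_S(2)[of "z * z" z] unfolding central_idempotent_def by auto

lemma central_corner_idempotent:
  assumes z: "central_idempotent z" and b: "b \<in> S" "b * b \<approx> b"
  shows "C.cong ((z * const b) * (z * const b)) (z * const b)"
proof -
  note zS = central_idempotentD(1)[OF z] and bS = const_CS[OF b(1)]
  have "(z * const b) * (z * const b) = z * (const b * z) * const b"
    by (simp only: mult.assoc)
  also have "C.cong \<dots> (z * (z * const b) * const b)"
    by (intro C.cong_left C.cong_right C.cong_sym[OF central_idempotentD(3)[OF z]] zS bS)
  also have "z * (z * const b) * const b = (z * z) * const (b * b)"
    by (simp only: mult.assoc const_mult)
  also have "C.cong \<dots> (z * const b)"
    by (intro C.cong_mult central_idempotentD(2)[OF z] const_cong b)
  finally show ?thesis .
qed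

text \<open>Centrality moves z between the two halves: z b = b s_\<alpha>^* z s_\<alpha> b.
  Replacing z by its degree 0 approximant y costs at most \<epsilon> times the norms of the halves,
  and the result is a multiple of b.\<close>

lemma compression_scalar:
  assumes z: "central_idempotent z" and b: "corner u b" and \<alpha>: "set \<alpha> \<subseteq> arcs E"
    and unit: "ghost_mult \<alpha> b * path_mult \<alpha> b \<approx> b"
    and y: "y \<in> S" "\<And>w. w \<in> Poly_Mapping.keys y \<Longrightarrow> word_degree w = 0" "N (z - const y) \<le> \<epsilon>"
    and len: "(\<forall>w\<in>Poly_Mapping.keys y. length (letters w) \<le> length \<alpha>) \<or> (\<forall>f\<in>arcs E. gh f * b \<approx> 0)"
  shows "\<exists>c. N (z * const b - const (scale c b)) \<le> un b * \<epsilon> * un b"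
proof -
  have bS: "b \<in> S"
    using b by (simp add: corner_def)
  define g where "g = ghost_mult \<alpha> b"
  define q where "q = path_mult \<alpha> b"
  have gq: "g \<in> S" "q \<in> S" "un g \<le> un b" "un q \<le> un b"
    using ghost_mult_S[OF bS \<alpha>] path_mult_S[OF bS \<alpha>] un_path_mult[OF bS \<alpha>]
    by (simp_all add: g_def q_def)
  note zS = central_idempotentD(1)[OF z]
  note S = zS const_CS[OF gq(1)] const_CS[OF gq(2)] const_CS[OF bS] const_CS[OF y(1)]
  obtain c where c: "g * y * q \<approx> scale c b"
    using degree_0_compression[OF b \<alpha> y(1,2) len] unfolding g_def q_def by blast
  have "C.cong (z * const b) (z * const (g * q))"
    by (intro C.cong_left const_cong cong_sym[OF unit[folded g_def q_def]] zS)
  also have "z * const (g * q) = (z * const g) * const q"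
    by (simp only: const_mult mult.assoc)
  also have "C.cong \<dots> (const g * z * const q)"
    by (intro C.cong_right central_idempotentD(3)[OF z] S)
  finally have 1: "C.cong (z * const b) (const g * z * const q)" .
  have 2: "C.cong (const (scale c b)) (const g * const y * const q)"
    using const_cong[OF cong_sym[OF c]] by (simp only: const_mult)
  have "N (z * const b - const (scale c b)) = N (const g * z * const q - const g * const y * const q)"
    by (intro N_cong C.cong_diff 1 2)
  also have "const g * z * const q - const g * const y * const q = const g * (z - const y) * const q"
    by (simp only: left_diff_distrib right_diff_distrib)
  also have "N \<dots> \<le> N (const g * (z - const y)) * N (const q)"
    by (intro seq_norm_mult[OF wf] C.S_mult C.S_diff S)
  also have "\<dots> \<le> (N (const g) * N (z - const y)) * N (const q)"
    by (intro mult_right_mono seq_norm_mult[OF wf] C.S_mult C.S_diff S N_nonneg)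
  also have "\<dots> \<le> (un b * \<epsilon>) * un b"
    unfolding N_const[OF gq(1)] N_const[OF gq(2)] using y(3) gq
    by (intro mult_mono order_trans[OF N_nonneg y(3)] mult_nonneg_nonneg N_nonneg C.S_diff S
        un_nonneg[OF wf] bS)
  finally show ?thesis
    by blast
qed

text \<open>If z b is near c b, multiplying by z' shows that c z' b is small, because z' z = 0. As
  z' b has norm at least 1, this bounds |c|; then z b itself has norm below 1, against the gap for
  idempotents.\<close>

lemma orthogonal_corners:
  assumes z: "central_idempotent z" "central_idempotent z'" and orth: "z * z' \<in> null_seqs G"
    and b: "b \<in> S" "b * b \<approx> b"
    and c: "N (z * const b - const (scale c b)) \<le> \<delta>" and small: "(N z' * un b + 1) * \<delta> < 1"
    and nonnull: "z * const b \<notin> null_seqs G" "z' * const b \<notin> null_seqs G"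
  shows False
proof -
  note S = central_idempotentD(1)[OF z(1)] central_idempotentD(1)[OF z(2)] const_CS[OF b(1)]
    const_CS[OF free_carrier_scale[OF b(1), of c]]
  let ?e = "z' * const b"
  have e: "?e \<in> CS" "seq_scale c ?e \<in> CS"
    by (intro C.S_mult C.S_scale S)+
  have "const (scale c b) = seq_scale c (const b)"
    by (simp add: seq_scale_def)
  have "C.cong (z' * (z * const b - const (scale c b))) (- seq_scale c ?e)"
  proof -
    have "z' * (z * const b - const (scale c b)) = z' * z * const b - seq_scale c ?e"
      by (simp add: fun_eq_iff seq_scale_def scale_mult_right algebra_simps)
    moreover have "C.cong (z' * z) 0"
      using C.cong_trans[OF C.cong_sym[OF central_idempotentD(3)[OF z(1) S(2)]]] orth C.cong_0_iff
      by blast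
    then have "C.cong (z' * z * const b) (0 * const b)"
      by (intro C.cong_right S)
    then have "C.cong (z' * z * const b - seq_scale c ?e) (0 * const b - seq_scale c ?e)"
      by (intro C.cong_diff C.cong_refl e)
    ultimately show ?thesis
      by simp
  qed
  then have "N (- seq_scale c ?e) = N (z' * (z * const b - const (scale c b)))"
    by (rule N_cong[symmetric])
  also have "\<dots> \<le> N z' * N (z * const b - const (scale c b))"
    by (intro seq_norm_mult[OF wf] C.S_mult C.S_diff S)
  also have "\<dots> \<le> N z' * \<delta>"
    by (intro mult_left_mono c N_nonneg S)
  finally have le: "N (- seq_scale c ?e) \<le> N z' * \<delta>" .
  have e1: "1 \<le> N ?e"
    by (rule idempotent_norm[OF central_corner_idempotent[OF z(2) b] nonnull(2)])
  have "cmod c \<le> N z' * \<delta>"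
  proof (cases "c = 0")
    case True
    have "0 \<le> N (z * const b - const (scale c b))"
      by (intro N_nonneg C.S_diff C.S_mult S)
    then have "0 \<le> N z' * \<delta>"
      using c by (intro mult_nonneg_nonneg N_nonneg S) auto
    then show ?thesis
      using True by simp
  next
    case False
    have "?e = seq_scale (- (1 / c)) (- seq_scale c ?e)"
      using False by (simp add: fun_eq_iff seq_scale_def scale_scale scale_minus_one[symmetric])
    then have "N ?e \<le> cmod (- (1 / c)) * N (- seq_scale c ?e)"
      using seq_norm_scale_le[OF wf C.S_uminus[OF e(2)], of "- (1 / c)"] by simp
    then have "1 \<le> cmod (- (1 / c)) * (N z' * \<delta>)"
      using e1 le mult_left_mono[OF le, of "cmod (- (1 / c))"] by simp
    then show ?thesis
      using False by (simp add: norm_divide field_simps)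
  qed
  then have "cmod c * un b \<le> N z' * \<delta> * un b"
    by (intro mult_right_mono un_nonneg[OF wf] b)
  moreover have "N (const (scale c b)) \<le> cmod c * un b"
    using un_scale_le[OF wf b(1), of c] N_const[OF free_carrier_scale[OF b(1), of c]] by simp
  moreover have "N ((z * const b - const (scale c b)) + const (scale c b))
      \<le> N (z * const b - const (scale c b)) + N (const (scale c b))"
    by (intro seq_norm_triangle[OF wf] C.S_diff C.S_mult S)
  moreover have "1 \<le> N (z * const b)"
    by (rule idempotent_norm[OF central_corner_idempotent[OF z(1) b] nonnull(1)])
  ultimately have "1 \<le> \<delta> + N z' * \<delta> * un b"
    using c by (simp only: diff_add_cancel)
  then show False
    using small by (simp add: algebra_simps)
qed

lemma nonnull_vertex:
  assumes z: "z \<in> CS" "z \<notin> null_seqs G"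
  shows "\<exists>v\<in>F \<inter> verts E. z * const (pr {v}) \<notin> null_seqs G"
proof (rule ccontr)
  assume "\<not> ?thesis"
  then have null: "z * const (pr {v}) \<in> null_seqs G" if "v \<in> F \<inter> verts E" for v
    using that by blast
  let ?\<sigma> = "\<Sum>v\<in>F \<inter> verts E. pr {v} :: ('v, 'e, complex) free"
  have \<sigma>: "?\<sigma> \<in> S"
    by (intro S_sum vertex_S) auto
  have "(\<Sum>v\<in>F \<inter> verts E. z * const (pr {v})) \<in> null_seqs G"
    using C.cong_sum[of "F \<inter> verts E" "\<lambda>v. z * const (pr {v})" "\<lambda>_. 0"] null by (simp add: C.cong_0_iff)
  then have "z * const ?\<sigma> \<in> null_seqs G"
    by (simp only: const_sum sum_distrib_left)
  moreover have "z * const ?\<sigma> - z \<in> null_seqs G"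
  proof -
    have "un ((z * const ?\<sigma> - z) n) = 0" for n
      using cong_self_zero[OF sum_essential[OF cauchy_seqs_carrier[OF z(1), of n]]] by simp
    then show ?thesis
      unfolding null_seqs_def by (simp add: C.S_diff C.S_mult z const_CS \<sigma>)
  qed
  ultimately have "z * const ?\<sigma> - (z * const ?\<sigma> - z) \<in> null_seqs G"
    by (rule C.J_diff)
  then show False
    using z(2) by simp
qed

text \<open>p_v is the sum of its defect and the s_f s_f^*, and z s_f s_f^* = s_f z p_{r(f)} s_f^*
  by centrality, so z must survive at some head.\<close>

lemma nonnull_successor:
  assumes z: "central_idempotent z" and v: "v \<in> verts E" "z * const (pr {v}) \<notin> null_seqs G"
    and defect: "z * const (defect v) \<in> null_seqs G"
  shows "\<exists>f\<in>D. tail E f = v \<and> z * const (pr {head E f}) \<notin> null_seqs G"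
proof (rule ccontr)
  assume "\<not> ?thesis"
  then have null: "z * const (pr {head E f}) \<in> null_seqs G" if "f \<in> {f \<in> D. tail E f = v}" for f
    using that by blast
  note zS = central_idempotentD(1)[OF z]
  have edge: "z * const (ed f * gh f) \<in> null_seqs G" if f: "f \<in> {f \<in> D. tail E f = v}" for f
  proof -
    have A: "f \<in> arcs E"
      using f D_arcs by blast
    note S = zS const_CS[OF arc_S(1)[OF A]] const_CS[OF arc_S(2)[OF A]] const_CS[OF vertex_S[OF head_E[OF A]]]
    have "z * const (ed f * gh f) = z * const (ed f) * const (gh f)"
      by (simp only: const_mult mult.assoc)
    also have "C.cong \<dots> (const (ed f) * z * const (pr {head E f} * gh f))"
      by (intro C.cong_mult central_idempotentD(3)[OF z] S const_cong cong_sym[OF head_gh[OF A]])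
    also have "const (ed f) * z * const (pr {head E f} * gh f)
        = const (ed f) * (z * const (pr {head E f})) * const (gh f)"
      by (simp only: const_mult mult.assoc)
    finally show ?thesis
      using C.cong_J_iff C.J_right[OF C.J_left[OF S(2) null[OF f]] S(3)] by blast
  qed
  have "(\<Sum>f\<in>{f \<in> D. tail E f = v}. z * const (ed f * gh f)) \<in> null_seqs G"
    using C.cong_sum[of "{f \<in> D. tail E f = v}" "\<lambda>f. z * const (ed f * gh f)" "\<lambda>_. 0"] edge
    by (simp add: C.cong_0_iff)
  then have "z * const (\<Sum>f\<in>{f \<in> D. tail E f = v}. ed f * gh f) \<in> null_seqs G"
    by (simp only: const_sum sum_distrib_left)
  then have "z * const (defect v) + z * const (\<Sum>f\<in>{f \<in> D. tail E f = v}. ed f * gh f) \<in> null_seqs G"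
    using defect C.J_add by simp
  moreover have "z * const (defect v) + z * const (\<Sum>f\<in>{f \<in> D. tail E f = v}. ed f * gh f)
      = z * const (pr {v})"
    by (simp add: fun_eq_iff defect_def algebra_simps)
  ultimately show False
    using v(2) by simp
qed

text \<open>Without nonzero defects z can be followed along successors for any number of steps. The
  condition at v makes the next edge composable with the path, so that the final product is p_u and
  not 0.\<close>

lemma nonnull_path:
  assumes z: "central_idempotent z" and defect: "\<And>v. v \<in> verts E \<Longrightarrow> z * const (defect v) \<in> null_seqs G"
    and "v \<in> verts E" "z * const (pr {v}) \<notin> null_seqs G"
  shows "\<exists>\<alpha> u. length \<alpha> = n \<and> set \<alpha> \<subseteq> arcs E \<and> u \<in> verts E \<and> z * const (pr {u}) \<notin> null_seqs G \<and>
    pr {v} * path_mult \<alpha> (pr {u}) \<approx> path_mult \<alpha> (pr {u}) \<and>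
    ghost_mult \<alpha> (pr {u}) * path_mult \<alpha> (pr {u}) \<approx> pr {u}"
  using assms(3,4)
proof (induction n arbitrary: v)
  case 0
  then show ?case
    using pr_idem by (intro exI[of _ "[]"] exI[of _ v]) auto
next
  case (Suc n)
  obtain f where f: "f \<in> D" "tail E f = v" "z * const (pr {head E f}) \<notin> null_seqs G"
    using nonnull_successor[OF z Suc.prems defect[OF Suc.prems(1)]] by blast
  have A: "f \<in> arcs E"
    by (rule D_arcs[OF f(1)])
  obtain \<alpha> u where \<alpha>: "length \<alpha> = n" "set \<alpha> \<subseteq> arcs E" "u \<in> verts E" "z * const (pr {u}) \<notin> null_seqs G"
    and v: "pr {head E f} * path_mult \<alpha> (pr {u}) \<approx> path_mult \<alpha> (pr {u})"
    and u: "ghost_mult \<alpha> (pr {u}) * path_mult \<alpha> (pr {u}) \<approx> pr {u}"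
    using Suc.IH[OF head_E[OF A] f(3)] by blast
  have S: "path_mult \<alpha> (pr {u}) \<in> S" "ghost_mult \<alpha> (pr {u}) \<in> S"
    using \<alpha> path_mult_S ghost_mult_S vertex_S by auto
  have "pr {v} * ed f * path_mult \<alpha> (pr {u}) \<approx> ed f * path_mult \<alpha> (pr {u})"
    using source_ed[of f] A f(2) by (intro cong_right S) simp
  moreover have "ghost_mult \<alpha> (pr {u}) * (gh f * ed f * path_mult \<alpha> (pr {u})) \<approx> pr {u}"
  proof -
    have "gh f * ed f * path_mult \<alpha> (pr {u}) \<approx> path_mult \<alpha> (pr {u})"
      by (rule cong_trans[OF cong_right[OF gh_ed_head[OF A] S(1)] v])
    then show ?thesis
      by (intro cong_trans[OF cong_left[OF S(2)] u])
  qed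
  ultimately show ?case
    using \<alpha>(1,2) A by (intro exI[of _ "f # \<alpha>"] exI[of _ u] conjI \<alpha>(3,4)) (simp_all add: mult.assoc)
qed

text \<open>Pigeonhole: each idempotent selects, from a finite set, a corner element on which it is
  nonzero and nearly scalar, and orthogonal idempotents cannot select the same one. So m + 1 of them
  exceed m corner elements.\<close>

theorem no_infinite_family_of_central_idempotents:
  assumes z: "\<And>n :: nat. central_idempotent (z n)" and nonnull: "\<And>n. z n \<notin> null_seqs G"
    and orth: "\<And>n m. n \<noteq> m \<Longrightarrow> z n * z m \<in> null_seqs G"
  shows False
proof -
  define B where "B = (\<lambda>(d, v). if d then defect v else pr {v}) ` (UNIV \<times> (F \<inter> verts E))"
  have B: "finite B" "B \<subseteq> S"
    using finite_F defect_S vertex_S by (auto simp: B_def)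
  define m where "m = card B"
  define K where "K = (\<Sum>b\<in>B. un b)"
  define Z where "Z = (\<Sum>i\<le>m. N (z i))"
  have K: "un b \<le> K" "0 \<le> un b" if "b \<in> B" for b
    using that B un_nonneg[OF wf] by (auto simp: K_def intro!: member_le_sum)
  have "0 \<le> K"
    unfolding K_def using B un_nonneg[OF wf] by (intro sum_nonneg) auto
  have zS: "z n \<in> CS" for n
    by (rule central_idempotentD(1)[OF z])
  have Z: "N (z i) \<le> Z" if "i \<le> m" for i
    unfolding Z_def using that zS N_nonneg by (intro member_le_sum) auto
  have "0 \<le> Z"
    unfolding Z_def using zS N_nonneg by (intro sum_nonneg) auto
  \<comment> \<open>Chosen to meet the smallness condition of \<open>orthogonal_corners\<close>,
    with K and Z as uniform bounds for \<open>un b\<close> and \<open>N (z i)\<close>; the final + 1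
    makes the estimate strict and the denominator positive.\<close>
  define \<epsilon> where "\<epsilon> = 1 / ((Z * K + 1) * (K * K) + 1)"
  have T: "0 \<le> (Z * K + 1) * (K * K)"
    using \<open>0 \<le> K\<close> \<open>0 \<le> Z\<close> by simp
  then have \<epsilon>: "0 < \<epsilon>" "(Z * K + 1) * (K * \<epsilon> * K) < 1"
    by (simp_all add: \<epsilon>_def field_simps)
  have "\<forall>i. \<exists>y. y \<in> S \<and> (\<forall>w\<in>Poly_Mapping.keys y. word_degree w = 0) \<and> N (z i - const y) < \<epsilon>"
    using degree_0_approximation[OF wf central_idempotentD(2)[OF z] central_idempotentD(3)[OF z] \<epsilon>(1)]
    by blast
  from choice[OF this] obtain y where y: "\<And>i. y i \<in> S" "\<And>i w. w \<in> Poly_Mapping.keys (y i) \<Longrightarrow> word_degree w = 0"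
    "\<And>i. N (z i - const (y i)) < \<epsilon>"
    by auto
  have "finite (\<Union>i\<le>m. (\<lambda>w. length (letters w)) ` Poly_Mapping.keys (y i))"
    by simp
  \<comment> \<open>The longest word length in the approximants; paths of this length outlast every
    word.\<close>
  then obtain L where "\<forall>l\<in>(\<Union>i\<le>m. (\<lambda>w. length (letters w)) ` Poly_Mapping.keys (y i)). l \<le> L"
    using finite_nat_set_iff_bounded_le by blast
  then have L: "length (letters w) \<le> L" if "i \<le> m" "w \<in> Poly_Mapping.keys (y i)" for i w
    using that by blast
  have scalar: "\<exists>b\<in>B. b * b \<approx> b \<and> z i * const b \<notin> null_seqs G \<and>
      (\<exists>c. N (z i * const b - const (scale c b)) \<le> un b * \<epsilon> * un b)" if i: "i \<le> m" for i
  proof (cases "\<exists>v\<in>F \<inter> verts E. z i * const (defect v) \<notin> null_seqs G")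
    case True
    then obtain v where v: "v \<in> F \<inter> verts E" "z i * const (defect v) \<notin> null_seqs G"
      by blast
    have c: "corner v (defect v)"
      using v by (intro corner_defect) auto
    \<comment> \<open>The empty path suffices, since ghosts annihilate the defect.\<close>
    have "\<exists>c. N (z i * const (defect v) - const (scale c (defect v))) \<le> un (defect v) * \<epsilon> * un (defect v)"
      using y(3)[of i] gh_defect[of v] v(1) c
      by (intro compression_scalar[OF z c, where \<alpha> = "[]" and y = "y i"] y) (auto simp: corner_def)
    moreover have "defect v \<in> B"
      using v(1) by (force simp: B_def)
    ultimately show ?thesis
      using v(2) c by (auto simp: corner_def)
  next
    case False
    have defect: "z i * const (defect v) \<in> null_seqs G" if v: "v \<in> verts E" for v
    proof (cases "v \<in> F")
      case True
      then show ?thesis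
        using False v by blast
    next
      case False
      then have 0: "pr {v} * defect v \<approx> 0"
        unfolding cong_0_iff using v by (intro J_right inessential defect_S) auto
      have "pr {v} * defect v \<approx> defect v"
        using pr_defect[OF v vertex_gv[OF v]] by simp
      from cong_trans[OF cong_sym[OF this] 0] have "defect v \<approx> 0" .
      then have "C.cong (z i * const (defect v)) (z i * const 0)"
        by (intro C.cong_left const_cong zS)
      moreover have "z i * const 0 = 0"
        by (simp add: fun_eq_iff)
      ultimately show ?thesis
        by (simp only: C.cong_0_iff)
    qed
    obtain v where v: "v \<in> F \<inter> verts E" "z i * const (pr {v}) \<notin> null_seqs G"
      using nonnull_vertex[OF zS nonnull] by blast
    obtain \<alpha> u where \<alpha>: "length \<alpha> = L" "set \<alpha> \<subseteq> arcs E" "u \<in> verts E" "z i * const (pr {u}) \<notin> null_seqs G"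
      "ghost_mult \<alpha> (pr {u}) * path_mult \<alpha> (pr {u}) \<approx> pr {u}"
      using nonnull_path[OF z defect, where v = v and n = L] v by blast
    have c: "corner u (pr {u})"
      using \<alpha>(3) by (rule corner_pr)
    have "\<exists>c. N (z i * const (pr {u}) - const (scale c (pr {u}))) \<le> un (pr {u}) * \<epsilon> * un (pr {u})"
      using y(3)[of i] L[OF i] \<alpha>
      by (intro compression_scalar[OF z c \<alpha>(2) \<alpha>(5), where y = "y i"] y) auto
    moreover have "u \<in> F"
    proof (rule ccontr)
      assume "u \<notin> F"
      then have "C.cong (z i * const (pr {u})) (z i * const 0)"
        using inessential[of u] \<alpha>(3) by (intro C.cong_left const_cong zS) (simp add: cong_0_iff)
      moreover have "z i * const 0 = 0"
        by (simp add: fun_eq_iff)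
      ultimately show False
        using \<alpha>(4) by (simp only: C.cong_0_iff)
    qed
    then have "pr {u} \<in> B"
      using \<alpha>(3) by (force simp: B_def)
    ultimately show ?thesis
      using \<alpha>(4) c by (auto simp: corner_def)
  qed
  then have "\<forall>i\<in>{..m}. \<exists>b. b \<in> B \<and> b * b \<approx> b \<and> z i * const b \<notin> null_seqs G \<and>
      (\<exists>c. N (z i * const b - const (scale c b)) \<le> un b * \<epsilon> * un b)"
    by blast
  from bchoice[OF this] obtain b where b: "\<And>i. i \<le> m \<Longrightarrow> b i \<in> B \<and> b i * b i \<approx> b i \<and> z i * const (b i) \<notin> null_seqs G \<and>
      (\<exists>c. N (z i * const (b i) - const (scale c (b i))) \<le> un (b i) * \<epsilon> * un (b i))"
    by auto
  have "inj_on b {..m}"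
  proof (rule inj_onI, rule ccontr)
    fix i j
    assume ij: "i \<in> {..m}" "j \<in> {..m}" "b i = b j" "i \<noteq> j"
    obtain c where c: "N (z i * const (b i) - const (scale c (b i))) \<le> un (b i) * \<epsilon> * un (b i)"
      using b[of i] ij(1) by auto
    have bi: "b i \<in> B" "b i \<in> S" "b i * b i \<approx> b i"
      using b[of i] ij(1) B(2) by auto
    have "(N (z j) * un (b i) + 1) * (un (b i) * \<epsilon> * un (b i)) \<le> (Z * K + 1) * (K * \<epsilon> * K)"
      using K[OF bi(1)] Z[of j] ij(2) \<epsilon>(1) N_nonneg[OF zS] \<open>0 \<le> K\<close> \<open>0 \<le> Z\<close>
      by (intro mult_mono add_mono) auto
    then have "(N (z j) * un (b i) + 1) * (un (b i) * \<epsilon> * un (b i)) < 1"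
      using \<epsilon>(2) by simp
    then show False
      using orthogonal_corners[OF z z orth[OF ij(4)] bi(2,3) c] b[of i] b[of j] ij by auto
  qed
  then have "card (b ` {..m}) = Suc m"
    by (simp add: card_image)
  moreover have "card (b ` {..m}) \<le> m"
    unfolding m_def using b by (intro card_mono B) (auto simp: m_def)
  ultimately show False
    by simp
qed

end

theorem cstar_not_isomorphic:
  fixes E :: "('v, 'e) pre_digraph"
  assumes "wf_digraph E"
  shows "\<not> star_isomorphic (ultragraph_cstar_algebra ultragraph_G) (graph_cstar_algebra E)"
proof
  let ?G = "ultragraph_of_graph E"
  let ?JE = "{x \<in> free_carrier ?G. universal_norm ?G x = 0}"
  have wfE: "wf_ultragraph ?G"
    by (rule wf_ultragraph_of_graph[OF assms])
  assume "star_isomorphic (ultragraph_cstar_algebra ultragraph_G) (graph_cstar_algebra E)"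
  then obtain h where "alg_isomorphism (ultragraph_cstar_algebra ultragraph_G) (graph_cstar_algebra E) h"
    unfolding star_isomorphic_def by blast
  then have h: "alg_isomorphism (quotient_alg (cauchy_alg ultragraph_G) (null_cong ultragraph_G))
      (quotient_alg (cauchy_alg ?G) (null_cong ?G)) h"
    by (simp add: alg_isomorphism_def ultragraph_cstar_algebra_def graph_cstar_algebra_def alg.defs)
  interpret G: ideal_G "leavitt_ideal ultragraph_G :: (vertex, edge, complex) free set"
    unfolding ideal_G_def ultragraph_ideal_def ultragraph_ideal_axioms_def
    by (simp add: ideal_of_leavitt wf_ultragraph_G)
  interpret E: graph_ideal E ?JE
    unfolding graph_ideal_def graph_ideal_axioms_def
    using ultragraph_ideal_null[OF wfE] assms by blast
  interpret CG: ideal_of "cauchy_seqs ultragraph_G" "null_seqs ultragraph_G" seq_scale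
    by (rule ideal_of_cauchy[OF wf_ultragraph_G])
  interpret CE: ideal_of "cauchy_seqs ?G" "null_seqs ?G" seq_scale
    by (rule ideal_of_cauchy[OF wfE])
  obtain rel where "correspondence (cauchy_seqs ultragraph_G) (null_seqs ultragraph_G) seq_scale
      (cauchy_seqs ?G) (null_seqs ?G) seq_scale rel"
    using correspondence_exists[OF CG.ideal_of_axioms CE.ideal_of_axioms] h
    unfolding quot_cauchy[OF wf_ultragraph_G] quot_cauchy[OF wfE] by blast
  then interpret correspondence "cauchy_seqs ultragraph_G" "null_seqs ultragraph_G" seq_scale
      "cauchy_seqs ?G" "null_seqs ?G" seq_scale rel .
  \<comment> \<open>Identities known modulo the Leavitt ideal hold in every term of a sequence,
    hence in the completion.\<close>
  have pointwise: "x \<in> null_seqs ultragraph_G"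
    if "x \<in> cauchy_seqs ultragraph_G" "\<And>n. x n \<in> leavitt_ideal ultragraph_G" for x
    using that un_leavitt_ideal[OF wf_ultragraph_G] by (simp add: null_seqs_def)
  have carrier: "x n \<in> free_carrier ultragraph_G" if "x \<in> cauchy_seqs ultragraph_G" for x n
    by (rule cauchy_seqs_carrier[OF that])
  \<comment> \<open>The identity is transferred for constant sequences, where it returns to the free
    algebra of the graph.\<close>
  have hall: "hall x y z \<in> ?JE" if S: "x \<in> E.S" "y \<in> E.S" "z \<in> E.S" for x y z
  proof -
    have "hall x y z \<in> null_seqs ultragraph_G" if x: "x \<in> cauchy_seqs ultragraph_G"
      "y \<in> cauchy_seqs ultragraph_G" "z \<in> cauchy_seqs ultragraph_G" for x y z
    proof (rule pointwise)
      show "hall x y z \<in> cauchy_seqs ultragraph_G"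
        unfolding hall_def by (intro CG.S_diff CG.S_mult x)
      show "hall x y z n \<in> leavitt_ideal ultragraph_G" for n
        using G.hall_G[OF carrier[OF x(1)] carrier[OF x(2)] carrier[OF x(3)], of n n n]
        by (simp add: hall_def)
    qed
    then have "hall (const x) (const y) (const z) \<in> null_seqs ?G"
      by (rule hall_transfer) (auto intro: cauchy_const[OF wfE] S)
    moreover have "hall (const x) (const y) (const z) = const (hall x y z)"
      by (simp add: hall_def fun_eq_iff)
    moreover have "hall x y z \<in> E.S"
      unfolding hall_def by (intro E.S_diff E.S_mult S)
    ultimately show ?thesis
      by (simp add: null_seqs_iff[OF wfE] seq_norm_const[OF wfE])
  qed
  have uS: "const (G.pW + pr {V}) \<in> cauchy_seqs ultragraph_G"
    by (intro cauchy_const[OF wf_ultragraph_G] G.S_add G.pr_S gv_G)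
  have "const (G.pW + pr {V}) * x - x \<in> null_seqs ultragraph_G" if x: "x \<in> cauchy_seqs ultragraph_G" for x
  proof (rule pointwise)
    show "const (G.pW + pr {V}) * x - x \<in> cauchy_seqs ultragraph_G"
      by (intro CG.S_diff CG.S_mult uS x)
    show "(const (G.pW + pr {V}) * x - x) n \<in> leavitt_ideal ultragraph_G" for n
      using G.cong_self_zero[OF G.unit(1)[OF carrier[OF x, of n]]] by simp
  qed
  then obtain u where u: "u \<in> cauchy_seqs ?G" "\<And>x. x \<in> cauchy_seqs ?G \<Longrightarrow> u * x - x \<in> null_seqs ?G"
    using unit_transfer[OF uS] by blast
  \<comment> \<open>The unit u is only a limit, while finite right support is known in the free
    algebra. A distance below 1 is enough: where y p_v vanishes, p_v = (u - y) p_v would have norm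
    less than its own unless it is zero.\<close>
  obtain y where y: "y \<in> E.S" "seq_norm ?G (u - const y) < 1"
    using seq_norm_dense[OF wfE u(1), of 1] by auto
  obtain F where F: "finite F" "\<And>v. v \<in> verts E - F \<Longrightarrow> y * pr {v} \<in> ?JE"
    using E.right_support[OF y(1)] by blast
  have F': "pr {v} \<in> ?JE" if v: "v \<in> verts E - F" for v
  proof -
    have p: "pr {v} \<in> E.S"
      using v by (intro E.vertex_S) auto
    have S: "const (pr {v}) \<in> cauchy_seqs ?G" "const y \<in> cauchy_seqs ?G"
      by (intro cauchy_const[OF wfE] p y)+
    have "const (y * pr {v}) \<in> null_seqs ?G"
      using F(2)[OF v] by (simp add: null_seqs_iff[OF wfE] seq_norm_const[OF wfE] cauchy_const[OF wfE])
    then have "const (y * pr {v}) - (u * const (pr {v}) - const (pr {v})) \<in> null_seqs ?G"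
      by (intro CE.J_diff u(2) S)
    moreover have "const (y * pr {v}) - (u * const (pr {v}) - const (pr {v}))
        = const (pr {v}) - (u - const y) * const (pr {v})"
      by (simp add: fun_eq_iff algebra_simps)
    moreover have "(u - const y) * const (pr {v}) \<in> cauchy_seqs ?G"
      by (intro CE.S_mult CE.S_diff S u(1))
    ultimately have "CE.cong (const (pr {v})) ((u - const y) * const (pr {v}))"
      using S(1) by (simp only: CE.cong_def simp_thms)
    then have "seq_norm ?G (const (pr {v})) = seq_norm ?G ((u - const y) * const (pr {v}))"
      by (rule seq_norm_cong[OF wfE])
    also have "\<dots> \<le> seq_norm ?G (u - const y) * seq_norm ?G (const (pr {v}))"
      by (intro seq_norm_mult[OF wfE] CE.S_diff S u(1))
    finally have le: "universal_norm ?G (pr {v}) \<le> seq_norm ?G (u - const y) * universal_norm ?G (pr {v})"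
      by (simp only: seq_norm_const[OF wfE p])
    have "universal_norm ?G (pr {v}) = 0"
    proof (rule ccontr)
      assume "universal_norm ?G (pr {v}) \<noteq> 0"
      then have "0 < universal_norm ?G (pr {v})"
        using un_nonneg[OF wfE p] by simp
      from mult_strict_right_mono[OF y(2) this] le show False
        by simp
    qed
    then show ?thesis
      using p by simp
  qed
  interpret cstar_graph E F
  proof
    show "finite F"
      by (rule F(1))
    show "v \<in> verts E - F \<Longrightarrow> pr {v} \<in> ?JE" for v
      by (rule F')
    show "finite {f \<in> arcs E. pr {head E f} \<notin> ?JE}"
      by (rule E.finite_essential_arcs[OF F(1) F' hall])
  qed
  let ?z = "\<lambda>n. const (G.central n)"
  have zS: "?z n \<in> cauchy_seqs ultragraph_G" for n
    by (intro cauchy_const[OF wf_ultragraph_G] G.central_S)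
  have z_nonnull: "?z n \<notin> null_seqs ultragraph_G" for n
    using universal_norm_central[of n] seq_norm_const[OF wf_ultragraph_G G.central_S]
    by (simp add: null_seqs_iff[OF wf_ultragraph_G] G.central_def)
  have z_central: "?z n * x - x * ?z n \<in> null_seqs ultragraph_G" if x: "x \<in> cauchy_seqs ultragraph_G" for n x
  proof (rule pointwise)
    show "?z n * x - x * ?z n \<in> cauchy_seqs ultragraph_G"
      by (intro CG.S_diff CG.S_mult zS x)
    show "(?z n * x - x * ?z n) k \<in> leavitt_ideal ultragraph_G" for k
      using G.cong_self_zero[OF G.central_commutes[OF carrier[OF x, of k], of n]] by simp
  qed
  have z_mult: "?z n * ?z m - (if n = m then ?z n else 0) \<in> null_seqs ultragraph_G" for n m
  proof (rule pointwise)
    show "?z n * ?z m - (if n = m then ?z n else 0) \<in> cauchy_seqs ultragraph_G"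
      using zS CG.S_zero by (intro CG.S_diff CG.S_mult) auto
    show "(?z n * ?z m - (if n = m then ?z n else 0)) k \<in> leavitt_ideal ultragraph_G" for k
      using G.cong_self_zero[OF G.central_mult[of n m]] by (cases "n = m") simp_all
  qed
  obtain z' where z': "\<And>n. z' n \<in> cauchy_seqs ?G" "\<And>n :: nat. z' n \<notin> null_seqs ?G"
    "\<And>n x. x \<in> cauchy_seqs ?G \<Longrightarrow> z' n * x - x * z' n \<in> null_seqs ?G"
    "\<And>n m. z' n * z' m - (if n = m then z' n else 0) \<in> null_seqs ?G"
    using central_idempotents_transfer[of ?z, OF zS z_nonnull z_central z_mult] by blast
  have "central_idempotent (z' n)" for n
    using z'(1)[of n] z'(3)[of _ n] z'(4)[of n n] unfolding central_idempotent_def CE.cong_def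
    by (auto intro: CE.S_mult)
  moreover have "z' n * z' m \<in> null_seqs ?G" if "n \<noteq> m" for n m
    using z'(4)[of n m] that by simp
  ultimately show False
    using no_infinite_family_of_central_idempotents z'(2) by blast
qed


theorem proposition8p6:
  fixes E :: "('v, 'e) pre_digraph"
  assumes "wf_digraph E" and "countable (verts E)" and "countable (arcs E)"
  shows "\<not> alg_isomorphic (ultragraph_leavitt_algebra TYPE('k::field) ultragraph_G)
             (leavitt_path_algebra TYPE('k) E)
       \<and> \<not> star_isomorphic (ultragraph_cstar_algebra ultragraph_G) (graph_cstar_algebra E)"
  using leavitt_not_isomorphic[OF assms(1)] cstar_not_isomorphic[OF assms(1)] by blast

end
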